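(* Let $a,m\in\mathbb{R}$ and let $u$ be the solution of the damped stochastic Klein-Gordon equation $(\partial_{tt}-\partial_{xx}+a\partial_t+m^2)u=\dot W$ on $t>0$, $x\in\mathbb{R}$, with $u(0,x)=\partial_t u(0,x)=0$. Fix $w_0\ge 0$ and $0<a_1<a_2$, and consider the line segment $$I=\left\{(t,x)\in(0,\infty)\times\mathbb{R}:\ \tfrac{t-x}{\sqrt2}=w_0,\ \tfrac{t+x}{\sqrt2}\in[a_1,a_2]\right\}.$$ Then there exist constants $0<C_1<C_2<\infty$ depending on $(w_0,a_1,a_2)$ such that for every sub-interval (of positive length) $J$ of $I$, there exists a (deterministic) constant $K_J\in[C_1,C_2]$ such that $$\limsup_{h\to0^+}\ \sup_{(t,x)\in J}\frac{|u(t+h,x+h)-u(t,x)|}{\sqrt{h\log(1/h)}}=K_J\quad\text{almost surely.}$$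
   Context: $\dot W$ is Gaussian space-time white noise on $[0,\infty)\times\mathbb{R}$, defined on a complete probability space $(\Omega,\mathscr{F},\mathbb{P})$. The solution is the mild solution in the sense of Walsh, $$u(t,x)=\int_0^t\int_{-\infty}^\infty G(t-s,x-y)\,W(ds,dy),$$ a centered Gaussian random field, where $G$ is the fundamental solution of $\partial_{tt}-\partial_{xx}+a\partial_t+m^2$. Explicitly, the spatial Fourier transform $\hat G(t,\xi)=\int_{\mathbb{R}}G(t,x)e^{-ix\xi}dx$ is: $e^{-at/2}\,\frac{\sin(t\sqrt{\xi^2+m^2-a^2/4})}{\sqrt{\xi^2+m^2-a^2/4}}$ if $\xi^2>\frac{a^2}{4}-m^2$; $te^{-at/2}$ if $\xi^2=\frac{a^2}{4}-m^2$; and $e^{-at/2}\,\frac{\sinh(t\sqrt{a^2/4-m^2-\xi^2})}{\sqrt{a^2/4-m^2-\xi^2}}$ if $\xi^2<\frac{a^2}{4}-m^2$. The field $u$ is taken to be its version with almost surely continuous sample paths on $[0,\infty)\times\mathbb{R}$. The constants $C_1,C_2,K_J$ may also depend on the parameters $a,m$ of the equation. A sub-interval $J$ of $I$ is a connected subset of the segment $I$ containing more than one point. *)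

theory Defs
  imports "HOL-Probability.Probability"
begin

text \<open>Almost surely constant variables count as (degenerate) Gaussian ones.\<close>

definition gaussian_rv :: "'w measure \<Rightarrow> ('w \<Rightarrow> real) \<Rightarrow> bool" where
  "gaussian_rv M X \<longleftrightarrow> X \<in> borel_measurable M \<and>
     ((\<exists>\<mu> \<sigma>. 0 < \<sigma> \<and> distributed M lborel X (normal_density \<mu> \<sigma>)) \<or>
      (\<exists>\<mu>. AE \<omega> in M. X \<omega> = \<mu>))"

text \<open>Points of space-time are pairs \<open>(t, x)\<close>, time first.\<close>

definition noise_sets :: "(real \<times> real) set set" where
  "noise_sets = {A \<in> sets borel. A \<subseteq> {0..} \<times> UNIV \<and> emeasure lborel A < \<infinity>}"

text \<open>White noise is a centered Gaussian family indexed by the Borel sets of finite Lebesgue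
  measure, with covariance \<open>E[W(A) W(B)] = |A \<inter> B|\<close>. Joint normality is expressed by
  normality of all finite linear combinations.\<close>

definition white_noise :: "'w measure \<Rightarrow> ((real \<times> real) set \<Rightarrow> 'w \<Rightarrow> real) \<Rightarrow> bool" where
  "white_noise M W \<longleftrightarrow>
     (\<forall>\<A> c. finite \<A> \<longrightarrow> \<A> \<subseteq> noise_sets \<longrightarrow> gaussian_rv M (\<lambda>\<omega>. \<Sum>A\<in>\<A>. c A * W A \<omega>)) \<and>
     (\<forall>A\<in>noise_sets. (\<integral>\<omega>. W A \<omega> \<partial>M) = 0) \<and>
     (\<forall>A\<in>noise_sets. \<forall>B\<in>noise_sets. (\<integral>\<omega>. W A \<omega> * W B \<omega> \<partial>M) = measure lborel (A \<inter> B))"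

text \<open>\<open>X\<close> is (a version of) the integral of the deterministic function \<open>f\<close> against \<open>W\<close>:
  the \<open>L\<^sup>2\<close>-limit of the integrals of simple functions that approximate \<open>f\<close> in \<open>L\<^sup>2\<close>.
  For deterministic integrands this is the Walsh integral. The integrand lives on
  \<open>[0,\<infinity>) \<times> \<real>\<close>, and has to vanish for negative times.\<close>

definition has_noise_integral ::
  "'w measure \<Rightarrow> ((real \<times> real) set \<Rightarrow> 'w \<Rightarrow> real) \<Rightarrow> (real \<times> real \<Rightarrow> real) \<Rightarrow> ('w \<Rightarrow> real) \<Rightarrow> bool" where
  "has_noise_integral M W f X \<longleftrightarrow>
     f \<in> borel_measurable borel \<and> X \<in> borel_measurable M \<and>
     (\<exists>\<A> c. (\<forall>n::nat. finite (\<A> n) \<and> \<A> n \<subseteq> noise_sets) \<and>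
       (\<lambda>n. \<integral>\<^sup>+p. ennreal ((f p - (\<Sum>A\<in>\<A> n. c n A * indicator A p))\<^sup>2) \<partial>lborel) \<longlonglongrightarrow> 0 \<and>
       (\<lambda>n. \<integral>\<^sup>+\<omega>. ennreal ((X \<omega> - (\<Sum>A\<in>\<A> n. c n A * W A \<omega>))\<^sup>2) \<partial>M) \<longlonglongrightarrow> 0)"

definition G_hat :: "real \<Rightarrow> real \<Rightarrow> real \<Rightarrow> real \<Rightarrow> real" where
  "G_hat a m t \<xi> =
     (if \<xi>\<^sup>2 > a\<^sup>2 / 4 - m\<^sup>2 then
        exp (- a * t / 2) * (sin (t * sqrt (\<xi>\<^sup>2 + m\<^sup>2 - a\<^sup>2 / 4)) / sqrt (\<xi>\<^sup>2 + m\<^sup>2 - a\<^sup>2 / 4))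
      else if \<xi>\<^sup>2 = a\<^sup>2 / 4 - m\<^sup>2 then
        t * exp (- a * t / 2)
      else
        exp (- a * t / 2) * (sinh (t * sqrt (a\<^sup>2 / 4 - m\<^sup>2 - \<xi>\<^sup>2)) / sqrt (a\<^sup>2 / 4 - m\<^sup>2 - \<xi>\<^sup>2)))"

text \<open>The fundamental solution of \<open>\<partial>\<^sub>t\<^sub>t - \<partial>\<^sub>x\<^sub>x + a \<partial>\<^sub>t + m\<^sup>2\<close> is specified by its spatial
  Fourier transform. This determines \<open>G t\<close>, for \<open>t > 0\<close>, up to a Lebesgue null set, which
  has no influence on stochastic integrals; values for \<open>t \<le> 0\<close> are irrelevant.\<close>

definition fundamental_solution :: "real \<Rightarrow> real \<Rightarrow> (real \<Rightarrow> real \<Rightarrow> real) \<Rightarrow> bool" where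
  "fundamental_solution a m G \<longleftrightarrow>
     (\<lambda>(t, x). G t x) \<in> borel_measurable borel \<and>
     (\<forall>t>0. integrable lborel (G t) \<and>
        (\<forall>\<xi>. (\<integral>x. complex_of_real (G t x) * exp (- \<i> * complex_of_real (x * \<xi>)) \<partial>lborel)
              = complex_of_real (G_hat a m t \<xi>)))"

text \<open>Mild solution with zero initial data, in a version with almost surely continuous paths.
  Only the values \<open>u (t, x)\<close> with \<open>t \<ge> 0\<close> matter.\<close>

definition mild_solution ::
  "real \<Rightarrow> real \<Rightarrow> 'w measure \<Rightarrow> ((real \<times> real) set \<Rightarrow> 'w \<Rightarrow> real) \<Rightarrow> (real \<times> real \<Rightarrow> 'w \<Rightarrow> real) \<Rightarrow> bool" where
  "mild_solution a m M W u \<longleftrightarrow>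
     (\<exists>G. fundamental_solution a m G \<and>
       (\<forall>t\<ge>0. \<forall>x. has_noise_integral M W
          (\<lambda>(s, y). indicator {0..t} s * G (t - s) (x - y)) (u (t, x)))) \<and>
     (AE \<omega> in M. continuous_on ({0..} \<times> UNIV) (\<lambda>p. u p \<omega>))"

definition char_segment :: "real \<Rightarrow> real \<Rightarrow> real \<Rightarrow> (real \<times> real) set" where
  "char_segment w\<^sub>0 a\<^sub>1 a\<^sub>2 =
     {(t, x). 0 < t \<and> (t - x) / sqrt 2 = w\<^sub>0 \<and> (t + x) / sqrt 2 \<in> {a\<^sub>1..a\<^sub>2}}"

definition subinterval_of :: "(real \<times> real) set \<Rightarrow> (real \<times> real) set \<Rightarrow> bool" where
  "subinterval_of J I \<longleftrightarrow> J \<subseteq> I \<and> connected J \<and> (\<exists>p\<in>J. \<exists>q\<in>J. p \<noteq> q)"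

end

theory Submission imports Defs begin

text \<open>
  Put \<open>c = \<surd>2 w\<^sub>0\<close> and follow the solution along the characteristic that carries the segment,
  \<open>X t = u (t, t - c)\<close>. The fundamental solution is supported in the light cone, where it equals
  \<open>1/2 exp (- a t / 2) F (t\<^sup>2 - x\<^sup>2)\<close> with an entire function \<open>F\<close>, \<open>F 0 = 1\<close>; so it jumps by
  \<open>1/2 exp (- a t / 2)\<close> across the boundary of the cone. The backward cones of the points at times
  \<open>t\<close> and \<open>t + h\<close> share one edge and differ by the strip \<open>2 t - c < s + y \<le> 2 (t + h) - c\<close>.
  Therefore \<open>X (t + h) - X t\<close> is the integral of white noise over that strip, with an
  integrand of order one, plus the integral over the old cone of a difference of order \<open>h\<close>. The first
  part has variance \<open>h/2 \<integral>\<^sub>0\<^sup>t exp (- a r) dr + O(h\<^sup>2)\<close>, the second part \<open>O(h\<^sup>2)\<close>, and the first parts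
  that belong to disjoint time intervals are independent because their strips are disjoint.

  Hence \<open>X\<close> is, up to a smoother error, a Brownian motion with variance rate
  \<open>\<kappa> t / 2\<close>, \<open>\<kappa> t = \<integral>\<^sub>0\<^sup>t exp (- a r) dr\<close>, and the argument for Levy's modulus of
  continuity gives the constant explicitly. As \<open>\<kappa>\<close> increases, the right end of \<open>J\<close> is
  decisive: with \<open>\<beta>\<close> the supremum of the time coordinates of \<open>J\<close>, the limit is
  \<open>K\<^sub>J = \<surd>(2 \<cdot> \<kappa> \<beta> / 2) = \<surd>(\<kappa> \<beta>)\<close>. The values of \<open>\<surd>\<kappa>\<close> at the two ends of the full segment
  serve as \<open>C\<^sub>1\<close> and \<open>C\<^sub>2\<close>; they are positive because the segment stays away from \<open>t = 0\<close>.

  The kernel is only known through its Fourier transform. It is identified in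
  \<open>fundamental_solution_eq_green\<close>; the variances are computed in
  \<open>char_increment_estimates\<close>. The upper bound (\<open>gaussian_modulus_upper\<close>) rests on Gaussian tails, through
  a union bound over a dyadic grid and chaining between grid points. The lower bound
  (\<open>gaussian_modulus_lower\<close>) is a second moment argument for the number of large strip integrals, for
  which pairwise independence is enough. \<open>char_modulus\<close> combines the two.
\<close>

section \<open>Gaussian variables through characteristic functions\<close>

text \<open>A weight of mean one turns \<open>M\<close> into another probability measure; the hypothesis says that \<open>X\<close> has the
  same characteristic function under both, hence the same law. This is how independence will be
  read off from one-dimensional characteristic functions.\<close>

lemma weighted_Levy_uniqueness:
  assumes "prob_space M" and X[measurable]: "X \<in> borel_measurable M"
    and w[measurable]: "w \<in> borel_measurable M" and w0: "\<And>\<omega>. 0 \<le> w \<omega>" and wb: "\<And>\<omega>. w \<omega> \<le> b"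
    and w1: "(\<integral>\<omega>. w \<omega> \<partial>M) = 1"
    and ch: "\<And>s. (CLINT \<omega>|M. of_real (w \<omega>) * iexp (s * X \<omega>)) = (CLINT \<omega>|M. iexp (s * X \<omega>))"
    and A: "A \<in> sets borel"
  shows "(\<integral>\<omega>. w \<omega> * indicator A (X \<omega>) \<partial>M) = measure M {\<omega>\<in>space M. X \<omega> \<in> A}"
proof -
  interpret prob_space M by fact
  have wi: "integrable M w"
    by (rule integrable_const_bound[of _ b]) (use w0 wb in auto)
  have N: "prob_space (density M w)"
    by (rule prob_spaceI) (use w0 wi w1 in \<open>simp add: emeasure_density nn_integral_eq_integral\<close>)
  interpret N: prob_space "density M w" by fact
  have e: "distr (density M w) borel X = distr M borel X"
  proof (rule Levy_uniqueness)
    show "real_distribution (distr (density M w) borel X)" "real_distribution (distr M borel X)"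
      by (auto intro!: N.real_distribution_distr real_distribution_distr)
    show "char (distr (density M w) borel X) = char (distr M borel X)"
    proof
      fix s
      have "char (distr (density M w) borel X) s = (CLINT \<omega>|M. w \<omega> *\<^sub>R iexp (s * X \<omega>))"
        unfolding char_def by (subst integral_distr; simp) (subst integral_density; use w0 in simp)
      also have "\<dots> = char (distr M borel X) s"
        unfolding char_def using ch[of s] by (subst integral_distr; simp add: scaleR_conv_of_real)
      finally show "char (distr (density M w) borel X) s = char (distr M borel X) s" .
    qed
  qed
  have "(\<integral>\<omega>. w \<omega> * indicator A (X \<omega>) \<partial>M) = (\<integral>\<omega>. indicator A (X \<omega>) \<partial>density M w)"
    using A by (subst integral_density) (use w0 in auto)
  also have "\<dots> = (\<integral>x. indicator A x \<partial>distr (density M w) borel X)"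
    using A by (subst integral_distr) auto
  also have "\<dots> = measure M (X -` A \<inter> space M)"
    unfolding e using A by (simp add: measure_distr)
  finally show ?thesis by (simp add: vimage_def Int_def conj_commute)
qed

text \<open>Two applications of uniqueness in one dimension. Weighting with trigonometric functions of \<open>Y\<close>
  (shifted by 2 to be positive) shows that \<open>E[1\<^sub>A(X) exp (i t Y)]\<close> factorises for every Borel set \<open>A\<close>;
  then the law of \<open>Y\<close> conditioned on \<open>X \<in> A\<close> has the characteristic function of \<open>Y\<close>.\<close>

lemma independent_of_char_product:
  assumes "prob_space M" and X[measurable]: "X \<in> borel_measurable M" and Y[measurable]: "Y \<in> borel_measurable M"
    and ch: "\<And>s t. (CLINT \<omega>|M. iexp (s * X \<omega> + t * Y \<omega>)) = (CLINT \<omega>|M. iexp (s * X \<omega>)) * (CLINT \<omega>|M. iexp (t * Y \<omega>))"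
    and A[measurable]: "A \<in> sets borel" and B[measurable]: "B \<in> sets borel"
  shows "measure M {\<omega>\<in>space M. X \<omega> \<in> A \<and> Y \<omega> \<in> B}
    = measure M {\<omega>\<in>space M. X \<omega> \<in> A} * measure M {\<omega>\<in>space M. Y \<omega> \<in> B}"
proof -
  interpret prob_space M by fact
  have int[simp]: "integrable M (\<lambda>\<omega>. iexp (s * X \<omega> + t * Y \<omega>))" for s t
    by (rule integrable_iexp) auto
  have intX[simp]: "integrable M (\<lambda>\<omega>. iexp (s * X \<omega>))" for s
    using int[of s 0] by simp
  have intY[simp]: "integrable M (\<lambda>\<omega>. iexp (s * Y \<omega>))" for s
    using int[of 0 s] by simp
  define \<phi> where "\<phi> t = (CLINT \<omega>|M. iexp (t * Y \<omega>))" for t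
  have ic[simp]: "integrable M (\<lambda>\<omega>. cos (t * Y \<omega>))" "integrable M (\<lambda>\<omega>. sin (t * Y \<omega>))" for t
    by (auto intro!: integrable_const_bound[of _ 1])
  have \<phi>c: "(\<integral>\<omega>. cos (t * Y \<omega>) \<partial>M) = Re (\<phi> t)" "(\<integral>\<omega>. sin (t * Y \<omega>) \<partial>M) = Im (\<phi> t)" for t
    unfolding \<phi>_def using integral_Re[OF intY, of t] integral_Im[OF intY, of t]
    by (simp_all add: Re_exp Im_exp)
  have \<phi>m: "\<phi> (-t) = cnj (\<phi> t)" for t
    by (simp add: complex_eq_iff flip: \<phi>c)
  have \<phi>1: "\<bar>Re (\<phi> t)\<bar> \<le> 1" "\<bar>Im (\<phi> t)\<bar> \<le> 1" for t
  proof -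
    have "norm (\<phi> t) \<le> (\<integral>\<omega>. norm (iexp (t * Y \<omega>)) \<partial>M)"
      unfolding \<phi>_def by (rule integral_norm_bound)
    also have "\<dots> = 1" by (simp add: prob_space)
    finally show "\<bar>Re (\<phi> t)\<bar> \<le> 1" "\<bar>Im (\<phi> t)\<bar> \<le> 1"
      using abs_Re_le_cmod[of "\<phi> t"] abs_Im_le_cmod[of "\<phi> t"] by linarith+
  qed
  let ?P = "measure M {\<omega>\<in>space M. X \<omega> \<in> A}"
  have iA: "integrable M (\<lambda>\<omega>. g \<omega> * indicator A (X \<omega>))" if "integrable M g" for g :: "_ \<Rightarrow> real"
    by (rule Bochner_Integration.integrable_bound[OF that])
       (use that in \<open>auto simp: indicator_def split: if_splits intro!: borel_measurable_times\<close>)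
  have EA: "(\<integral>\<omega>. indicator A (X \<omega>) \<partial>M) = ?P"
  proof -
    have "(\<integral>\<omega>. indicator A (X \<omega>) \<partial>M) = (\<integral>\<omega>. indicat_real {\<omega>\<in>space M. X \<omega> \<in> A} \<omega> \<partial>M)"
      by (rule Bochner_Integration.integral_cong) (auto simp: indicator_def)
    then show ?thesis by simp
  qed
  have key: "(\<integral>\<omega>. g \<omega> * indicator A (X \<omega>) \<partial>M) = ?P * (\<integral>\<omega>. g \<omega> \<partial>M)"
    if g[measurable]: "g \<in> borel_measurable M" and gb: "\<And>\<omega>. \<bar>g \<omega>\<bar> \<le> 1"
      and gch: "\<And>s. (CLINT \<omega>|M. of_real (g \<omega>) * iexp (s * X \<omega>))
               = of_real (\<integral>\<omega>. g \<omega> \<partial>M) * (CLINT \<omega>|M. iexp (s * X \<omega>))" for g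
  proof -
    have gi: "integrable M g" by (rule integrable_const_bound[of _ 1]) (use gb in auto)
    have gii: "integrable M (\<lambda>\<omega>. of_real (g \<omega>) * iexp (s * X \<omega>))" for s
      by (rule integrable_const_bound[of _ 1]) (use gb in \<open>auto simp: norm_mult\<close>)
    have "\<bar>\<integral>\<omega>. g \<omega> \<partial>M\<bar> \<le> (\<integral>\<omega>. \<bar>g \<omega>\<bar> \<partial>M)"
      by (rule integral_abs_bound)
    also have "\<dots> \<le> (\<integral>\<omega>. 1 \<partial>M)"
      by (rule integral_mono) (use gb gi in auto)
    finally have g1: "\<bar>\<integral>\<omega>. g \<omega> \<partial>M\<bar> \<le> 1" by (simp add: prob_space)
    define d where "d = 2 + (\<integral>\<omega>. g \<omega> \<partial>M)"
    have d: "d \<ge> 1" using g1 by (simp add: d_def)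
    have "(\<integral>\<omega>. (2 + g \<omega>) / d * indicator A (X \<omega>) \<partial>M) = ?P"
    proof (rule weighted_Levy_uniqueness[OF \<open>prob_space M\<close> X, where b="3"])
      show "0 \<le> (2 + g \<omega>) / d" for \<omega> using gb[of \<omega>] d by (auto intro!: divide_nonneg_pos)
      show "(2 + g \<omega>) / d \<le> 3" for \<omega> using gb[of \<omega>] d by (auto simp: field_simps)
      show "(\<integral>\<omega>. (2 + g \<omega>) / d \<partial>M) = 1" using gi d by (simp add: prob_space d_def)
      fix s
      have "(CLINT \<omega>|M. of_real ((2 + g \<omega>) / d) * iexp (s * X \<omega>))
        = (CLINT \<omega>|M. (2 * iexp (s * X \<omega>) + of_real (g \<omega>) * iexp (s * X \<omega>)) / d)"
        by (simp add: field_simps)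
      also have "\<dots> = (CLINT \<omega>|M. 2 * iexp (s * X \<omega>) + of_real (g \<omega>) * iexp (s * X \<omega>)) / d"
        by simp
      also have "\<dots> = (2 + of_real (\<integral>\<omega>. g \<omega> \<partial>M)) * (CLINT \<omega>|M. iexp (s * X \<omega>)) / d"
        by (subst Bochner_Integration.integral_add[OF integrable_mult_right[OF intX] gii])
           (simp only: gch integral_mult_right_zero ring_distribs)
      also have "\<dots> = (CLINT \<omega>|M. iexp (s * X \<omega>))"
      proof -
        have "(2 + of_real (\<integral>\<omega>. g \<omega> \<partial>M) :: complex) = of_real d" by (simp add: d_def)
        then show ?thesis using d by simp
      qed
      finally show "(CLINT \<omega>|M. of_real ((2 + g \<omega>) / d) * iexp (s * X \<omega>)) = (CLINT \<omega>|M. iexp (s * X \<omega>))" .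
    qed auto
    moreover have "(\<integral>\<omega>. (2 + g \<omega>) / d * indicator A (X \<omega>) \<partial>M)
       = (\<integral>\<omega>. (2 * indicator A (X \<omega>) + g \<omega> * indicator A (X \<omega>)) / d \<partial>M)"
      by (simp add: field_simps)
    moreover have "\<dots> = (2 * ?P + (\<integral>\<omega>. g \<omega> * indicator A (X \<omega>) \<partial>M)) / d"
    proof -
      have 1: "integrable M (\<lambda>\<omega>. 2 * indicator A (X \<omega>) :: real)" using iA[of "\<lambda>_. 2"] by simp
      have "(\<integral>\<omega>. 2 * indicator A (X \<omega>) + g \<omega> * indicator A (X \<omega>) \<partial>M)
        = 2 * ?P + (\<integral>\<omega>. g \<omega> * indicator A (X \<omega>) \<partial>M)"
        by (subst Bochner_Integration.integral_add[OF 1 iA[OF gi]]) (simp add: EA)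
      then show ?thesis by simp
    qed
    ultimately show ?thesis using d by (simp add: d_def field_simps)
  qed
  \<comment> \<open>\<open>cos\<close> and \<open>sin\<close> are combinations of the characters at \<open>t\<close> and \<open>-t\<close>, for which the
    transform of the pair factorises.\<close>
  have cosE: "(CLINT \<omega>|M. of_real (cos (t * Y \<omega>)) * iexp (s * X \<omega>)) = of_real (Re (\<phi> t)) * (CLINT \<omega>|M. iexp (s * X \<omega>))" for s t
  proof -
    have "(CLINT \<omega>|M. of_real (cos (t * Y \<omega>)) * iexp (s * X \<omega>))
       = (CLINT \<omega>|M. (iexp (s * X \<omega> + t * Y \<omega>) + iexp (s * X \<omega> + (-t) * Y \<omega>)) / 2)"
      by (rule Bochner_Integration.integral_cong)
         (simp_all add: cos_exp_eq exp_add exp_diff exp_minus field_simps flip: cos_of_real)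
    also have "\<dots> = ((CLINT \<omega>|M. iexp (s * X \<omega> + t * Y \<omega>)) + (CLINT \<omega>|M. iexp (s * X \<omega> + (-t) * Y \<omega>))) / 2"
      by (subst Bochner_Integration.integral_add[symmetric]) (simp_all only: int integral_divide_zero)
    also have "\<dots> = (CLINT \<omega>|M. iexp (s * X \<omega>)) * ((\<phi> t + \<phi> (-t)) / 2)"
      by (simp only: ch \<phi>_def) (simp add: field_simps)
    also have "(\<phi> t + \<phi> (-t)) / 2 = of_real (Re (\<phi> t))"
      by (simp add: \<phi>m complex_eq_iff)
    finally show ?thesis by simp
  qed
  have sinE: "(CLINT \<omega>|M. of_real (sin (t * Y \<omega>)) * iexp (s * X \<omega>)) = of_real (Im (\<phi> t)) * (CLINT \<omega>|M. iexp (s * X \<omega>))" for s t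
  proof -
    have "(CLINT \<omega>|M. of_real (sin (t * Y \<omega>)) * iexp (s * X \<omega>))
       = (CLINT \<omega>|M. (iexp (s * X \<omega> + t * Y \<omega>) - iexp (s * X \<omega> + (-t) * Y \<omega>)) / (2 * \<i>))"
      by (rule Bochner_Integration.integral_cong)
         (simp_all add: sin_exp_eq exp_add exp_diff exp_minus field_simps flip: sin_of_real)
    also have "\<dots> = ((CLINT \<omega>|M. iexp (s * X \<omega> + t * Y \<omega>)) - (CLINT \<omega>|M. iexp (s * X \<omega> + (-t) * Y \<omega>))) / (2 * \<i>)"
      by (subst Bochner_Integration.integral_diff[symmetric]) (simp_all only: int integral_divide_zero)
    also have "\<dots> = (CLINT \<omega>|M. iexp (s * X \<omega>)) * ((\<phi> t - \<phi> (-t)) / (2 * \<i>))"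
      by (simp only: ch \<phi>_def) (simp add: field_simps)
    also have "(\<phi> t - \<phi> (-t)) / (2 * \<i>) = of_real (Im (\<phi> t))"
      by (simp add: \<phi>m complex_eq_iff)
    finally show ?thesis by simp
  qed
  have kc: "(\<integral>\<omega>. cos (t * Y \<omega>) * indicator A (X \<omega>) \<partial>M) = ?P * Re (\<phi> t)" for t
    using key[of "\<lambda>\<omega>. cos (t * Y \<omega>)"] cosE[of t] by (simp add: \<phi>c)
  have ks: "(\<integral>\<omega>. sin (t * Y \<omega>) * indicator A (X \<omega>) \<partial>M) = ?P * Im (\<phi> t)" for t
    using key[of "\<lambda>\<omega>. sin (t * Y \<omega>)"] sinE[of t] by (simp add: \<phi>c)
  have kA: "(CLINT \<omega>|M. of_real (indicator A (X \<omega>)) * iexp (t * Y \<omega>)) = of_real ?P * \<phi> t" for t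
  proof -
    have i: "integrable M (\<lambda>\<omega>. of_real (indicator A (X \<omega>)) * iexp (t * Y \<omega>))"
      by (rule integrable_const_bound[of _ 1]) (auto simp: norm_mult indicator_def)
    show ?thesis
      unfolding complex_eq_iff
      using integral_Re[OF i] integral_Im[OF i] kc[of t] ks[of t]
      by (simp add: Re_exp Im_exp mult.commute)
  qed
  show ?thesis
  proof (cases "?P = 0")
    case True
    have "measure M {\<omega>\<in>space M. X \<omega> \<in> A \<and> Y \<omega> \<in> B} \<le> ?P"
      by (rule finite_measure_mono) auto
    then show ?thesis using True by (simp add: measure_le_0_iff)
  next
    case False
    then have p: "?P > 0" by (simp add: zero_less_measure_iff)
    have "(\<integral>\<omega>. indicator A (X \<omega>) / ?P * indicator B (Y \<omega>) \<partial>M) = measure M {\<omega>\<in>space M. Y \<omega> \<in> B}"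
    proof (rule weighted_Levy_uniqueness[OF \<open>prob_space M\<close> Y, where b="1 / ?P"])
      show "(\<integral>\<omega>. indicator A (X \<omega>) / ?P \<partial>M) = 1" using EA p by simp
      fix s
      have "(CLINT \<omega>|M. of_real (indicator A (X \<omega>) / ?P) * iexp (s * Y \<omega>))
        = (CLINT \<omega>|M. of_real (indicator A (X \<omega>)) * iexp (s * Y \<omega>) / of_real ?P)" by simp
      also have "\<dots> = \<phi> s"
        unfolding integral_divide_zero kA using p by simp
      finally show "(CLINT \<omega>|M. of_real (indicator A (X \<omega>) / ?P) * iexp (s * Y \<omega>)) = (CLINT \<omega>|M. iexp (s * Y \<omega>))"
        by (simp add: \<phi>_def)
    qed (use p in \<open>auto simp: indicator_def field_simps\<close>)
    moreover have "(\<integral>\<omega>. indicator A (X \<omega>) / ?P * indicator B (Y \<omega>) \<partial>M)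
      = (\<integral>\<omega>. indicator {\<omega>\<in>space M. X \<omega> \<in> A \<and> Y \<omega> \<in> B} \<omega> / ?P \<partial>M)"
      by (rule Bochner_Integration.integral_cong) (auto simp: indicator_def)
    ultimately show ?thesis using p by (simp add: field_simps)
  qed
qed

text \<open>Prescribing the characteristic function includes the degenerate case \<open>v = 0\<close> and makes the
  notion stable under \<open>L\<^sup>2\<close>-limits.\<close>

definition centered_gaussian :: "'w measure \<Rightarrow> ('w \<Rightarrow> real) \<Rightarrow> real \<Rightarrow> bool" where
  "centered_gaussian M X v \<longleftrightarrow> X \<in> borel_measurable M \<and> 0 \<le> v \<and>
     (\<forall>t. (CLINT \<omega>|M. iexp (t * X \<omega>)) = of_real (exp (- (v * t\<^sup>2) / 2)))"

lemma centered_gaussian_distr: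
  assumes "prob_space M" "centered_gaussian M X v"
  shows "distr M borel X = distr std_normal_distribution borel (\<lambda>z. sqrt v * z)"
proof (rule Levy_uniqueness)
  interpret prob_space M by fact
  interpret N: real_distribution std_normal_distribution by (rule real_dist_normal_dist)
  have [measurable]: "X \<in> borel_measurable M" using assms(2) by (simp add: centered_gaussian_def)
  show "real_distribution (distr M borel X)"
      "real_distribution (distr std_normal_distribution borel (\<lambda>z. sqrt v * z))"
    by (auto intro!: real_distribution_distr N.real_distribution_distr)
  show "char (distr M borel X) = char (distr std_normal_distribution borel (\<lambda>z. sqrt v * z))"
  proof
    fix t
    have "char (distr M borel X) t = of_real (exp (- (v * t\<^sup>2) / 2))"
      unfolding char_def using assms(2) by (subst integral_distr) (auto simp: centered_gaussian_def)
    also have "\<dots> = char std_normal_distribution (t * sqrt v)"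
      using assms(2) by (simp add: char_std_normal_distribution power_mult_distrib centered_gaussian_def mult.commute)
    also have "\<dots> = char (distr std_normal_distribution borel (\<lambda>z. sqrt v * z)) t"
      unfolding char_def by (subst integral_distr) (auto simp: mult_ac)
    finally show "char (distr M borel X) t = char (distr std_normal_distribution borel (\<lambda>z. sqrt v * z)) t" .
  qed
qed

text \<open>Beyond \<open>b\<close> the density at \<open>x\<close> is at most \<open>exp (- b\<^sup>2 / 2)\<close> times the density translated to \<open>b\<close>.\<close>

lemma std_normal_halfline_le:
  assumes "0 \<le> b"
  shows "measure std_normal_distribution {b<..} \<le> exp (- b\<^sup>2 / 2)"
    and "measure std_normal_distribution {..<-b} \<le> exp (- b\<^sup>2 / 2)"
proof -
  interpret N: real_distribution std_normal_distribution by (rule real_dist_normal_dist)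
  have shift: "measure std_normal_distribution A \<le> exp (- b\<^sup>2 / 2)"
    if A: "A \<in> sets borel" and le: "\<And>x. x \<in> A \<Longrightarrow> std_normal_density x \<le> exp (- b\<^sup>2 / 2) * normal_density \<mu> 1 x" for A \<mu>
  proof -
    have "emeasure std_normal_distribution A = (\<integral>\<^sup>+x. ennreal (std_normal_density x) * indicator A x \<partial>lborel)"
      using A by (simp add: emeasure_density)
    also have "\<dots> \<le> (\<integral>\<^sup>+x. ennreal (exp (- b\<^sup>2 / 2)) * ennreal (normal_density \<mu> 1 x) \<partial>lborel)"
    proof (rule nn_integral_mono)
      fix x show "ennreal (std_normal_density x) * indicator A x \<le> ennreal (exp (- b\<^sup>2 / 2)) * ennreal (normal_density \<mu> 1 x)"
        using le[of x] by (auto simp: indicator_def simp flip: ennreal_mult intro!: ennreal_leI)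
    qed
    also have "\<dots> = ennreal (exp (- b\<^sup>2 / 2)) * (\<integral>\<^sup>+x. ennreal (normal_density \<mu> 1 x) \<partial>lborel)"
      by (simp add: nn_integral_cmult)
    also have "(\<integral>\<^sup>+x. ennreal (normal_density \<mu> 1 x) \<partial>lborel) = 1"
      using prob_space.emeasure_space_1[OF prob_space_normal_density[of 1 \<mu>]] by (simp add: emeasure_density)
    finally show ?thesis by (simp add: measure_def enn2real_leI)
  qed
  have e: "std_normal_density x = exp (- b\<^sup>2 / 2) * exp (- c * (x - c)) * normal_density c 1 x" if "c\<^sup>2 = b\<^sup>2" for x c
  proof -
    have "std_normal_density x = 1 / sqrt (2 * pi) * exp (- x\<^sup>2 / 2)" by (simp add: std_normal_density_def)
    also have "- x\<^sup>2 / 2 = - b\<^sup>2 / 2 + (- c * (x - c)) + (- (x - c)\<^sup>2 / 2)"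
      using that by (simp add: power2_eq_square field_simps)
    finally show ?thesis by (simp only: exp_add) (simp add: normal_density_def)
  qed
  show "measure std_normal_distribution {b<..} \<le> exp (- b\<^sup>2 / 2)"
  proof (rule shift[of _ b])
    fix x assume "x \<in> {b<..}"
    then have "0 \<le> b * (x - b)" using assms by simp
    then have "exp (- b * (x - b)) \<le> 1" by simp
    then show "std_normal_density x \<le> exp (- b\<^sup>2 / 2) * normal_density b 1 x"
      unfolding e[of b x, OF refl] by (auto intro!: mult_left_le_one_le)
  qed simp
  show "measure std_normal_distribution {..<-b} \<le> exp (- b\<^sup>2 / 2)"
  proof (rule shift[of _ "-b"])
    fix x assume "x \<in> {..<-b}"
    then have "0 \<le> b * (- b - x)" using assms by simp
    then have "exp (- (-b) * (x - (-b))) \<le> 1" by (simp add: algebra_simps)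
    then show "std_normal_density x \<le> exp (- b\<^sup>2 / 2) * normal_density (-b) 1 x"
      by (subst e[of "-b" x]) (auto intro!: mult_left_le_one_le)
  qed simp
qed

lemma centered_gaussian_tail_le:
  assumes "prob_space M" and G: "centered_gaussian M X v" and v: "v \<le> v'" "0 < v'" and x: "0 \<le> x"
  shows "measure M {\<omega>\<in>space M. \<bar>X \<omega>\<bar> > x} \<le> 2 * exp (- x\<^sup>2 / (2 * v'))"
proof -
  interpret prob_space M by fact
  interpret N: real_distribution std_normal_distribution by (rule real_dist_normal_dist)
  have [measurable]: "X \<in> borel_measurable M" and v0: "0 \<le> v" using G by (simp_all add: centered_gaussian_def)
  have "measure M {\<omega>\<in>space M. \<bar>X \<omega>\<bar> > x} = measure (distr M borel X) {z. \<bar>z\<bar> > x}"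
    by (subst measure_distr) (auto intro!: arg_cong[where f="measure M"])
  also have "\<dots> = measure std_normal_distribution {z. \<bar>sqrt v * z\<bar> > x}"
    unfolding centered_gaussian_distr[OF assms(1,2)]
    by (subst measure_distr) (auto intro!: arg_cong[where f="measure std_normal_distribution"])
  also have "\<dots> \<le> measure std_normal_distribution ({x / sqrt v'<..} \<union> {..< - (x / sqrt v')})"
  proof (rule N.finite_measure_mono)
    show "{z. \<bar>sqrt v * z\<bar> > x} \<subseteq> {x / sqrt v'<..} \<union> {..< - (x / sqrt v')}"
    proof
      fix z assume "z \<in> {z. \<bar>sqrt v * z\<bar> > x}"
      then have "x < sqrt v * \<bar>z\<bar>" using v0 by (simp add: abs_mult)
      also have "\<dots> \<le> sqrt v' * \<bar>z\<bar>" using v by (intro mult_right_mono) auto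
      finally have "x / sqrt v' < \<bar>z\<bar>" using v by (simp add: field_simps)
      then show "z \<in> {x / sqrt v'<..} \<union> {..< - (x / sqrt v')}" by auto
    qed
  qed auto
  also have "\<dots> \<le> measure std_normal_distribution {x / sqrt v'<..} + measure std_normal_distribution {..< - (x / sqrt v')}"
    by (rule measure_Un_le) auto
  also have "\<dots> \<le> exp (- (x / sqrt v')\<^sup>2 / 2) + exp (- (x / sqrt v')\<^sup>2 / 2)"
    using x v by (intro add_mono std_normal_halfline_le) auto
  finally show ?thesis using v by (simp add: power_divide mult.commute)
qed

text \<open>The mass of the unit interval to the right of \<open>x / \<surd>v'\<close> is at least the density at its right end.\<close>

lemma centered_gaussian_tail_ge:
  assumes "prob_space M" and G: "centered_gaussian M X v" and v: "v' \<le> v" "0 < v'" and x: "0 \<le> x"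
  shows "exp (- (x / sqrt v' + 1)\<^sup>2 / 2) / sqrt (2 * pi) \<le> measure M {\<omega>\<in>space M. X \<omega> > x}"
proof -
  interpret prob_space M by fact
  interpret N: real_distribution std_normal_distribution by (rule real_dist_normal_dist)
  have [measurable]: "X \<in> borel_measurable M" and v0: "0 \<le> v" using G by (simp_all add: centered_gaussian_def)
  define b where "b = x / sqrt v'"
  have b: "0 \<le> b" using x v by (simp add: b_def)
  have "ennreal (exp (- (b + 1)\<^sup>2 / 2) / sqrt (2 * pi)) = (\<integral>\<^sup>+z. ennreal (exp (- (b + 1)\<^sup>2 / 2) / sqrt (2 * pi)) * indicator {b<..b+1} z \<partial>lborel)"
    by (simp add: nn_integral_cmult_indicator)
  also have "\<dots> \<le> (\<integral>\<^sup>+z. ennreal (std_normal_density z) * indicator {b<..b+1} z \<partial>lborel)"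
    by (rule nn_integral_mono)
       (use b in \<open>auto simp: indicator_def std_normal_density_def intro!: ennreal_leI divide_right_mono power_mono\<close>)
  also have "\<dots> = emeasure std_normal_distribution {b<..b+1}" by (simp add: emeasure_density)
  finally have "exp (- (b + 1)\<^sup>2 / 2) / sqrt (2 * pi) \<le> measure std_normal_distribution {b<..b+1}"
    by (simp add: N.emeasure_eq_measure)
  also have "\<dots> \<le> measure std_normal_distribution {z. sqrt v * z > x}"
  proof (rule N.finite_measure_mono)
    show "{b<..b+1} \<subseteq> {z. sqrt v * z > x}"
    proof
      fix z assume "z \<in> {b<..b+1}"
      then have z: "z > b" by simp
      then have "x < sqrt v' * z" using v by (simp add: b_def field_simps)
      also have "\<dots> \<le> sqrt v * z" using v z b by (intro mult_right_mono) auto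
      finally show "z \<in> {z. sqrt v * z > x}" by simp
    qed
  qed auto
  also have "\<dots> = measure (distr M borel X) {z. z > x}"
    unfolding centered_gaussian_distr[OF assms(1,2)]
    by (subst measure_distr) (auto intro!: arg_cong[where f="measure std_normal_distribution"])
  also have "\<dots> = measure M {\<omega>\<in>space M. X \<omega> > x}"
    by (subst measure_distr) (auto intro!: arg_cong[where f="measure M"])
  finally show ?thesis by (simp add: b_def)
qed

section \<open>Integrals of deterministic functions against white noise\<close>

lemma nn_integral_tendsto_0_comparison:
  fixes F :: "nat \<Rightarrow> 'a \<Rightarrow> real"
  assumes lim1: "(\<lambda>n. \<integral>\<^sup>+x. ennreal ((A n x)\<^sup>2) \<partial>N) \<longlonglongrightarrow> 0"
    and lim2: "(\<lambda>n. \<integral>\<^sup>+x. ennreal ((B n x)\<^sup>2) \<partial>N) \<longlonglongrightarrow> 0"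
    and [measurable]: "\<And>n. A n \<in> borel_measurable N" "\<And>n. B n \<in> borel_measurable N"
    and F: "\<And>n x. F n x = \<alpha> * A n x + \<beta> * B n x"
  shows "(\<lambda>n. \<integral>\<^sup>+x. ennreal ((F n x)\<^sup>2) \<partial>N) \<longlonglongrightarrow> 0"
proof (rule tendsto_sandwich[OF _ _ tendsto_const])
  have b: "(\<integral>\<^sup>+x. ennreal ((F n x)\<^sup>2) \<partial>N)
      \<le> ennreal (2 * \<alpha>\<^sup>2) * (\<integral>\<^sup>+x. ennreal ((A n x)\<^sup>2) \<partial>N) + ennreal (2 * \<beta>\<^sup>2) * (\<integral>\<^sup>+x. ennreal ((B n x)\<^sup>2) \<partial>N)" for n
  proof -
    have "(F n x)\<^sup>2 \<le> 2 * \<alpha>\<^sup>2 * (A n x)\<^sup>2 + 2 * \<beta>\<^sup>2 * (B n x)\<^sup>2" for x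
      using zero_le_power2[of "\<alpha> * A n x - \<beta> * B n x"] unfolding F
      by (simp add: power2_eq_square algebra_simps)
    then have "(\<integral>\<^sup>+x. ennreal ((F n x)\<^sup>2) \<partial>N)
        \<le> (\<integral>\<^sup>+x. ennreal (2 * \<alpha>\<^sup>2) * ennreal ((A n x)\<^sup>2) + ennreal (2 * \<beta>\<^sup>2) * ennreal ((B n x)\<^sup>2) \<partial>N)"
      by (intro nn_integral_mono) (simp flip: ennreal_mult ennreal_plus add: ennreal_leI)
    also have "\<dots> = ennreal (2 * \<alpha>\<^sup>2) * (\<integral>\<^sup>+x. ennreal ((A n x)\<^sup>2) \<partial>N) + ennreal (2 * \<beta>\<^sup>2) * (\<integral>\<^sup>+x. ennreal ((B n x)\<^sup>2) \<partial>N)"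
      by (simp add: nn_integral_add nn_integral_cmult)
    finally show ?thesis .
  qed
  show "\<forall>\<^sub>F n in sequentially. (\<integral>\<^sup>+x. ennreal ((F n x)\<^sup>2) \<partial>N)
      \<le> ennreal (2 * \<alpha>\<^sup>2) * (\<integral>\<^sup>+x. ennreal ((A n x)\<^sup>2) \<partial>N) + ennreal (2 * \<beta>\<^sup>2) * (\<integral>\<^sup>+x. ennreal ((B n x)\<^sup>2) \<partial>N)"
    using b by simp
  have "(\<lambda>n. ennreal (2 * \<alpha>\<^sup>2) * (\<integral>\<^sup>+x. ennreal ((A n x)\<^sup>2) \<partial>N) + ennreal (2 * \<beta>\<^sup>2) * (\<integral>\<^sup>+x. ennreal ((B n x)\<^sup>2) \<partial>N))
      \<longlonglongrightarrow> ennreal (2 * \<alpha>\<^sup>2) * 0 + ennreal (2 * \<beta>\<^sup>2) * 0"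
    by (intro tendsto_add ennreal_tendsto_cmult lim1 lim2) auto
  then show "(\<lambda>n. ennreal (2 * \<alpha>\<^sup>2) * (\<integral>\<^sup>+x. ennreal ((A n x)\<^sup>2) \<partial>N) + ennreal (2 * \<beta>\<^sup>2) * (\<integral>\<^sup>+x. ennreal ((B n x)\<^sup>2) \<partial>N))
      \<longlonglongrightarrow> 0" by simp
qed auto

lemma square_integrable_of_close:
  assumes [measurable]: "f \<in> borel_measurable N" "g \<in> borel_measurable N"
    and "integrable N (\<lambda>x. (g x)\<^sup>2 :: real)" "integrable N (\<lambda>x. (f x - g x)\<^sup>2)"
  shows "integrable N (\<lambda>x. (f x)\<^sup>2)"
proof (rule Bochner_Integration.integrable_bound)
  show "integrable N (\<lambda>x. 2 * (g x)\<^sup>2 + 2 * (f x - g x)\<^sup>2)" using assms by auto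
  have "(f x)\<^sup>2 \<le> 2 * (g x)\<^sup>2 + 2 * (f x - g x)\<^sup>2" for x
    using zero_le_power2[of "2 * g x - f x"] by (simp add: power2_eq_square algebra_simps)
  then show "AE x in N. norm ((f x)\<^sup>2) \<le> norm (2 * (g x)\<^sup>2 + 2 * (f x - g x)\<^sup>2)" by auto
qed auto

text \<open>The inequality \<open>2 |f d| \<le> \<theta> f\<^sup>2 + d\<^sup>2 / \<theta>\<close> for \<open>d = g - f\<close>: a quantitative continuity of the squared
  \<open>L\<^sup>2\<close>-norm in which \<open>\<theta>\<close> can be tuned to the size of \<open>f - g\<close>.\<close>

lemma integral_square_diff_le:
  assumes [measurable]: "f \<in> borel_measurable N" "g \<in> borel_measurable N"
    and f: "integrable N (\<lambda>x. (f x)\<^sup>2 :: real)" and g: "integrable N (\<lambda>x. (g x)\<^sup>2)"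
    and fg: "integrable N (\<lambda>x. (f x - g x)\<^sup>2)" and \<theta>: "0 < \<theta>"
  shows "\<bar>(\<integral>x. (g x)\<^sup>2 \<partial>N) - (\<integral>x. (f x)\<^sup>2 \<partial>N)\<bar>
    \<le> \<theta> * (\<integral>x. (f x)\<^sup>2 \<partial>N) + (1 + 1 / \<theta>) * (\<integral>x. (f x - g x)\<^sup>2 \<partial>N)"
proof -
  have pt: "\<bar>(g x)\<^sup>2 - (f x)\<^sup>2\<bar> \<le> \<theta> * (f x)\<^sup>2 + (1 + 1 / \<theta>) * (f x - g x)\<^sup>2" for x
  proof -
    define d where "d = g x - f x"
    have "2 * \<bar>f x\<bar> * \<bar>d\<bar> \<le> \<theta> * (f x)\<^sup>2 + d\<^sup>2 / \<theta>"
    proof -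
      have "0 \<le> (\<theta> * \<bar>f x\<bar> - \<bar>d\<bar>)\<^sup>2 / \<theta>" using \<theta> by simp
      also have "\<dots> = \<theta> * (f x)\<^sup>2 + d\<^sup>2 / \<theta> - 2 * \<bar>f x\<bar> * \<bar>d\<bar>"
        using \<theta> by (simp add: power2_diff field_simps power2_eq_square)
      finally show ?thesis by simp
    qed
    moreover have "(g x)\<^sup>2 - (f x)\<^sup>2 = 2 * f x * d + d\<^sup>2" by (simp add: d_def power2_eq_square algebra_simps)
    moreover have "\<bar>2 * f x * d\<bar> = 2 * \<bar>f x\<bar> * \<bar>d\<bar>" by (simp add: abs_mult)
    moreover have "\<bar>2 * f x * d + d\<^sup>2\<bar> \<le> \<bar>2 * f x * d\<bar> + d\<^sup>2"
      using abs_triangle_ineq[of "2 * f x * d" "d\<^sup>2"] by simp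
    ultimately have "\<bar>(g x)\<^sup>2 - (f x)\<^sup>2\<bar> \<le> \<theta> * (f x)\<^sup>2 + d\<^sup>2 / \<theta> + d\<^sup>2" by simp
    also have "\<dots> = \<theta> * (f x)\<^sup>2 + (1 + 1 / \<theta>) * d\<^sup>2" by (simp add: algebra_simps)
    also have "d\<^sup>2 = (f x - g x)\<^sup>2" by (simp add: d_def power2_commute)
    finally show ?thesis .
  qed
  have "\<bar>(\<integral>x. (g x)\<^sup>2 \<partial>N) - (\<integral>x. (f x)\<^sup>2 \<partial>N)\<bar> = \<bar>\<integral>x. (g x)\<^sup>2 - (f x)\<^sup>2 \<partial>N\<bar>" using f g by simp
  also have "\<dots> \<le> (\<integral>x. \<bar>(g x)\<^sup>2 - (f x)\<^sup>2\<bar> \<partial>N)" by (rule integral_abs_bound)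
  also have "\<dots> \<le> (\<integral>x. \<theta> * (f x)\<^sup>2 + (1 + 1 / \<theta>) * (f x - g x)\<^sup>2 \<partial>N)"
    using f g fg pt by (intro integral_mono) auto
  also have "\<dots> = \<theta> * (\<integral>x. (f x)\<^sup>2 \<partial>N) + (1 + 1 / \<theta>) * (\<integral>x. (f x - g x)\<^sup>2 \<partial>N)"
    using f fg by simp
  finally show ?thesis .
qed

lemma L2_limit:
  fixes F :: "'b \<Rightarrow> real"
  assumes lim: "(\<lambda>n::nat. \<integral>\<^sup>+x. ennreal ((F x - S n x)\<^sup>2) \<partial>N) \<longlonglongrightarrow> 0"
    and [measurable]: "F \<in> borel_measurable N" "\<And>n. S n \<in> borel_measurable N"
  shows "\<forall>\<^sub>F n in sequentially. integrable N (\<lambda>x. (F x - S n x)\<^sup>2)"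
    and "(\<lambda>n. \<integral>x. (F x - S n x)\<^sup>2 \<partial>N) \<longlonglongrightarrow> 0"
proof -
  have "\<forall>\<^sub>F n in sequentially. (\<integral>\<^sup>+x. ennreal ((F x - S n x)\<^sup>2) \<partial>N) < 1"
    using order_tendstoD(2)[OF lim, of 1] by simp
  then show "\<forall>\<^sub>F n in sequentially. integrable N (\<lambda>x. (F x - S n x)\<^sup>2)"
  proof eventually_elim
    case (elim n)
    then have "(\<integral>\<^sup>+x. ennreal ((F x - S n x)\<^sup>2) \<partial>N) < \<infinity>"
      by (rule order_less_trans) simp
    then show ?case by (intro integrableI_bounded) auto
  qed
  have "(\<integral>x. (F x - S n x)\<^sup>2 \<partial>N) = enn2real (\<integral>\<^sup>+x. ennreal ((F x - S n x)\<^sup>2) \<partial>N)" for n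
    by (rule integral_eq_nn_integral) auto
  then show "(\<lambda>n. \<integral>x. (F x - S n x)\<^sup>2 \<partial>N) \<longlonglongrightarrow> 0"
    using tendsto_enn2real[of _ 0] lim by simp
qed

lemma cmod_iexp_diff_le: "cmod (iexp x - iexp y) \<le> \<bar>x - y\<bar>"
proof -
  have "iexp x - iexp y = iexp y * (iexp (x - y) - 1)"
    by (simp add: right_diff_distrib exp_diff)
  then have "cmod (iexp x - iexp y) = cmod (iexp (x - y) - 1)" by (simp add: norm_mult)
  then show ?thesis using iexp_approx1[of "x - y" 0] by simp
qed

lemma gaussian_rv_integrable:
  assumes "prob_space M" "gaussian_rv M X"
  shows "integrable M X" "integrable M (\<lambda>\<omega>. (X \<omega>)\<^sup>2)"
proof -
  interpret prob_space M by fact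
  have [measurable]: "X \<in> borel_measurable M" using assms(2) by (simp add: gaussian_rv_def)
  have "integrable M X \<and> integrable M (\<lambda>\<omega>. (X \<omega>)\<^sup>2)"
    using assms(2) unfolding gaussian_rv_def
  proof (elim conjE disjE exE)
    fix \<mu> \<sigma> :: real assume \<sigma>: "0 < \<sigma>" and D: "distributed M lborel X (normal_density \<mu> \<sigma>)"
    have 1: "integrable M X"
      using distributed_integrable[OF D, of "\<lambda>x. x"] integrable_normal_moment_nz_1[OF \<sigma>, of \<mu>] by simp
    have 2: "integrable M (\<lambda>\<omega>. (X \<omega> - \<mu>)\<^sup>2)"
      using distributed_integrable[OF D, of "\<lambda>x. (x - \<mu>)\<^sup>2"] integrable_normal_moment[OF \<sigma>, of \<mu> 2] by simp
    have "integrable M (\<lambda>\<omega>. (X \<omega> - \<mu>)\<^sup>2 + 2 * \<mu> * X \<omega> - \<mu>\<^sup>2)" using 1 2 by auto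
    then have "integrable M (\<lambda>\<omega>. (X \<omega>)\<^sup>2)" by (simp add: power2_eq_square algebra_simps)
    then show ?thesis using 1 by simp
  next
    fix \<mu> assume ae: "AE \<omega> in M. X \<omega> = \<mu>"
    have "integrable M X \<longleftrightarrow> integrable M (\<lambda>_. \<mu>)" by (rule integrable_cong_AE) (use ae in auto)
    moreover have "integrable M (\<lambda>\<omega>. (X \<omega>)\<^sup>2) \<longleftrightarrow> integrable M (\<lambda>_. \<mu>\<^sup>2)" by (rule integrable_cong_AE) (use ae in auto)
    ultimately show ?thesis by simp
  qed
  then show "integrable M X" "integrable M (\<lambda>\<omega>. (X \<omega>)\<^sup>2)" by auto
qed

lemma centered_gaussian_of_gaussian_rv:
  assumes "prob_space M" and G: "gaussian_rv M X" and m: "(\<integral>\<omega>. X \<omega> \<partial>M) = 0"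
  shows "centered_gaussian M X (\<integral>\<omega>. (X \<omega>)\<^sup>2 \<partial>M)"
proof -
  interpret prob_space M by fact
  have [measurable]: "X \<in> borel_measurable M" using G by (simp add: gaussian_rv_def)
  have "(CLINT \<omega>|M. iexp (t * X \<omega>)) = of_real (exp (- ((\<integral>\<omega>. (X \<omega>)\<^sup>2 \<partial>M) * t\<^sup>2) / 2))" for t
    using G unfolding gaussian_rv_def
  proof (elim conjE disjE exE)
    fix \<mu> \<sigma> :: real assume \<sigma>: "0 < \<sigma>" and D: "distributed M lborel X (normal_density \<mu> \<sigma>)"
    have \<mu>: "\<mu> = 0" using normal_distributed_expectation[OF \<sigma> D] m by simp
    have v: "(\<integral>\<omega>. (X \<omega>)\<^sup>2 \<partial>M) = \<sigma>\<^sup>2" using normal_distributed_variance[OF \<sigma> D] m by simp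
    have "distributed M lborel (\<lambda>\<omega>. X \<omega> / \<sigma>) std_normal_density"
      using normal_standard_normal_convert[OF \<sigma>, of X \<mu>] D \<mu> by simp
    then have d: "distr M lborel (\<lambda>\<omega>. X \<omega> / \<sigma>) = std_normal_distribution" by (simp add: distributed_def)
    have "(CLINT \<omega>|M. iexp (t * X \<omega>)) = (CLINT \<omega>|M. iexp ((t * \<sigma>) * (X \<omega> / \<sigma>)))" using \<sigma> by simp
    also have "\<dots> = (CLINT x|distr M lborel (\<lambda>\<omega>. X \<omega> / \<sigma>). iexp ((t * \<sigma>) * x))"
      by (rule integral_distr[symmetric]) auto
    also have "\<dots> = char std_normal_distribution (t * \<sigma>)" unfolding d char_def ..
    finally show ?thesis by (simp add: char_std_normal_distribution v power_mult_distrib mult.commute)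
  next
    fix \<mu> assume ae: "AE \<omega> in M. X \<omega> = \<mu>"
    have "(\<integral>\<omega>. X \<omega> \<partial>M) = (\<integral>\<omega>. \<mu> \<partial>M)" by (rule integral_cong_AE) (use ae in auto)
    then have \<mu>: "\<mu> = 0" using m by (simp add: prob_space)
    have 1: "(\<integral>\<omega>. (X \<omega>)\<^sup>2 \<partial>M) = (\<integral>\<omega>. 0 \<partial>M)" by (rule integral_cong_AE) (use ae \<mu> in auto)
    have "(CLINT \<omega>|M. iexp (t * X \<omega>)) = (CLINT \<omega>|M. 1)" by (rule integral_cong_AE) (use ae \<mu> in auto)
    then show ?thesis using 1 by (simp add: prob_space)
  qed
  then show ?thesis by (simp add: centered_gaussian_def)
qed

definition step_fun :: "('b set \<Rightarrow> real) \<Rightarrow> 'b set set \<Rightarrow> 'b \<Rightarrow> real" where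
  "step_fun c \<A> p = (\<Sum>A\<in>\<A>. c A * indicator A p)"

locale white_noise_space = prob_space M for M :: "'w measure" +
  fixes W :: "(real \<times> real) set \<Rightarrow> 'w \<Rightarrow> real"
  assumes noise: "white_noise M W"
begin

definition noise_sum :: "((real \<times> real) set \<Rightarrow> real) \<Rightarrow> (real \<times> real) set set \<Rightarrow> 'w \<Rightarrow> real" where
  "noise_sum c \<A> \<omega> = (\<Sum>A\<in>\<A>. c A * W A \<omega>)"

lemma noise_gaussian_rv: "A \<in> noise_sets \<Longrightarrow> gaussian_rv M (W A)"
  using noise[unfolded white_noise_def, THEN conjunct1, rule_format, of "{A}" "\<lambda>_. 1"] by simp

lemma noise_measurable[measurable (raw)]: "A \<in> noise_sets \<Longrightarrow> W A \<in> borel_measurable M"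
  using noise_gaussian_rv by (simp add: gaussian_rv_def)

lemma noise_product_integrable:
  assumes "A \<in> noise_sets" "B \<in> noise_sets"
  shows "integrable M (\<lambda>\<omega>. W A \<omega> * W B \<omega>)"
proof (rule Bochner_Integration.integrable_bound)
  have i: "integrable M (\<lambda>\<omega>. (W A \<omega>)\<^sup>2)" "integrable M (\<lambda>\<omega>. (W B \<omega>)\<^sup>2)"
    by (auto intro!: gaussian_rv_integrable noise_gaussian_rv assms prob_space_axioms)
  then show "integrable M (\<lambda>\<omega>. (W A \<omega>)\<^sup>2 + (W B \<omega>)\<^sup>2)" by auto
  have "\<bar>x * y\<bar> \<le> x\<^sup>2 + y\<^sup>2" for x y :: real
  proof -
    have "2 * (\<bar>x\<bar> * \<bar>y\<bar>) \<le> x\<^sup>2 + y\<^sup>2" using zero_le_power2[of "\<bar>x\<bar> - \<bar>y\<bar>"] by (simp add: power2_diff)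
    moreover have "0 \<le> \<bar>x\<bar> * \<bar>y\<bar>" by simp
    ultimately show ?thesis by (simp only: abs_mult)
  qed
  then show "AE \<omega> in M. norm (W A \<omega> * W B \<omega>) \<le> norm ((W A \<omega>)\<^sup>2 + (W B \<omega>)\<^sup>2)" by auto
  show "(\<lambda>\<omega>. W A \<omega> * W B \<omega>) \<in> borel_measurable M" using assms by measurable
qed

lemma noise_sets_finite_measure: "A \<in> noise_sets \<Longrightarrow> A \<in> sets lborel \<and> emeasure lborel A < \<infinity>"
  by (simp add: noise_sets_def)

lemma step_fun_measurable:
  assumes "finite \<A>" "\<A> \<subseteq> noise_sets" shows "step_fun c \<A> \<in> borel_measurable borel"
  unfolding step_fun_def[abs_def]
  by (intro borel_measurable_sum borel_measurable_times borel_measurable_const borel_measurable_indicator)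
     (use assms in \<open>auto simp: noise_sets_def\<close>)

lemma noise_sum_measurable:
  assumes "finite \<A>" "\<A> \<subseteq> noise_sets" shows "noise_sum c \<A> \<in> borel_measurable M"
  unfolding noise_sum_def[abs_def]
  by (intro borel_measurable_sum borel_measurable_times borel_measurable_const noise_measurable)
     (use assms in auto)

text \<open>The covariance of white noise is the \<open>L\<^sup>2\<close> inner product of indicators, so the variance of a sum is the
  squared norm of the step function.\<close>

lemma noise_sum_gaussian:
  assumes fin: "finite \<A>" and sub: "\<A> \<subseteq> noise_sets"
  shows "integrable lborel (\<lambda>p. (step_fun c \<A> p)\<^sup>2)"
    and "centered_gaussian M (noise_sum c \<A>) (\<integral>p. (step_fun c \<A> p)\<^sup>2 \<partial>lborel)"
proof -
  have G: "gaussian_rv M (noise_sum c \<A>)"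
    using noise fin sub unfolding white_noise_def noise_sum_def[abs_def] by blast
  have m: "(\<integral>\<omega>. noise_sum c \<A> \<omega> \<partial>M) = 0"
  proof -
    have i: "integrable M (\<lambda>\<omega>. c A * W A \<omega>)" if "A \<in> \<A>" for A
      using gaussian_rv_integrable(1)[OF prob_space_axioms noise_gaussian_rv] sub that by auto
    have "(\<integral>\<omega>. noise_sum c \<A> \<omega> \<partial>M) = (\<Sum>A\<in>\<A>. c A * (\<integral>\<omega>. W A \<omega> \<partial>M))"
      unfolding noise_sum_def using i by (subst Bochner_Integration.integral_sum) auto
    also have "\<dots> = 0" using noise sub unfolding white_noise_def by (intro sum.neutral) auto
    finally show ?thesis .
  qed
  have sq: "(step_fun c \<A> p)\<^sup>2 = (\<Sum>A\<in>\<A>. \<Sum>B\<in>\<A>. c A * c B * indicator (A \<inter> B) p)" for p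
    by (simp add: step_fun_def power2_eq_square sum_product indicator_inter_arith mult_ac)
  have sqW: "(noise_sum c \<A> \<omega>)\<^sup>2 = (\<Sum>A\<in>\<A>. \<Sum>B\<in>\<A>. c A * c B * (W A \<omega> * W B \<omega>))" for \<omega>
    by (simp add: noise_sum_def power2_eq_square sum_product mult_ac)
  have ii: "integrable lborel (\<lambda>p. c A * c B * indicator (A \<inter> B) p)" if "A \<in> \<A>" "B \<in> \<A>" for A B
  proof -
    have A: "A \<in> sets lborel" "emeasure lborel A < \<infinity>" "B \<in> sets lborel"
      using noise_sets_finite_measure sub that by blast+
    have "emeasure lborel (A \<inter> B) \<le> emeasure lborel A" using A by (intro emeasure_mono) auto
    then show ?thesis using A by (intro integrable_mult_right integrable_real_indicator) auto
  qed
  show "integrable lborel (\<lambda>p. (step_fun c \<A> p)\<^sup>2)"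
    unfolding sq using ii by (intro Bochner_Integration.integrable_sum) auto
  have e1: "(\<integral>p. (step_fun c \<A> p)\<^sup>2 \<partial>lborel) = (\<Sum>A\<in>\<A>. \<Sum>B\<in>\<A>. c A * c B * measure lborel (A \<inter> B))"
  proof -
    have "(\<integral>p. (step_fun c \<A> p)\<^sup>2 \<partial>lborel) = (\<Sum>A\<in>\<A>. \<Sum>B\<in>\<A>. \<integral>p. c A * c B * indicator (A \<inter> B) p \<partial>lborel)"
      unfolding sq using ii by (simp add: Bochner_Integration.integral_sum Bochner_Integration.integrable_sum)
    then show ?thesis by simp
  qed
  have e2: "(\<integral>\<omega>. (noise_sum c \<A> \<omega>)\<^sup>2 \<partial>M) = (\<Sum>A\<in>\<A>. \<Sum>B\<in>\<A>. c A * c B * measure lborel (A \<inter> B))"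
  proof -
    have i: "integrable M (\<lambda>\<omega>. c A * c B * (W A \<omega> * W B \<omega>))" if "A \<in> \<A>" "B \<in> \<A>" for A B
      using noise_product_integrable[of A B] that sub by auto
    have "(\<integral>\<omega>. (noise_sum c \<A> \<omega>)\<^sup>2 \<partial>M) = (\<Sum>A\<in>\<A>. \<integral>\<omega>. (\<Sum>B\<in>\<A>. c A * c B * (W A \<omega> * W B \<omega>)) \<partial>M)"
      unfolding sqW using i by (intro Bochner_Integration.integral_sum Bochner_Integration.integrable_sum) auto
    also have "\<dots> = (\<Sum>A\<in>\<A>. \<Sum>B\<in>\<A>. \<integral>\<omega>. c A * c B * (W A \<omega> * W B \<omega>) \<partial>M)"
      using i by (intro sum.cong refl Bochner_Integration.integral_sum) auto
    also have "\<dots> = (\<Sum>A\<in>\<A>. \<Sum>B\<in>\<A>. c A * c B * measure lborel (A \<inter> B))"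
      using noise sub unfolding white_noise_def by (intro sum.cong refl) (simp add: subset_iff)
    finally show ?thesis .
  qed
  show "centered_gaussian M (noise_sum c \<A>) (\<integral>p. (step_fun c \<A> p)\<^sup>2 \<partial>lborel)"
    using centered_gaussian_of_gaussian_rv[OF prob_space_axioms G m] by (simp only: e1 e2)
qed

lemma has_noise_integralD:
  assumes "has_noise_integral M W f X"
  obtains \<A> c where "\<And>n::nat. finite (\<A> n)" "\<And>n. \<A> n \<subseteq> noise_sets"
    "(\<lambda>n. \<integral>\<^sup>+p. ennreal ((f p - step_fun (c n) (\<A> n) p)\<^sup>2) \<partial>lborel) \<longlonglongrightarrow> 0"
    "(\<lambda>n. \<integral>\<^sup>+\<omega>. ennreal ((X \<omega> - noise_sum (c n) (\<A> n) \<omega>)\<^sup>2) \<partial>M) \<longlonglongrightarrow> 0"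
  using assms unfolding has_noise_integral_def step_fun_def noise_sum_def by blast

lemma has_noise_integralI:
  assumes "f \<in> borel_measurable borel" "X \<in> borel_measurable M"
    "\<And>n::nat. finite (\<A> n)" "\<And>n. \<A> n \<subseteq> noise_sets"
    "(\<lambda>n. \<integral>\<^sup>+p. ennreal ((f p - step_fun (c n) (\<A> n) p)\<^sup>2) \<partial>lborel) \<longlonglongrightarrow> 0"
    "(\<lambda>n. \<integral>\<^sup>+\<omega>. ennreal ((X \<omega> - noise_sum (c n) (\<A> n) \<omega>)\<^sup>2) \<partial>M) \<longlonglongrightarrow> 0"
  shows "has_noise_integral M W f X"
  using assms unfolding has_noise_integral_def step_fun_def noise_sum_def by blast

lemma has_noise_integral_measurable:
  assumes "has_noise_integral M W f X"
  shows "f \<in> borel_measurable borel" "X \<in> borel_measurable M"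
  using assms by (simp_all add: has_noise_integral_def)

lemma has_noise_integral_step:
  assumes "finite \<A>" "\<A> \<subseteq> noise_sets"
  shows "has_noise_integral M W (step_fun c \<A>) (noise_sum c \<A>)"
  by (rule has_noise_integralI[of _ _ "\<lambda>_. \<A>" "\<lambda>_. c"])
     (use assms in \<open>auto intro: step_fun_measurable noise_sum_measurable\<close>)

lemma has_noise_integral_lincomb:
  assumes f: "has_noise_integral M W f X" and g: "has_noise_integral M W g Y"
  shows "has_noise_integral M W (\<lambda>p. \<alpha> * f p + \<beta> * g p) (\<lambda>\<omega>. \<alpha> * X \<omega> + \<beta> * Y \<omega>)"
proof -
  note [measurable] = has_noise_integral_measurable[OF f] has_noise_integral_measurable[OF g]
  obtain \<A> c where A: "\<And>n::nat. finite (\<A> n)" "\<And>n. \<A> n \<subseteq> noise_sets"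
    "(\<lambda>n. \<integral>\<^sup>+p. ennreal ((f p - step_fun (c n) (\<A> n) p)\<^sup>2) \<partial>lborel) \<longlonglongrightarrow> 0"
    "(\<lambda>n. \<integral>\<^sup>+\<omega>. ennreal ((X \<omega> - noise_sum (c n) (\<A> n) \<omega>)\<^sup>2) \<partial>M) \<longlonglongrightarrow> 0"
    by (rule has_noise_integralD[OF f], rule that)
  obtain \<B> d where B: "\<And>n::nat. finite (\<B> n)" "\<And>n. \<B> n \<subseteq> noise_sets"
    "(\<lambda>n. \<integral>\<^sup>+p. ennreal ((g p - step_fun (d n) (\<B> n) p)\<^sup>2) \<partial>lborel) \<longlonglongrightarrow> 0"
    "(\<lambda>n. \<integral>\<^sup>+\<omega>. ennreal ((Y \<omega> - noise_sum (d n) (\<B> n) \<omega>)\<^sup>2) \<partial>M) \<longlonglongrightarrow> 0"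
    by (rule has_noise_integralD[OF g], rule that)
  \<comment> \<open>A set that occurs in both families keeps one summand, so its coefficients add up.\<close>
  define e where "e n A = \<alpha> * (if A \<in> \<A> n then c n A else 0) + \<beta> * (if A \<in> \<B> n then d n A else 0)" for n A
  have split: "(\<Sum>A\<in>\<A> n \<union> \<B> n. e n A * h A) = \<alpha> * (\<Sum>A\<in>\<A> n. c n A * h A) + \<beta> * (\<Sum>A\<in>\<B> n. d n A * h A)"
    for n and h :: "_ \<Rightarrow> real"
  proof -
    have "(\<Sum>A\<in>\<A> n. c n A * h A) = (\<Sum>A\<in>\<A> n \<union> \<B> n. (if A \<in> \<A> n then c n A else 0) * h A)"
      using A(1) B(1) by (intro sum.mono_neutral_cong_left) auto
    moreover have "(\<Sum>A\<in>\<B> n. d n A * h A) = (\<Sum>A\<in>\<A> n \<union> \<B> n. (if A \<in> \<B> n then d n A else 0) * h A)"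
      using A(1) B(1) by (intro sum.mono_neutral_cong_left) auto
    ultimately show ?thesis
      by (simp only: e_def sum_distrib_left sum.distrib[symmetric] ring_distribs mult.assoc)
  qed
  note [measurable] = step_fun_measurable[OF A(1,2)] step_fun_measurable[OF B(1,2)]
    noise_sum_measurable[OF A(1,2)] noise_sum_measurable[OF B(1,2)]
  show ?thesis
  proof (rule has_noise_integralI[where \<A>="\<lambda>n. \<A> n \<union> \<B> n" and c=e])
    show "(\<lambda>n. \<integral>\<^sup>+p. ennreal ((\<alpha> * f p + \<beta> * g p - step_fun (e n) (\<A> n \<union> \<B> n) p)\<^sup>2) \<partial>lborel) \<longlonglongrightarrow> 0"
      by (rule nn_integral_tendsto_0_comparison[OF A(3) B(3), of _ \<alpha> \<beta>])
         (simp_all add: step_fun_def[of "e _"] split, simp_all add: step_fun_def algebra_simps)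
    show "(\<lambda>n. \<integral>\<^sup>+\<omega>. ennreal ((\<alpha> * X \<omega> + \<beta> * Y \<omega> - noise_sum (e n) (\<A> n \<union> \<B> n) \<omega>)\<^sup>2) \<partial>M) \<longlonglongrightarrow> 0"
      by (rule nn_integral_tendsto_0_comparison[OF A(4) B(4), of _ \<alpha> \<beta>])
         (simp_all add: noise_sum_def[of "e _"] split, simp_all add: noise_sum_def algebra_simps)
  qed (use A B in auto)
qed

text \<open>The isometry passes from step functions to the limit: squared norms converge by
  \<open>integral_square_diff_le\<close>, and characteristic functions converge because \<open>x \<mapsto> exp (i t x)\<close> is Lipschitz.\<close>

lemma has_noise_integral_gaussian:
  assumes f: "has_noise_integral M W f X"
  shows "integrable lborel (\<lambda>p. (f p)\<^sup>2)"
    and "centered_gaussian M X (\<integral>p. (f p)\<^sup>2 \<partial>lborel)"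
proof -
  note [measurable] = has_noise_integral_measurable[OF f]
  obtain \<A> c where A: "\<And>n::nat. finite (\<A> n)" "\<And>n. \<A> n \<subseteq> noise_sets"
    "(\<lambda>n. \<integral>\<^sup>+p. ennreal ((f p - step_fun (c n) (\<A> n) p)\<^sup>2) \<partial>lborel) \<longlonglongrightarrow> 0"
    "(\<lambda>n. \<integral>\<^sup>+\<omega>. ennreal ((X \<omega> - noise_sum (c n) (\<A> n) \<omega>)\<^sup>2) \<partial>M) \<longlonglongrightarrow> 0"
    by (rule has_noise_integralD[OF f], rule that)
  note [measurable] = step_fun_measurable[OF A(1,2)] noise_sum_measurable[OF A(1,2)]
  let ?g = "\<lambda>n. step_fun (c n) (\<A> n)" and ?S = "\<lambda>n. noise_sum (c n) (\<A> n)"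
  have mf: "f \<in> borel_measurable lborel" "\<And>n. ?g n \<in> borel_measurable lborel" by measurable
  have mX: "X \<in> borel_measurable M" "\<And>n. ?S n \<in> borel_measurable M" by measurable
  note lf = L2_limit[OF A(3) mf] and lX = L2_limit[OF A(4) mX]
  note gi = noise_sum_gaussian(1)[OF A(1,2)] and gG = noise_sum_gaussian(2)[OF A(1,2)]
  obtain n0 where "integrable lborel (\<lambda>p. (f p - ?g n0 p)\<^sup>2)"
    using eventually_happens'[OF sequentially_bot lf(1)] by auto
  then show fi: "integrable lborel (\<lambda>p. (f p)\<^sup>2)"
    by (rule square_integrable_of_close[OF mf(1) mf(2) gi])
  have nrm: "(\<lambda>n. \<integral>p. (?g n p)\<^sup>2 \<partial>lborel) \<longlonglongrightarrow> (\<integral>p. (f p)\<^sup>2 \<partial>lborel)"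
  proof (rule tendstoI)
    fix \<epsilon> :: real assume \<epsilon>: "0 < \<epsilon>"
    define F where "F = (\<integral>p. (f p)\<^sup>2 \<partial>lborel)"
    have F: "F \<ge> 0" by (simp add: F_def)
    define \<theta> where "\<theta> = \<epsilon> / (2 * (F + 1))"
    have \<theta>: "0 < \<theta>" "\<theta> * F < \<epsilon> / 2" using \<epsilon> F by (auto simp: \<theta>_def field_simps intro!: add_pos_nonneg)
    have "\<forall>\<^sub>F n in sequentially. (\<integral>x. (f x - ?g n x)\<^sup>2 \<partial>lborel) < \<epsilon> / (2 * (1 + 1 / \<theta>))"
      using \<epsilon> \<theta> by (intro order_tendstoD(2)[OF lf(2)]) (auto intro!: divide_pos_pos add_pos_pos)
    then have "\<forall>\<^sub>F n in sequentially. dist (\<integral>p. (?g n p)\<^sup>2 \<partial>lborel) F < \<epsilon>"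
      using lf(1)
    proof eventually_elim
      case (elim n)
      have "\<bar>(\<integral>p. (?g n p)\<^sup>2 \<partial>lborel) - F\<bar> \<le> \<theta> * F + (1 + 1 / \<theta>) * (\<integral>x. (f x - ?g n x)\<^sup>2 \<partial>lborel)"
        unfolding F_def by (rule integral_square_diff_le[OF mf(1) mf(2) fi gi elim(2) \<theta>(1)])
      also have "\<dots> < \<epsilon> / 2 + \<epsilon> / 2"
      proof (intro add_strict_mono \<theta>(2))
        have p: "0 < 1 + 1 / \<theta>" using \<theta> by (auto intro!: add_pos_pos)
        have "(1 + 1 / \<theta>) * (\<integral>x. (f x - ?g n x)\<^sup>2 \<partial>lborel) < (1 + 1 / \<theta>) * (\<epsilon> / (2 * (1 + 1 / \<theta>)))"
          using elim(1) p by (rule mult_strict_left_mono)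
        also have "\<dots> = \<epsilon> / 2"
        proof -
          have "c * (\<epsilon> / (2 * c)) = \<epsilon> / 2" if "0 < c" for c using that by simp
          then show ?thesis using p .
        qed
        finally show "(1 + 1 / \<theta>) * (\<integral>x. (f x - ?g n x)\<^sup>2 \<partial>lborel) < \<epsilon> / 2" .
      qed
      finally show ?case by (simp add: dist_real_def)
    qed
    then show "\<forall>\<^sub>F n in sequentially. dist (\<integral>p. (?g n p)\<^sup>2 \<partial>lborel) (\<integral>p. (f p)\<^sup>2 \<partial>lborel) < \<epsilon>"
      by (simp add: F_def)
  qed
  have "(CLINT \<omega>|M. iexp (t * X \<omega>)) = of_real (exp (- ((\<integral>p. (f p)\<^sup>2 \<partial>lborel) * t\<^sup>2) / 2))" for t
  proof (rule LIMSEQ_unique)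
    have "(\<lambda>n. of_real (exp (- ((\<integral>p. (?g n p)\<^sup>2 \<partial>lborel) * t\<^sup>2) / 2)) :: complex)
        \<longlonglongrightarrow> of_real (exp (- ((\<integral>p. (f p)\<^sup>2 \<partial>lborel) * t\<^sup>2) / 2))"
      by (intro tendsto_intros nrm) auto
    then show "(\<lambda>n. CLINT \<omega>|M. iexp (t * ?S n \<omega>)) \<longlonglongrightarrow> of_real (exp (- ((\<integral>p. (f p)\<^sup>2 \<partial>lborel) * t\<^sup>2) / 2))"
      using gG by (simp add: centered_gaussian_def)
    show "(\<lambda>n. CLINT \<omega>|M. iexp (t * ?S n \<omega>)) \<longlonglongrightarrow> (CLINT \<omega>|M. iexp (t * X \<omega>))"
    proof (rule LIM_zero_cancel, rule Lim_null_comparison)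
      let ?e = "\<lambda>n. \<integral>\<omega>. (X \<omega> - ?S n \<omega>)\<^sup>2 \<partial>M"
      show "(\<lambda>n. \<bar>t\<bar> * sqrt (?e n)) \<longlonglongrightarrow> 0"
        using tendsto_mult[OF tendsto_const[of "\<bar>t\<bar>"] tendsto_real_sqrt[OF lX(2)]] by simp
      show "\<forall>\<^sub>F n in sequentially. norm ((CLINT \<omega>|M. iexp (t * ?S n \<omega>)) - (CLINT \<omega>|M. iexp (t * X \<omega>))) \<le> \<bar>t\<bar> * sqrt (?e n)"
        using lX(1)
      proof eventually_elim
        case (elim n)
        have i1: "integrable M (\<lambda>\<omega>. X \<omega> - ?S n \<omega>)" by (rule square_integrable_imp_integrable[OF _ elim]) simp
        have ie: "integrable M (\<lambda>\<omega>. iexp (t * Z \<omega>))" if [measurable]: "Z \<in> borel_measurable M" for Z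
          by (rule integrable_iexp) auto
        have "norm ((CLINT \<omega>|M. iexp (t * X \<omega>)) - (CLINT \<omega>|M. iexp (t * ?S n \<omega>)))
            = norm (CLINT \<omega>|M. iexp (t * X \<omega>) - iexp (t * ?S n \<omega>))"
          using ie by (subst Bochner_Integration.integral_diff) auto
        also have "\<dots> \<le> (\<integral>\<omega>. norm (iexp (t * X \<omega>) - iexp (t * ?S n \<omega>)) \<partial>M)" by (rule integral_norm_bound)
        also have "\<dots> \<le> (\<integral>\<omega>. \<bar>t\<bar> * \<bar>X \<omega> - ?S n \<omega>\<bar> \<partial>M)"
        proof (rule integral_mono)
          show "integrable M (\<lambda>\<omega>. norm (iexp (t * X \<omega>) - iexp (t * ?S n \<omega>)))"
            using ie by (intro integrable_norm Bochner_Integration.integrable_diff) auto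
          show "norm (iexp (t * X \<omega>) - iexp (t * ?S n \<omega>)) \<le> \<bar>t\<bar> * \<bar>X \<omega> - ?S n \<omega>\<bar>" for \<omega>
            using cmod_iexp_diff_le[of "t * X \<omega>" "t * ?S n \<omega>"]
            by (simp only: right_diff_distrib[symmetric] abs_mult)
        qed (use i1 in auto)
        also have "\<dots> = \<bar>t\<bar> * (\<integral>\<omega>. \<bar>X \<omega> - ?S n \<omega>\<bar> \<partial>M)" by simp
        also have "(\<integral>\<omega>. \<bar>X \<omega> - ?S n \<omega>\<bar> \<partial>M) \<le> sqrt (?e n)"
        proof (rule real_le_rsqrt)
          have "0 \<le> (\<integral>\<omega>. (\<bar>X \<omega> - ?S n \<omega>\<bar> - (\<integral>\<omega>. \<bar>X \<omega> - ?S n \<omega>\<bar> \<partial>M))\<^sup>2 \<partial>M)" by simp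
          also have "\<dots> = (\<integral>\<omega>. \<bar>X \<omega> - ?S n \<omega>\<bar>\<^sup>2 \<partial>M) - (\<integral>\<omega>. \<bar>X \<omega> - ?S n \<omega>\<bar> \<partial>M)\<^sup>2"
            using i1 elim by (intro variance_eq) auto
          finally show "(\<integral>\<omega>. \<bar>X \<omega> - ?S n \<omega>\<bar> \<partial>M)\<^sup>2 \<le> ?e n" by simp
        qed
        finally show ?case by (simp add: mult_left_mono norm_minus_commute)
      qed
    qed
  qed
  then show "centered_gaussian M X (\<integral>p. (f p)\<^sup>2 \<partial>lborel)" by (simp add: centered_gaussian_def)
qed

text \<open>Cutting the approximating step functions down to \<open>D\<close> approximates \<open>f 1\<^sub>D\<close>. A step function near
  \<open>f 1\<^sub>D\<close> whose support is exactly inside \<open>D\<close> is all that is used of an integral over \<open>D\<close>.\<close>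

lemma noise_integral_restrict_approx:
  assumes f: "has_noise_integral M W f X" and D[measurable]: "D \<in> sets borel" and \<eta>: "0 < \<eta>"
  obtains g S where "has_noise_integral M W g S" "\<And>p. p \<notin> D \<Longrightarrow> g p = 0"
    "integrable lborel (\<lambda>p. (f p * indicator D p - g p)\<^sup>2)"
    "(\<integral>p. (f p * indicator D p - g p)\<^sup>2 \<partial>lborel) < \<eta>"
proof -
  note [measurable] = has_noise_integral_measurable[OF f]
  obtain \<A> c where A: "\<And>n::nat. finite (\<A> n)" "\<And>n. \<A> n \<subseteq> noise_sets"
    "(\<lambda>n. \<integral>\<^sup>+p. ennreal ((f p - step_fun (c n) (\<A> n) p)\<^sup>2) \<partial>lborel) \<longlonglongrightarrow> 0"
    "(\<lambda>n. \<integral>\<^sup>+\<omega>. ennreal ((X \<omega> - noise_sum (c n) (\<A> n) \<omega>)\<^sup>2) \<partial>M) \<longlonglongrightarrow> 0"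
    by (rule has_noise_integralD[OF f], rule that)
  note [measurable] = step_fun_measurable[OF A(1,2)]
  have mf: "f \<in> borel_measurable lborel" "\<And>n. step_fun (c n) (\<A> n) \<in> borel_measurable lborel" by measurable
  note lf = L2_limit[OF A(3) mf]
  have "\<forall>\<^sub>F n in sequentially. integrable lborel (\<lambda>p. (f p - step_fun (c n) (\<A> n) p)\<^sup>2)
      \<and> (\<integral>p. (f p - step_fun (c n) (\<A> n) p)\<^sup>2 \<partial>lborel) < \<eta>"
    using eventually_conj[OF lf(1) order_tendstoD(2)[OF lf(2) \<eta>]] by simp
  then obtain n where n: "integrable lborel (\<lambda>p. (f p - step_fun (c n) (\<A> n) p)\<^sup>2)"
      "(\<integral>p. (f p - step_fun (c n) (\<A> n) p)\<^sup>2 \<partial>lborel) < \<eta>"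
    by (auto dest!: eventually_happens'[OF sequentially_bot])
  define \<B> where "\<B> = (\<lambda>A. A \<inter> D) ` \<A> n"
  \<comment> \<open>Different sets may have the same trace on \<open>D\<close>; their coefficients are collected.\<close>
  define d where "d B = (\<Sum>A\<in>{A\<in>\<A> n. A \<inter> D = B}. c n A)" for B
  have B: "finite \<B>" "\<B> \<subseteq> noise_sets"
  proof -
    have "A \<inter> D \<in> noise_sets" if "A \<in> \<A> n" for A
    proof -
      have "A \<in> noise_sets" using A(2) that by auto
      moreover have "emeasure lborel (A \<inter> D) \<le> emeasure lborel A" if "A \<in> sets borel"
        using that by (intro emeasure_mono) auto
      ultimately show ?thesis by (auto simp: noise_sets_def)
    qed
    then show "\<B> \<subseteq> noise_sets" by (auto simp: \<B>_def)
  qed (use A(1) in \<open>simp add: \<B>_def\<close>)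
  have g: "step_fun d \<B> p = step_fun (c n) (\<A> n) p * indicator D p" for p
  proof -
    have "step_fun (c n) (\<A> n) p * indicator D p = (\<Sum>A\<in>\<A> n. c n A * indicator (A \<inter> D) p)"
      by (simp add: step_fun_def sum_distrib_right indicator_inter_arith mult.assoc)
    also have "\<dots> = (\<Sum>B\<in>\<B>. \<Sum>A\<in>{A\<in>\<A> n. A \<inter> D = B}. c n A * indicator (A \<inter> D) p)"
      unfolding \<B>_def by (rule sum.image_gen[OF A(1)])
    also have "\<dots> = step_fun d \<B> p"
      by (auto simp: step_fun_def d_def sum_distrib_right intro!: sum.cong)
    finally show ?thesis ..
  qed
  have le: "(f p * indicator D p - step_fun d \<B> p)\<^sup>2 \<le> (f p - step_fun (c n) (\<A> n) p)\<^sup>2" for p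
    unfolding g by (auto simp: indicator_def)
  have m: "(\<lambda>p. (f p * indicator D p - step_fun d \<B> p)\<^sup>2) \<in> borel_measurable lborel"
    unfolding g by measurable
  have i: "integrable lborel (\<lambda>p. (f p * indicator D p - step_fun d \<B> p)\<^sup>2)"
    by (rule Bochner_Integration.integrable_bound[OF n(1) m]) (use le in auto)
  show thesis
  proof
    show "has_noise_integral M W (step_fun d \<B>) (noise_sum d \<B>)"
      by (rule has_noise_integral_step[OF B])
    show "step_fun d \<B> p = 0" if "p \<notin> D" for p using that by (simp add: g)
    show "integrable lborel (\<lambda>p. (f p * indicator D p - step_fun d \<B> p)\<^sup>2)" by fact
    have "(\<integral>p. (f p * indicator D p - step_fun d \<B> p)\<^sup>2 \<partial>lborel) \<le> (\<integral>p. (f p - step_fun (c n) (\<A> n) p)\<^sup>2 \<partial>lborel)"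
      by (rule integral_mono[OF i n(1)]) (rule le)
    then show "(\<integral>p. (f p * indicator D p - step_fun d \<B> p)\<^sup>2 \<partial>lborel) < \<eta>" using n(2) by simp
  qed
qed

text \<open>For disjoint supports the variance of every linear combination splits, so the characteristic
  function of the pair is a product.\<close>

lemma noise_integral_disjoint_independent:
  assumes f: "has_noise_integral M W f X" and g: "has_noise_integral M W g Y"
    and disj: "\<And>p. f p = 0 \<or> g p = 0" and A: "A \<in> sets borel" and B: "B \<in> sets borel"
  shows "prob {\<omega>\<in>space M. X \<omega> \<in> A \<and> Y \<omega> \<in> B} = prob {\<omega>\<in>space M. X \<omega> \<in> A} * prob {\<omega>\<in>space M. Y \<omega> \<in> B}"
proof (rule independent_of_char_product[OF prob_space_axioms _ _ _ A B])
  show "X \<in> borel_measurable M" "Y \<in> borel_measurable M"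
    using has_noise_integral_measurable f g by auto
  fix s t
  note fi = has_noise_integral_gaussian[OF f] and gi = has_noise_integral_gaussian[OF g]
  have sq: "(s * f p + t * g p)\<^sup>2 = s\<^sup>2 * (f p)\<^sup>2 + t\<^sup>2 * (g p)\<^sup>2" for p
    using disj[of p] by (auto simp: power_mult_distrib)
  have v: "(\<integral>p. (s * f p + t * g p)\<^sup>2 \<partial>lborel) = s\<^sup>2 * (\<integral>p. (f p)\<^sup>2 \<partial>lborel) + t\<^sup>2 * (\<integral>p. (g p)\<^sup>2 \<partial>lborel)"
    unfolding sq using fi(1) gi(1) by simp
  have "(CLINT \<omega>|M. iexp (1 * (s * X \<omega> + t * Y \<omega>))) = of_real (exp (- ((\<integral>p. (s * f p + t * g p)\<^sup>2 \<partial>lborel) * 1\<^sup>2) / 2))"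
    using has_noise_integral_gaussian(2)[OF has_noise_integral_lincomb[OF f g, of s t]]
    unfolding centered_gaussian_def by blast
  also have "\<dots> = of_real (exp (- ((\<integral>p. (f p)\<^sup>2 \<partial>lborel) * s\<^sup>2) / 2) * exp (- ((\<integral>p. (g p)\<^sup>2 \<partial>lborel) * t\<^sup>2) / 2))"
    unfolding v exp_add[symmetric] by (simp add: field_simps)
  also have "\<dots> = (CLINT \<omega>|M. iexp (s * X \<omega>)) * (CLINT \<omega>|M. iexp (t * Y \<omega>))"
    using fi(2) gi(2) by (simp add: centered_gaussian_def)
  finally show "(CLINT \<omega>|M. iexp (s * X \<omega> + t * Y \<omega>)) = (CLINT \<omega>|M. iexp (s * X \<omega>)) * (CLINT \<omega>|M. iexp (t * Y \<omega>))"
    by simp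
qed

end

section \<open>The fundamental solution\<close>

text \<open>For \<open>c z \<ge> 0\<close> this is \<open>I\<^sub>0 (\<surd>(c z))\<close>, for \<open>c z \<le> 0\<close> it is \<open>J\<^sub>0 (\<surd>(- c z))\<close>, with the Bessel functions of
  order zero.\<close>

definition riemann_series :: "real \<Rightarrow> real \<Rightarrow> real" where
  "riemann_series c z = (\<Sum>k. (c / 4) ^ k / (fact k)\<^sup>2 * z ^ k)"

lemma riemann_series_abs_summable: "summable (\<lambda>k. norm ((c / 4) ^ k / (fact k)\<^sup>2 * z ^ k :: real))"
proof (rule summable_norm_comparison_test, intro exI allI impI)
  show "summable (\<lambda>k. inverse (fact k) * \<bar>c * z / 4\<bar> ^ k)" by (rule summable_exp)
  fix k :: nat
  have "norm ((c / 4) ^ k / (fact k)\<^sup>2 * z ^ k) = \<bar>c * z / 4\<bar> ^ k / (fact k)\<^sup>2"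
    by (simp add: power_divide power_mult_distrib abs_mult power_abs)
  also have "\<dots> \<le> \<bar>c * z / 4\<bar> ^ k / fact k"
    by (intro divide_left_mono) (auto simp: power2_eq_square mult_le_cancel_left1)
  finally show "norm ((c / 4) ^ k / (fact k)\<^sup>2 * z ^ k) \<le> inverse (fact k) * \<bar>c * z / 4\<bar> ^ k"
    by (simp add: field_simps)
qed

lemma riemann_series_sums: "(\<lambda>k. (c / 4) ^ k / (fact k)\<^sup>2 * z ^ k) sums riemann_series c z"
  unfolding riemann_series_def
  using summable_norm_cancel[OF riemann_series_abs_summable] by (rule summable_sums)

lemma riemann_series_0: "riemann_series c 0 = 1"
  unfolding riemann_series_def powser_zero by simp

lemma riemann_series_deriv:
  obtains F' where "\<And>z. (riemann_series c has_real_derivative F' z) (at z)" "continuous_on UNIV F'"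
proof -
  let ?a = "\<lambda>k. (c / 4) ^ k / (fact k)\<^sup>2 :: real"
  have s: "summable (\<lambda>k. ?a k * z ^ k)" for z
    using summable_norm_cancel[OF riemann_series_abs_summable] .
  have s': "summable (\<lambda>k. diffs ?a k * z ^ k)" for z
    by (rule termdiff_converges_all[OF s])
  show thesis
  proof
    show "(riemann_series c has_real_derivative (\<Sum>k. diffs ?a k * z ^ k)) (at z)" for z
      unfolding riemann_series_def[abs_def] by (rule termdiffs_strong_converges_everywhere[OF s])
    show "continuous_on UNIV (\<lambda>z. \<Sum>k. diffs ?a k * z ^ k)"
      using DERIV_continuous_on[where s=UNIV, OF termdiffs_strong_converges_everywhere[OF s']] by blast
  qed
qed

lemma riemann_series_continuous: "continuous_on UNIV (riemann_series c)"
  by (rule riemann_series_deriv[of c]) (blast intro: DERIV_continuous_on has_field_derivative_at_within)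

lemma riemann_series_lipschitz:
  obtains L where "0 \<le> L" "\<And>y z. \<bar>y\<bar> \<le> R \<Longrightarrow> \<bar>z\<bar> \<le> R \<Longrightarrow> \<bar>riemann_series c y - riemann_series c z\<bar> \<le> L * \<bar>y - z\<bar>"
proof -
  obtain F' where F: "\<And>z. (riemann_series c has_real_derivative F' z) (at z)" "continuous_on UNIV F'"
    by (rule riemann_series_deriv[of c], rule that)
  have "compact (F' ` {-R..R})"
    by (intro compact_continuous_image continuous_on_subset[OF F(2)]) auto
  then obtain L where L: "\<And>z. z \<in> {-R..R} \<Longrightarrow> \<bar>F' z\<bar> \<le> L"
    using compact_imp_bounded[THEN bounded_iff[THEN iffD1]] by (metis imageI real_norm_def)
  show thesis
  proof
    show "0 \<le> \<bar>L\<bar>" by simp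
    fix y z :: real assume "\<bar>y\<bar> \<le> R" "\<bar>z\<bar> \<le> R"
    then have "norm (riemann_series c y - riemann_series c z) \<le> \<bar>L\<bar> * norm (y - z)"
      by (intro field_differentiable_bound[where S="{-R..R}" and f'=F'])
         (use L in \<open>auto intro: has_field_derivative_at_within[OF F(1)] order_trans[OF _ abs_ge_self]\<close>)
    then show "\<bar>riemann_series c y - riemann_series c z\<bar> \<le> \<bar>L\<bar> * \<bar>y - z\<bar>" by simp
  qed
qed

text \<open>Writing one factor \<open>t\<^sup>2 - x\<^sup>2\<close> as a difference reduces \<open>k\<close> by one, at the price of raising \<open>j\<close>; the closed
  form satisfies this recursion.\<close>

lemma beta_moment:
  assumes "0 \<le> (t::real)"
  shows "((\<lambda>x. (t\<^sup>2 - x\<^sup>2) ^ k * x ^ (2 * j)) has_integral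
    (2 * 4 ^ k * fact k * fact (2 * j) * fact (k + j) / (fact j * fact (2 * k + 2 * j + 1)) * t ^ (2 * k + 2 * j + 1))) {-t..t}"
proof (induction k arbitrary: j)
  case 0
  have "((\<lambda>x. x ^ (2 * j)) has_integral (t ^ (2 * j + 1) / real (2 * j + 1) - (-t) ^ (2 * j + 1) / real (2 * j + 1))) {-t..t}"
  proof (rule fundamental_theorem_of_calculus)
    fix x assume "x \<in> {-t..t}"
    have "((\<lambda>x. x ^ (2 * j + 1) / real (2 * j + 1)) has_real_derivative x ^ (2 * j)) (at x within {-t..t})"
      by (rule derivative_eq_intros refl | simp)+
    then show "((\<lambda>x. x ^ (2 * j + 1) / real (2 * j + 1)) has_vector_derivative x ^ (2 * j)) (at x within {-t..t})"
      by (simp add: has_real_derivative_iff_has_vector_derivative)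
  qed (use assms in auto)
  moreover have "fact (2 * 0 + 2 * j + 1) = real (2 * j + 1) * (fact (2 * j) :: real)" by simp
  then have "t ^ (2 * j + 1) / real (2 * j + 1) - (-t) ^ (2 * j + 1) / real (2 * j + 1)
     = 2 * 4 ^ 0 * fact 0 * fact (2 * j) * fact (0 + j) / (fact j * fact (2 * 0 + 2 * j + 1)) * t ^ (2 * 0 + 2 * j + 1)"
    by (simp only:) (simp add: divide_simps)
  ultimately show ?case by simp
next
  case (Suc k)
  have p: "t ^ (2 * k + 2 * Suc j + 1) = t\<^sup>2 * t ^ (2 * k + 2 * j + 1)" for j
    by (simp add: power2_eq_square)
  define F where "F = (fact (2 * k + 2 * j + 1) :: real)"
  have F: "F \<noteq> 0" by (simp add: F_def)
  have f1: "fact (2 * k + 2 * Suc j + 1) = real (2 * k + 2 * j + 3) * (real (2 * k + 2 * j + 2) * F)"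
  proof -
    have "2 * k + 2 * Suc j + 1 = Suc (Suc (2 * k + 2 * j + 1))" by simp
    then show ?thesis unfolding F_def by (simp only: fact_Suc) (simp add: algebra_simps)
  qed
  have f2: "fact (2 * Suc k + 2 * j + 1) = real (2 * k + 2 * j + 3) * (real (2 * k + 2 * j + 2) * F)"
    using f1 by simp
  have f3: "fact (2 * Suc j) = real (2 * j + 2) * (real (2 * j + 1) * fact (2 * j))"
  proof -
    have "2 * Suc j = Suc (Suc (2 * j))" by simp
    then show ?thesis by (simp only: fact_Suc) (simp add: algebra_simps)
  qed
  have f4: "fact (k + Suc j) = real (k + j + 1) * fact (k + j)" "fact (Suc k + j) = real (k + j + 1) * fact (k + j)"
    "fact (Suc j) = real (j + 1) * fact j" "fact (Suc k) = real (k + 1) * fact k" by simp_all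
  have "((\<lambda>x. t\<^sup>2 * ((t\<^sup>2 - x\<^sup>2) ^ k * x ^ (2 * j)) - (t\<^sup>2 - x\<^sup>2) ^ k * x ^ (2 * Suc j)) has_integral
     (t\<^sup>2 * (2 * 4 ^ k * fact k * fact (2 * j) * fact (k + j) / (fact j * F) * t ^ (2 * k + 2 * j + 1))
      - 2 * 4 ^ k * fact k * fact (2 * Suc j) * fact (k + Suc j) / (fact (Suc j) * fact (2 * k + 2 * Suc j + 1)) * t ^ (2 * k + 2 * Suc j + 1))) {-t..t}"
    unfolding F_def by (intro has_integral_diff has_integral_mult_right Suc.IH)
  also have "(\<lambda>x. t\<^sup>2 * ((t\<^sup>2 - x\<^sup>2) ^ k * x ^ (2 * j)) - (t\<^sup>2 - x\<^sup>2) ^ k * x ^ (2 * Suc j)) = (\<lambda>x. (t\<^sup>2 - x\<^sup>2) ^ Suc k * x ^ (2 * j))"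
    by (simp add: fun_eq_iff algebra_simps power2_eq_square)
  also have "t\<^sup>2 * (2 * 4 ^ k * fact k * fact (2 * j) * fact (k + j) / (fact j * F) * t ^ (2 * k + 2 * j + 1))
      - 2 * 4 ^ k * fact k * fact (2 * Suc j) * fact (k + Suc j) / (fact (Suc j) * fact (2 * k + 2 * Suc j + 1)) * t ^ (2 * k + 2 * Suc j + 1)
     = 2 * 4 ^ Suc k * fact (Suc k) * fact (2 * j) * fact (Suc k + j) / (fact j * fact (2 * Suc k + 2 * j + 1)) * t ^ (2 * Suc k + 2 * j + 1)"
  proof -
    have T: "t ^ (2 * Suc k + 2 * j + 1) = t\<^sup>2 * t ^ (2 * k + 2 * j + 1)" by (simp add: power2_eq_square)
    define T where "T = t\<^sup>2 * t ^ (2 * k + 2 * j + 1)"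
    define J K KJ J2 :: real where "J = fact j" and "K = fact k" and "KJ = fact (k + j)" and "J2 = fact (2 * j)"
    have J: "J \<noteq> 0" by (simp add: J_def)
    define x y where "x = real k" and "y = real j"
    have xy: "x \<ge> 0" "y \<ge> 0" by (simp_all add: x_def y_def)
    have alg: "2 * q * K * J2 * KJ / (J * F) * T
      - 2 * q * K * ((2 * y + 2) * ((2 * y + 1) * J2)) * ((x + y + 1) * KJ) / ((y + 1) * J * ((2 * x + 2 * y + 3) * ((2 * x + 2 * y + 2) * F))) * T
     = 2 * (4 * q) * ((x + 1) * K) * J2 * ((x + y + 1) * KJ) / (J * ((2 * x + 2 * y + 3) * ((2 * x + 2 * y + 2) * F))) * T" for q
    proof -
      define S where "S = x + y + 1"
      have S: "S > 0" "2 * x + 2 * y + 3 = 2 * S + 1" "2 * x + 2 * y + 2 = 2 * S" "x + y + 1 = S" "x = S - 1 - y"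
        using xy by (auto simp: S_def)
      have S': "2 * S + 1 \<noteq> 0" "S \<noteq> 0" "y + 1 \<noteq> 0" using S(1) xy by auto
      show ?thesis unfolding S(2-4) using J F S' by (simp add: divide_simps) (simp add: S(5) algebra_simps)
    qed
    have r: "real (2 * k + 2 * j + 3) = 2 * x + 2 * y + 3" "real (2 * k + 2 * j + 2) = 2 * x + 2 * y + 2"
      "real (2 * j + 2) = 2 * y + 2" "real (2 * j + 1) = 2 * y + 1" "real (k + j + 1) = x + y + 1"
      "real (j + 1) = y + 1" "real (k + 1) = x + 1"
      by (simp_all add: x_def y_def)
    have u: "t\<^sup>2 * (B * t ^ (2 * k + 2 * j + 1)) = B * T" for B by (simp add: T_def)
    show ?thesis
      unfolding p T f1 f2 f3 f4 u T_def[symmetric] J_def[symmetric] K_def[symmetric] KJ_def[symmetric] J2_def[symmetric] r power_Suc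
      by (rule alg)
  qed
  finally show ?case .
qed

text \<open>One entire function of \<open>\<mu>\<close> for the three cases of the Fourier transform: \<open>sinh (t \<surd>\<mu>) / \<surd>\<mu>\<close> for
  \<open>\<mu> > 0\<close>, \<open>t\<close> for \<open>\<mu> = 0\<close> and \<open>sin (t \<surd>(- \<mu>)) / \<surd>(- \<mu>)\<close> for \<open>\<mu> < 0\<close>.\<close>

definition sine_series :: "real \<Rightarrow> real \<Rightarrow> real" where
  "sine_series \<mu> t = (\<Sum>n. \<mu> ^ n * t ^ (2 * n + 1) / fact (2 * n + 1))"

lemma sine_series_sums: "(\<lambda>n. \<mu> ^ n * t ^ (2 * n + 1) / fact (2 * n + 1)) sums sine_series \<mu> t"
  and sine_series_zero: "sine_series 0 t = t"
  and sine_series_pos: "0 < \<mu> \<Longrightarrow> sine_series \<mu> t = sinh (t * sqrt \<mu>) / sqrt \<mu>"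
  and sine_series_neg: "\<mu> < 0 \<Longrightarrow> sine_series \<mu> t = sin (t * sqrt (- \<mu>)) / sqrt (- \<mu>)"
proof -
  have pos: "(\<lambda>n. \<mu> ^ n * t ^ (2 * n + 1) / fact (2 * n + 1)) sums (sinh (t * sqrt \<mu>) / sqrt \<mu>)" if "0 < \<mu>"
  proof -
    let ?f = "\<lambda>n. if even n then 0 else (t * sqrt \<mu>) ^ n /\<^sub>R fact n"
    have "(\<lambda>n. \<Sum>k = n*2..<n * 2 + 2. ?f k) sums sinh (t * sqrt \<mu>)"
      by (rule sums_group) (use sinh_converges in auto)
    moreover have "(\<Sum>k = n*2..<n * 2 + 2. ?f k) = sqrt \<mu> * (\<mu> ^ n * t ^ (2 * n + 1) / fact (2 * n + 1))" for n
    proof -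
      have "(t * sqrt \<mu>) ^ (2 * n + 1) = sqrt \<mu> * (\<mu> ^ n * t ^ (2 * n + 1))"
        using that by (simp add: power_mult_distrib power_mult)
      moreover have "{n*2..<n * 2 + 2} = {2 * n, 2 * n + 1}" by auto
      ultimately show ?thesis
        by (simp add: divide_inverse mult_ac del: power_Suc fact_Suc)
    qed
    ultimately have "(\<lambda>n. sqrt \<mu> * (\<mu> ^ n * t ^ (2 * n + 1) / fact (2 * n + 1))) sums sinh (t * sqrt \<mu>)" by simp
    from sums_divide[OF this, of "sqrt \<mu>"] show ?thesis using that by simp
  qed
  have neg: "(\<lambda>n. \<mu> ^ n * t ^ (2 * n + 1) / fact (2 * n + 1)) sums (sin (t * sqrt (- \<mu>)) / sqrt (- \<mu>))" if "\<mu> < 0"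
  proof -
    have "sqrt (- \<mu>) ^ (2 * n + 1) = sqrt (- \<mu>) * (- \<mu>) ^ n" for n
      using that by (simp add: power_mult)
    then have "(t * sqrt (- \<mu>)) ^ (2 * n + 1) = sqrt (- \<mu>) * ((- \<mu>) ^ n * t ^ (2 * n + 1))" for n
      by (simp only: power_mult_distrib mult_ac)
    then have "(\<lambda>n. (- 1) ^ n / fact (2 * n + 1) * (sqrt (- \<mu>) * ((- \<mu>) ^ n * t ^ (2 * n + 1)))) sums sin (t * sqrt (- \<mu>))"
      using sin_paired[of "t * sqrt (- \<mu>)"] by (simp only:)
    from sums_divide[OF this, of "sqrt (- \<mu>)"]
    have "(\<lambda>n. (- 1) ^ n / fact (2 * n + 1) * ((- \<mu>) ^ n * t ^ (2 * n + 1))) sums (sin (t * sqrt (- \<mu>)) / sqrt (- \<mu>))"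
      using that by (simp add: mult.assoc)
    moreover have "(- 1) ^ n / fact (2 * n + 1) * ((- \<mu>) ^ n * t ^ (2 * n + 1)) = \<mu> ^ n * t ^ (2 * n + 1) / fact (2 * n + 1)" for n
    proof -
      have "(- 1) ^ n * (- \<mu>) ^ n = \<mu> ^ n" by (simp flip: power_mult_distrib)
      then have "((- 1) ^ n * (- \<mu>) ^ n) * t ^ (2 * n + 1) / fact (2 * n + 1) = \<mu> ^ n * t ^ (2 * n + 1) / fact (2 * n + 1)"
        by (simp only:)
      then show ?thesis by (simp only: times_divide_eq_left mult.assoc)
    qed
    ultimately show ?thesis by (simp only:)
  qed
  have zero: "(\<lambda>n. 0 ^ n * t ^ (2 * n + 1) / fact (2 * n + 1)) sums t"
  proof -
    have "(\<lambda>n. 0 ^ n * t ^ (2 * n + 1) / fact (2 * n + 1)) = (\<lambda>n. if n = 0 then t else 0)"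
      by (auto simp: fun_eq_iff power_0_left)
    then show ?thesis using sums_single[of 0 "\<lambda>_. t"] by simp
  qed
  show "(\<lambda>n. \<mu> ^ n * t ^ (2 * n + 1) / fact (2 * n + 1)) sums sine_series \<mu> t"
    unfolding sine_series_def
    using pos neg zero by (cases \<mu> "0 :: real" rule: linorder_cases) (auto intro!: summable_sums dest: sums_summable)
  show "sine_series 0 t = t" unfolding sine_series_def using zero by (rule sums_unique[symmetric])
  show "0 < \<mu> \<Longrightarrow> sine_series \<mu> t = sinh (t * sqrt \<mu>) / sqrt \<mu>"
    unfolding sine_series_def using pos by (auto intro: sums_unique[symmetric])
  show "\<mu> < 0 \<Longrightarrow> sine_series \<mu> t = sin (t * sqrt (- \<mu>)) / sqrt (- \<mu>)"
    unfolding sine_series_def using neg by (auto intro: sums_unique[symmetric])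
qed

lemma G_hat_eq_sine_series: "G_hat a m t \<xi> = exp (- a * t / 2) * sine_series (a\<^sup>2 / 4 - m\<^sup>2 - \<xi>\<^sup>2) t"
proof (cases "\<xi>\<^sup>2" "a\<^sup>2 / 4 - m\<^sup>2" rule: linorder_cases)
  case less
  then show ?thesis by (subst sine_series_pos) (auto simp: G_hat_def)
next
  case equal
  then show ?thesis by (simp add: G_hat_def sine_series_zero)
next
  case greater
  then show ?thesis by (subst sine_series_neg) (auto simp: G_hat_def algebra_simps)
qed

text \<open>In the Cauchy product of the series for the kernel and for the cosine, the terms of total degree \<open>n\<close>
  integrate, by \<open>beta_moment\<close>, to the binomial expansion of \<open>(c - \<xi>\<^sup>2)\<^sup>n\<close>. The Cauchy product of the
  series of absolute bounds dominates the partial sums.\<close>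

lemma riemann_cosine_transform:
  assumes t: "0 \<le> t"
  shows "((\<lambda>x. riemann_series c (t\<^sup>2 - x\<^sup>2) * cos (x * \<xi>)) has_integral 2 * sine_series (c - \<xi>\<^sup>2) t) {-t..t}"
proof -
  define A where "A x k = (c / 4) ^ k / (fact k)\<^sup>2 * (t\<^sup>2 - x\<^sup>2) ^ k" for x k
  define B where "B x j = (- 1) ^ j / fact (2 * j) * (x * \<xi>) ^ (2 * j)" for x and j :: nat
  define p where "p x n = (\<Sum>i\<le>n. A x i * B x (n - i))" for x n
  define A' where "A' k = norm ((\<bar>c\<bar> / 4) ^ k / (fact k)\<^sup>2 * (t\<^sup>2) ^ k)" for k
  define B' where "B' j = \<bar>t * \<xi>\<bar> ^ (2 * j) / fact (2 * j)" for j :: nat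
  have sB: "summable (\<lambda>j. \<bar>y\<bar> ^ (2 * j) / fact (2 * j))" for y :: real
  proof (rule summable_comparison_test', rule summable_exp[of "y\<^sup>2"])
    fix j :: nat
    have "(fact j :: real) \<le> fact (2 * j)" by (rule fact_mono) simp
    then have "(y\<^sup>2) ^ j / fact (2 * j) \<le> (y\<^sup>2) ^ j / fact j" by (intro divide_left_mono) auto
    moreover have "\<bar>y\<bar> ^ (2 * j) = (y\<^sup>2) ^ j" by (simp only: power_mult power2_abs)
    ultimately show "norm (\<bar>y\<bar> ^ (2 * j) / fact (2 * j)) \<le> inverse (fact j) * (y\<^sup>2) ^ j"
      by (simp add: divide_inverse mult.commute)
  qed
  have A: "A x sums riemann_series c (t\<^sup>2 - x\<^sup>2)" "summable (\<lambda>k. norm (A x k))" for x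
    unfolding A_def[abs_def] using riemann_series_sums riemann_series_abs_summable by auto
  have B: "B x sums cos (x * \<xi>)" for x
    unfolding B_def[abs_def] using cos_paired by auto
  have B2: "norm (B x j) = \<bar>x * \<xi>\<bar> ^ (2 * j) / fact (2 * j)" for x j
    by (simp only: B_def real_norm_def abs_mult abs_divide power_abs) simp
  have sBx: "summable (\<lambda>j. norm (B x j))" for x
    using sB[of "x * \<xi>"] by (simp only: B2)
  have psum: "p x sums (riemann_series c (t\<^sup>2 - x\<^sup>2) * cos (x * \<xi>))" for x
    using Cauchy_product_sums[OF A(2)[of x] sBx[of x]]
    unfolding p_def[abs_def] by (simp only: sums_unique[OF A(1), symmetric] sums_unique[OF B, symmetric])
  define q where "q n = (\<Sum>i\<le>n. A' i * B' (n - i))" for n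
  have qs: "summable q"
    unfolding q_def[abs_def] using riemann_series_abs_summable[of "\<bar>c\<bar>" "t\<^sup>2"] sB[of "t * \<xi>"]
    by (intro summable_Cauchy_product) (auto simp: A'_def B'_def)
  have pq: "norm (p x n) \<le> q n" if "x \<in> {-t..t}" for x n
  proof -
    have x: "\<bar>x\<bar> \<le> t" using that by auto
    have x2: "x\<^sup>2 \<le> t\<^sup>2" using power_mono[OF x, of 2] by simp
    have "norm (A x k) \<le> A' k" for k
    proof -
      have "\<bar>t\<^sup>2 - x\<^sup>2\<bar> ^ k \<le> (t\<^sup>2) ^ k" using x2 by (intro power_mono) auto
      then show ?thesis
        unfolding A_def A'_def by (auto simp: abs_mult power_abs power_divide intro!: divide_right_mono mult_left_mono)
    qed
    moreover have "norm (B x j) \<le> B' j" for j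
      unfolding B2 B'_def using x t by (intro divide_right_mono power_mono) (auto simp: abs_mult intro!: mult_right_mono)
    ultimately have "norm (A x i * B x (n - i)) \<le> A' i * B' (n - i)" for i
      unfolding norm_mult by (intro mult_mono) (auto simp: A'_def)
    then show ?thesis unfolding p_def q_def by (intro order_trans[OF norm_sum] sum_mono) auto
  qed
  have q0: "0 \<le> q n" for n unfolding q_def A'_def B'_def by (intro sum_nonneg mult_nonneg_nonneg) auto
  have pint: "((\<lambda>x. p x n) has_integral 2 * ((c - \<xi>\<^sup>2) ^ n * t ^ (2 * n + 1) / fact (2 * n + 1))) {-t..t}" for n
  proof -
    let ?M = "\<lambda>k j. 2 * 4 ^ k * fact k * fact (2 * j) * fact (k + j) / (fact j * fact (2 * k + 2 * j + 1)) * t ^ (2 * k + 2 * j + 1) :: real"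
    have "((\<lambda>x. \<Sum>i\<le>n. ((c / 4) ^ i / (fact i)\<^sup>2 * ((- 1) ^ (n - i) / fact (2 * (n - i)) * \<xi> ^ (2 * (n - i)))) *
        ((t\<^sup>2 - x\<^sup>2) ^ i * x ^ (2 * (n - i)))) has_integral
        (\<Sum>i\<le>n. ((c / 4) ^ i / (fact i)\<^sup>2 * ((- 1) ^ (n - i) / fact (2 * (n - i)) * \<xi> ^ (2 * (n - i)))) * ?M i (n - i))) {-t..t}"
      by (intro has_integral_sum has_integral_mult_right beta_moment t) auto
    moreover have "(\<lambda>x. \<Sum>i\<le>n. ((c / 4) ^ i / (fact i)\<^sup>2 * ((- 1) ^ (n - i) / fact (2 * (n - i)) * \<xi> ^ (2 * (n - i)))) *
        ((t\<^sup>2 - x\<^sup>2) ^ i * x ^ (2 * (n - i)))) = (\<lambda>x. p x n)"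
      by (auto simp: fun_eq_iff p_def A_def B_def power_mult_distrib intro!: sum.cong)
    moreover have "(\<Sum>i\<le>n. ((c / 4) ^ i / (fact i)\<^sup>2 * ((- 1) ^ (n - i) / fact (2 * (n - i)) * \<xi> ^ (2 * (n - i)))) * ?M i (n - i))
       = (\<Sum>i\<le>n. 2 * t ^ (2 * n + 1) / fact (2 * n + 1) * (of_nat (n choose i) * c ^ i * (- \<xi>\<^sup>2) ^ (n - i)))"
    proof (rule sum.cong[OF refl])
      fix i assume "i \<in> {..n}"
      then have i: "i \<le> n" by simp
      have e: "2 * i + 2 * (n - i) + 1 = 2 * n + 1" "i + (n - i) = n" using i by auto
      have s: "(- \<xi>\<^sup>2) ^ (n - i) = (- 1) ^ (n - i) * \<xi> ^ (2 * (n - i))"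
        by (simp add: power_mult flip: power_mult_distrib)
      have b: "real (n choose i) = fact n / (fact i * fact (n - i))" using i by (rule binomial_fact)
      show "((c / 4) ^ i / (fact i)\<^sup>2 * ((- 1) ^ (n - i) / fact (2 * (n - i)) * \<xi> ^ (2 * (n - i)))) * ?M i (n - i)
         = 2 * t ^ (2 * n + 1) / fact (2 * n + 1) * (of_nat (n choose i) * c ^ i * (- \<xi>\<^sup>2) ^ (n - i))"
        unfolding e s b power_divide
        by (simp add: power2_eq_square divide_simps del: fact_Suc power_Suc)
    qed
    moreover have "\<dots> = 2 * ((c - \<xi>\<^sup>2) ^ n * t ^ (2 * n + 1) / fact (2 * n + 1))"
    proof -
      have "(c - \<xi>\<^sup>2) ^ n = (\<Sum>i\<le>n. of_nat (n choose i) * c ^ i * (- \<xi>\<^sup>2) ^ (n - i))"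
        using binomial_ring[of c "- \<xi>\<^sup>2" n] by simp
      then show ?thesis by (simp only: sum_distrib_left[symmetric]) simp
    qed
    ultimately show ?thesis by simp
  qed
  show ?thesis
  proof (rule has_integral_dominated_convergence)
    show "((\<lambda>x. \<Sum>n<N. p x n) has_integral (\<Sum>n<N. 2 * ((c - \<xi>\<^sup>2) ^ n * t ^ (2 * n + 1) / fact (2 * n + 1)))) {-t..t}" for N
      by (intro has_integral_sum pint) auto
    show "(\<lambda>_. suminf q) integrable_on {-t..t}" by (rule integrable_const_ivl)
    show "\<forall>x\<in>{-t..t}. norm (\<Sum>n<N. p x n) \<le> suminf q" for N
    proof
      fix x assume x: "x \<in> {-t..t}"
      have "norm (\<Sum>n<N. p x n) \<le> (\<Sum>n<N. q n)" by (intro order_trans[OF norm_sum] sum_mono pq x)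
      also have "\<dots> \<le> suminf q" by (rule sum_le_suminf[OF qs]) (use q0 in auto)
      finally show "norm (\<Sum>n<N. p x n) \<le> suminf q" .
    qed
    show "\<forall>x\<in>{-t..t}. (\<lambda>N. \<Sum>n<N. p x n) \<longlonglongrightarrow> riemann_series c (t\<^sup>2 - x\<^sup>2) * cos (x * \<xi>)"
      using psum by (auto simp: sums_def)
    show "(\<lambda>N. \<Sum>n<N. 2 * ((c - \<xi>\<^sup>2) ^ n * t ^ (2 * n + 1) / fact (2 * n + 1))) \<longlonglongrightarrow> 2 * sine_series (c - \<xi>\<^sup>2) t"
      using sums_mult[OF sine_series_sums[of "c - \<xi>\<^sup>2" t], of 2] by (simp only: sums_def)
  qed
qed

text \<open>The closed cone is used, so that the integrands below are supported in closed regions.\<close>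

definition green :: "real \<Rightarrow> real \<Rightarrow> real \<Rightarrow> real \<Rightarrow> real" where
  "green a m t x = (if \<bar>x\<bar> \<le> t then exp (- a * t / 2) / 2 * riemann_series (a\<^sup>2 / 4 - m\<^sup>2) (t\<^sup>2 - x\<^sup>2) else 0)"

lemma green_fourier:
  assumes t: "0 < t"
  shows "integrable lborel (green a m t)"
    and "(CLINT x|lborel. of_real (green a m t x) * exp (- \<i> * of_real (x * \<xi>))) = of_real (G_hat a m t \<xi>)"
proof -
  let ?F = "\<lambda>x. riemann_series (a\<^sup>2 / 4 - m\<^sup>2) (t\<^sup>2 - x\<^sup>2)"
  have cF: "continuous_on S ?F" for S
    by (rule continuous_on_compose2[OF riemann_series_continuous]) (auto intro!: continuous_intros)
  have gi: "integrable lborel (\<lambda>x. green a m t x * h x)" if "continuous_on {-t..t} h" for h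
  proof -
    have "integrable lborel (\<lambda>x. indicator {-t..t} x *\<^sub>R (exp (- a * t / 2) / 2 * ?F x * h x))"
      using that by (intro borel_integrable_compact continuous_intros cF) auto
    also have "(\<lambda>x. indicator {-t..t} x *\<^sub>R (exp (- a * t / 2) / 2 * ?F x * h x)) = (\<lambda>x. green a m t x * h x)"
      by (auto simp: fun_eq_iff green_def indicator_def abs_le_iff)
    finally show ?thesis .
  qed
  show "integrable lborel (green a m t)" using gi[of "\<lambda>_. 1"] by simp
  have ic: "integrable lborel (\<lambda>x. green a m t x * cos (x * \<xi>))" and isn: "integrable lborel (\<lambda>x. green a m t x * sin (x * \<xi>))"
    by (auto intro!: gi continuous_intros)
  have "(\<integral>x. green a m t x * cos (x * \<xi>) \<partial>lborel) = G_hat a m t \<xi>"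
  proof (rule has_integral_unique)
    show "((\<lambda>x. green a m t x * cos (x * \<xi>)) has_integral (\<integral>x. green a m t x * cos (x * \<xi>) \<partial>lborel)) UNIV"
      by (rule has_integral_integral_lborel[OF ic])
    have "((\<lambda>x. exp (- a * t / 2) / 2 * (?F x * cos (x * \<xi>))) has_integral
        (exp (- a * t / 2) / 2 * (2 * sine_series (a\<^sup>2 / 4 - m\<^sup>2 - \<xi>\<^sup>2) t))) {-t..t}"
      using t by (intro has_integral_mult_right riemann_cosine_transform) auto
    then have "((\<lambda>x. if x \<in> {-t..t} then exp (- a * t / 2) / 2 * (?F x * cos (x * \<xi>)) else 0) has_integral
        (exp (- a * t / 2) / 2 * (2 * sine_series (a\<^sup>2 / 4 - m\<^sup>2 - \<xi>\<^sup>2) t))) UNIV"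
      by (simp only: has_integral_restrict_UNIV)
    moreover have "(\<lambda>x. if x \<in> {-t..t} then exp (- a * t / 2) / 2 * (?F x * cos (x * \<xi>)) else 0) = (\<lambda>x. green a m t x * cos (x * \<xi>))"
      by (auto simp: fun_eq_iff green_def abs_le_iff)
    ultimately show "((\<lambda>x. green a m t x * cos (x * \<xi>)) has_integral G_hat a m t \<xi>) UNIV"
      by (simp add: G_hat_eq_sine_series)
  qed
  moreover have "(\<integral>x. green a m t x * sin (x * \<xi>) \<partial>lborel) = 0"
  proof -
    have "(\<integral>x. green a m t x * sin (x * \<xi>) \<partial>lborel) = (\<integral>x. green a m t (0 + (-1) * x) * sin ((0 + (-1) * x) * \<xi>) \<partial>lborel)"
      by (subst lborel_integral_real_affine[where c="-1" and t=0]) auto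
    also have "\<dots> = - (\<integral>x. green a m t x * sin (x * \<xi>) \<partial>lborel)"
    proof -
      have "green a m t (- x) = green a m t x" for x by (simp add: green_def)
      then show ?thesis by simp
    qed
    finally show ?thesis by simp
  qed
  moreover have "(CLINT x|lborel. of_real (green a m t x) * exp (- \<i> * of_real (x * \<xi>)))
     = (CLINT x|lborel. of_real (green a m t x * cos (x * \<xi>)) - \<i> * of_real (green a m t x * sin (x * \<xi>)))"
    by (rule Bochner_Integration.integral_cong) (auto simp: complex_eq_iff Re_exp Im_exp)
  moreover have "\<dots> = of_real (\<integral>x. green a m t x * cos (x * \<xi>) \<partial>lborel) - \<i> * of_real (\<integral>x. green a m t x * sin (x * \<xi>) \<partial>lborel)"
    using ic isn by (subst Bochner_Integration.integral_diff) (auto intro!: integrable_of_real integrable_mult_right simp del: of_real_mult)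
  ultimately show "(CLINT x|lborel. of_real (green a m t x) * exp (- \<i> * of_real (x * \<xi>))) = of_real (G_hat a m t \<xi>)"
    by simp
qed

text \<open>Uniqueness of characteristic functions, applied to the positive and the negative part of \<open>d\<close> after
  dividing both by their common total mass.\<close>

lemma fourier_L1_unique:
  fixes d :: "real \<Rightarrow> real"
  assumes d: "integrable lborel d"
    and F: "\<And>\<xi>. (CLINT x|lborel. of_real (d x) * iexp (\<xi> * x)) = 0"
  shows "AE x in lborel. d x = 0"
proof -
  have [measurable]: "d \<in> borel_measurable borel" using borel_measurable_integrable[OF d] by simp
  define P N where "P x = max 0 (d x)" and "N x = max 0 (- d x)" for x
  have [measurable]: "P \<in> borel_measurable borel" "N \<in> borel_measurable borel" by (simp_all add: P_def[abs_def] N_def[abs_def])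
  have PN0: "0 \<le> P x" "0 \<le> N x" "d x = P x - N x" for x by (auto simp: P_def N_def)
  have iPN: "integrable lborel P" "integrable lborel N"
    by (auto intro!: Bochner_Integration.integrable_bound[OF d] simp: P_def N_def)
  have ie: "complex_integrable lborel (\<lambda>x. of_real (h x) * iexp (\<xi> * x))"
    if [measurable]: "integrable lborel h" for h :: "real \<Rightarrow> real" and \<xi>
    by (rule Bochner_Integration.integrable_bound[OF that]) (use that in \<open>auto simp: norm_mult\<close>)
  have eq: "(CLINT x|lborel. of_real (P x) * iexp (\<xi> * x)) = (CLINT x|lborel. of_real (N x) * iexp (\<xi> * x))" for \<xi>
  proof -
    have "(CLINT x|lborel. of_real (P x) * iexp (\<xi> * x)) - (CLINT x|lborel. of_real (N x) * iexp (\<xi> * x))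
      = (CLINT x|lborel. of_real (d x) * iexp (\<xi> * x))"
      by (subst Bochner_Integration.integral_diff[symmetric, OF ie[OF iPN(1)] ie[OF iPN(2)]])
         (simp add: PN0(3) algebra_simps)
    then show ?thesis by (simp only: F right_minus_eq)
  qed
  define \<kappa> where "\<kappa> = (\<integral>x. P x \<partial>lborel)"
  have \<kappa>N: "\<kappa> = (\<integral>x. N x \<partial>lborel)"
    using eq[of 0] by (simp add: \<kappa>_def)
  have \<kappa>0: "0 \<le> \<kappa>" by (simp add: \<kappa>_def PN0)
  show ?thesis
  proof (cases "\<kappa> = 0")
    case True
    have "AE x in lborel. P x = 0" "AE x in lborel. N x = 0"
      using integral_nonneg_eq_0_iff_AE[OF iPN(1)] integral_nonneg_eq_0_iff_AE[OF iPN(2)] True \<kappa>N PN0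
      by (auto simp: \<kappa>_def)
    then show ?thesis by eventually_elim (simp add: PN0(3))
  next
    case False
    then have \<kappa>: "0 < \<kappa>" using \<kappa>0 by simp
    have rd: "real_distribution (density lborel (\<lambda>x. h x / \<kappa>))"
      if [measurable]: "h \<in> borel_measurable borel" and "integrable lborel h" "\<And>x. 0 \<le> h x" "(\<integral>x. h x \<partial>lborel) = \<kappa>" for h
    proof -
      have "prob_space (density lborel (\<lambda>x. h x / \<kappa>))"
        by (rule prob_spaceI)
           (use that \<kappa> in \<open>simp add: emeasure_density nn_integral_eq_integral\<close>)
      then show ?thesis by (auto simp: real_distribution_def real_distribution_axioms_def)
    qed
    have ch: "char (density lborel (\<lambda>x. h x / \<kappa>)) \<xi> = (CLINT x|lborel. of_real (h x) * iexp (\<xi> * x)) / of_real \<kappa>"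
      if [measurable]: "h \<in> borel_measurable borel" and "\<And>x. 0 \<le> h x" for h \<xi>
      unfolding char_def using that \<kappa>
      by (subst integral_density) (auto simp: scaleR_conv_of_real simp flip: integral_divide_zero)
    have "density lborel (\<lambda>x. P x / \<kappa>) = density lborel (\<lambda>x. N x / \<kappa>)"
    proof (rule Levy_uniqueness)
      have "char (density lborel (\<lambda>x. P x / \<kappa>)) \<xi> = char (density lborel (\<lambda>x. N x / \<kappa>)) \<xi>" for \<xi>
        using ch[of P \<xi>] ch[of N \<xi>] PN0 by (simp only: eq) simp
      then show "char (density lborel (\<lambda>x. P x / \<kappa>)) = char (density lborel (\<lambda>x. N x / \<kappa>))" by (rule ext)
    qed (auto simp: PN0 iPN \<kappa>N[symmetric] \<kappa>_def[symmetric] intro!: rd)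
    then have "AE x in lborel. ennreal (P x / \<kappa>) = ennreal (N x / \<kappa>)"
      by (intro sigma_finite_measure.density_unique) (auto intro: lborel.sigma_finite_measure_axioms)
    then show ?thesis
    proof eventually_elim
      case (elim x)
      then have "P x / \<kappa> = N x / \<kappa>" using PN0 \<kappa> by (subst (asm) ennreal_inj) auto
      then show ?case using \<kappa> by (simp add: PN0(3))
    qed
  qed
qed

lemma fundamental_solution_eq_green:
  assumes G: "fundamental_solution a m G" and t: "0 < t"
  shows "AE x in lborel. G t x = green a m t x"
proof -
  have Gi: "integrable lborel (G t)"
    and GF: "(CLINT x|lborel. of_real (G t x) * exp (- \<i> * of_real (x * \<xi>))) = of_real (G_hat a m t \<xi>)" for \<xi>
    using G t by (auto simp: fundamental_solution_def)
  note gi = green_fourier[OF t, of a m]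
  have ie: "complex_integrable lborel (\<lambda>x. of_real (h x) * exp (- \<i> * of_real (x * \<xi>)))"
    if [measurable]: "integrable lborel h" for h :: "real \<Rightarrow> real" and \<xi>
    by (rule Bochner_Integration.integrable_bound[OF that]) (use that in \<open>auto simp: norm_mult\<close>)
  have "AE x in lborel. G t x - green a m t x = 0"
  proof (rule fourier_L1_unique)
    show "integrable lborel (\<lambda>x. G t x - green a m t x)" using Gi gi(1) by auto
    fix \<xi>
    have "(CLINT x|lborel. of_real (G t x - green a m t x) * iexp (\<xi> * x))
       = (CLINT x|lborel. of_real (G t x) * exp (- \<i> * of_real (x * (-\<xi>))) - of_real (green a m t x) * exp (- \<i> * of_real (x * (-\<xi>))))"
      by (simp add: algebra_simps)
    also have "\<dots> = 0"
      by (subst Bochner_Integration.integral_diff[OF ie[OF Gi] ie[OF gi(1)]]) (simp only: GF gi(2), simp)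
    finally show "(CLINT x|lborel. of_real (G t x - green a m t x) * iexp (\<xi> * x)) = 0" .
  qed
  then show ?thesis by simp
qed

lemma green_measurable[measurable (raw)]:
  assumes [measurable]: "f \<in> borel_measurable M" "g \<in> borel_measurable M"
  shows "(\<lambda>p. green a m (f p) (g p)) \<in> borel_measurable M"
proof -
  have [measurable]: "riemann_series c \<in> borel_measurable borel" for c
    using riemann_series_continuous by (rule borel_measurable_continuous_onI)
  show ?thesis unfolding green_def by measurable
qed

text \<open>The kernel is determined up to a null set for each time; by Fubini this suffices for almost every
  space-time point.\<close>

lemma mild_integrand_eq_green:
  assumes G: "fundamental_solution a m G"
  shows "AE p in lborel. (case p of (s, y) \<Rightarrow> indicator {0..t} s * G (t - s) (x - y))
       = (case p of (s, y) \<Rightarrow> indicator {0..t} s * green a m (t - s) (x - y))"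
proof -
  have Gm: "(\<lambda>(t, x). G t x) \<in> borel_measurable borel" using G by (simp add: fundamental_solution_def)
  have [measurable (raw)]: "(\<lambda>p. G (f p) (g p)) \<in> borel_measurable N"
    if [measurable]: "f \<in> borel_measurable N" "g \<in> borel_measurable N" for f g and N :: "'b measure"
    using measurable_compose[OF _ Gm, of "\<lambda>p. (f p, g p)" N] by (simp add: borel_prod[symmetric])
  have "AE p in lborel \<Otimes>\<^sub>M lborel. (case p of (s, y) \<Rightarrow> indicator {0..t} s * G (t - s) (x - y))
       = (case p of (s, y) \<Rightarrow> indicator {0..t} s * green a m (t - s) (x - y))"
  proof (rule lborel_pair.AE_pair_measure)
    show "{p \<in> space (lborel \<Otimes>\<^sub>M lborel). (case p of (s, y) \<Rightarrow> indicator {0..t} s * G (t - s) (x - y))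
       = (case p of (s, y) \<Rightarrow> indicator {0..t} s * green a m (t - s) (x - y))} \<in> sets (lborel \<Otimes>\<^sub>M lborel)"
      by measurable
    have "AE s in lborel. s \<noteq> t" by (rule AE_lborel_singleton)
    then show "AE s in lborel. AE y in lborel. (case (s, y) of (s, y) \<Rightarrow> indicator {0..t} s * G (t - s) (x - y))
       = (case (s, y) of (s, y) \<Rightarrow> indicator {0..t} s * green a m (t - s) (x - y))"
    proof eventually_elim
      case (elim s)
      show ?case
      proof (cases "s < t")
        case True
        then have "AE z in lborel. G (t - s) z = green a m (t - s) z"
          by (intro fundamental_solution_eq_green[OF G]) simp
        then have "emeasure lborel {z. G (t - s) z \<noteq> green a m (t - s) z} = 0"
          by (subst (asm) AE_iff_measurable[OF _ refl]) auto
        then have "(\<integral>\<^sup>+z. indicator {z. G (t - s) z \<noteq> green a m (t - s) z} z \<partial>lborel) = 0" by simp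
        then have "(\<integral>\<^sup>+y. indicator {z. G (t - s) z \<noteq> green a m (t - s) z} (x + (-1) * y) \<partial>lborel) = 0"
          by (subst (asm) nn_integral_real_affine[where c="-1" and t=x]) auto
        then have "AE y in lborel. indicator {z. G (t - s) z \<noteq> green a m (t - s) z} (x + (-1) * y) = (0::ennreal)"
          by (subst (asm) nn_integral_0_iff_AE) auto
        then show ?thesis by eventually_elim (auto simp: indicator_def split: if_splits)
      next
        case False
        then show ?thesis using elim by simp
      qed
    qed
  qed
  then show ?thesis by (simp only: lborel_prod)
qed

section \<open>The variance of increments along a characteristic\<close>

text \<open>The integral \<open>\<integral>\<^sub>0\<^sup>t exp (- a r) dr\<close>, twice the variance rate of the solution along the characteristic.\<close>

definition age_integral :: "real \<Rightarrow> real \<Rightarrow> real" where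
  "age_integral a t = (if a = 0 then t else (1 - exp (- a * t)) / a)"

lemma age_integral_deriv: "(age_integral a has_real_derivative exp (- a * t)) (at t within S)"
proof (cases "a = 0")
  case True
  then have "age_integral a = (\<lambda>t. t)" by (auto simp: age_integral_def)
  then show ?thesis using True by simp
next
  case False
  then have "age_integral a = (\<lambda>t. (1 - exp (- a * t)) / a)" by (auto simp: age_integral_def)
  then show ?thesis using False by (auto intro!: derivative_eq_intros)
qed

lemma age_integral_0[simp]: "age_integral a 0 = 0"
  by (simp add: age_integral_def)

lemma age_integral_continuous: "isCont (age_integral a) t"
  using age_integral_deriv[of a t UNIV] by (rule DERIV_isCont)

lemma age_integral_less: "s < t \<Longrightarrow> age_integral a s < age_integral a t"
  by (rule DERIV_pos_imp_increasing[of s t "age_integral a"]) (auto intro!: age_integral_deriv exI[of _ "exp (- a * _)"])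

lemma age_integral_mono: "s \<le> t \<Longrightarrow> age_integral a s \<le> age_integral a t"
  using age_integral_less[of s t a] by (cases "s = t") auto

lemma age_integral_pos: "0 < t \<Longrightarrow> 0 < age_integral a t"
  using age_integral_less[of 0 t a] by simp

lemma integral_exp_age:
  assumes "0 \<le> b"
  shows "integrable lborel (\<lambda>s. indicator {0..b} s * exp (- a * (t - s)))"
    and "(\<integral>s. indicator {0..b} s * exp (- a * (t - s)) \<partial>lborel) = age_integral a t - age_integral a (t - b)"
proof -
  have "integrable lborel (\<lambda>s. exp (- a * (t - s)) * indicator {0..b} s)"
    by (rule borel_integrable_atLeastAtMost) (intro continuous_intros)
  then show "integrable lborel (\<lambda>s. indicator {0..b} s * exp (- a * (t - s)))" by (simp add: mult.commute)
  have "(\<integral>s. exp (- a * (t - s)) * indicator {0..b} s \<partial>lborel) = - age_integral a (t - b) - (- age_integral a (t - 0))"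
  proof (rule integral_FTC_Icc_real[OF assms])
    fix s
    have "((\<lambda>s. age_integral a (t - s)) has_real_derivative exp (- a * (t - s)) * (-1)) (at s)"
      by (rule DERIV_chain2[OF age_integral_deriv]) (auto intro!: derivative_eq_intros)
    from DERIV_minus[OF this]
    show "((\<lambda>s. - age_integral a (t - s)) has_real_derivative exp (- a * (t - s))) (at s)" by simp
    show "isCont (\<lambda>s. exp (- a * (t - s))) s" by (intro continuous_intros)
  qed
  then show "(\<integral>s. indicator {0..b} s * exp (- a * (t - s)) \<partial>lborel) = age_integral a t - age_integral a (t - b)"
    by (simp add: mult.commute)
qed

text \<open>For fixed \<open>s\<close> the strip \<open>l < s + y \<le> l + h\<close> is an interval of length \<open>h\<close>.\<close>

lemma integral_sheared_strip:
  fixes g :: "real \<Rightarrow> real"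
  assumes g: "integrable lborel g" and g0: "\<And>s. 0 \<le> g s" and h: "0 \<le> h"
  shows "integrable lborel (\<lambda>(s, y). g s * indicator {l - s<..l + h - s} y)"
    and "(\<integral>p. (case p of (s, y) \<Rightarrow> g s * indicator {l - s<..l + h - s} y) \<partial>lborel) = h * (\<integral>s. g s \<partial>lborel)"
proof -
  have [measurable]: "g \<in> borel_measurable borel" using borel_measurable_integrable[OF g] by simp
  let ?f = "\<lambda>(s, y). g s * indicator {l - s<..l + h - s} y"
  have m: "?f \<in> borel_measurable (lborel \<Otimes>\<^sub>M lborel)"
    unfolding greaterThanAtMost_def greaterThan_def atMost_def Int_def indicator_def by measurable
  have "(\<integral>\<^sup>+p. ennreal (?f p) \<partial>(lborel \<Otimes>\<^sub>M lborel)) = (\<integral>\<^sup>+s. \<integral>\<^sup>+y. ennreal (?f (s, y)) \<partial>lborel \<partial>lborel)"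
    by (rule lborel.nn_integral_fst[symmetric]) (use m in measurable)
  also have "\<dots> = (\<integral>\<^sup>+s. ennreal h * ennreal (g s) \<partial>lborel)"
  proof (rule nn_integral_cong)
    fix s
    have "(\<integral>\<^sup>+y. ennreal (?f (s, y)) \<partial>lborel) = (\<integral>\<^sup>+y. ennreal (g s) * indicator {l - s<..l + h - s} y \<partial>lborel)"
      by (rule nn_integral_cong) (auto simp: indicator_def)
    then show "(\<integral>\<^sup>+y. ennreal (?f (s, y)) \<partial>lborel) = ennreal h * ennreal (g s)"
      using h by (simp add: nn_integral_cmult_indicator mult.commute)
  qed
  also have "\<dots> = ennreal (h * (\<integral>s. g s \<partial>lborel))"
    using g g0 h by (simp add: nn_integral_cmult nn_integral_eq_integral ennreal_mult)
  finally have n: "(\<integral>\<^sup>+p. ennreal (?f p) \<partial>lborel) = ennreal (h * (\<integral>s. g s \<partial>lborel))"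
    by (simp only: lborel_prod)
  have m': "?f \<in> borel_measurable lborel" using m by (simp only: lborel_prod)
  have f0: "0 \<le> ?f p" for p using g0 by (auto split: prod.split)
  show "integrable lborel ?f"
    by (rule integrableI_nonneg[OF m']) (use f0 n in auto)
  show "(\<integral>p. ?f p \<partial>lborel) = h * (\<integral>s. g s \<partial>lborel)"
    using integral_eq_nn_integral[OF m'] f0 n h g0 by simp
qed

lemma exp_diff_le:
  fixes x y R :: real
  assumes "\<bar>x\<bar> \<le> R" "\<bar>y\<bar> \<le> R"
  shows "\<bar>exp x - exp y\<bar> \<le> exp R * \<bar>x - y\<bar>"
proof -
  have le: "exp v - exp u \<le> exp R * (v - u)" if "u \<le> v" "v \<le> R" for u v :: real
  proof -
    have "exp v - exp u = exp v * (1 - exp (u - v))" by (simp add: right_diff_distrib flip: exp_add)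
    also have "\<dots> \<le> exp v * (v - u)" by (intro mult_left_mono) (use exp_ge_add_one_self[of "u - v"] in \<open>linarith | simp\<close>)+
    also have "\<dots> \<le> exp R * (v - u)" using that by (intro mult_right_mono) auto
    finally show ?thesis .
  qed
  have "x \<le> R" "y \<le> R" using assms by auto
  then show ?thesis using le[of x y] le[of y x] exp_le_cancel_iff[of x y] exp_le_cancel_iff[of y x]
    by (cases "x \<le> y") (auto simp: abs_of_nonneg abs_of_nonpos)
qed

text \<open>The integrand of the mild solution at the point \<open>(t, t - c)\<close> of the characteristic \<open>t - x = c\<close>.\<close>

definition char_integrand :: "real \<Rightarrow> real \<Rightarrow> real \<Rightarrow> real \<Rightarrow> real \<times> real \<Rightarrow> real" where
  "char_integrand a m c t = (\<lambda>(s, y). indicator {0..t} s * green a m (t - s) (t - c - y))"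

lemma char_integrand_measurable[measurable]: "char_integrand a m c t \<in> borel_measurable borel"
proof -
  have "char_integrand a m c t \<in> borel_measurable (borel \<Otimes>\<^sub>M borel)"
    unfolding char_integrand_def by measurable
  then show ?thesis by (simp only: borel_prod)
qed

text \<open>The formula for the integrand inside the cone, without the cut-off: along the characteristic
  \<open>(t - s)\<^sup>2 - (t - c - y)\<^sup>2\<close> factorises into \<open>(c + y - s) (2 t - c - s - y)\<close>, and the first factor does
  not depend on \<open>t\<close>.\<close>

definition smooth_kernel :: "real \<Rightarrow> real \<Rightarrow> real \<Rightarrow> real \<Rightarrow> real \<times> real \<Rightarrow> real" where
  "smooth_kernel a m c t = (\<lambda>(s, y). exp (- a * (t - s) / 2) / 2 *
     riemann_series (a\<^sup>2 / 4 - m\<^sup>2) ((c + y - s) * (2 * t - c - s - y)))"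

lemma char_integrand_eq_smooth_kernel:
  "char_integrand a m c t (s, y) =
     (if 0 \<le> s \<and> s - y \<le> c \<and> s + y \<le> 2 * t - c then smooth_kernel a m c t (s, y) else 0)"
proof -
  have "0 \<le> s \<and> s \<le> t \<and> \<bar>t - c - y\<bar> \<le> t - s \<longleftrightarrow> 0 \<le> s \<and> s - y \<le> c \<and> s + y \<le> 2 * t - c" by auto
  moreover have "(t - s)\<^sup>2 - (t - c - y)\<^sup>2 = (c + y - s) * (2 * t - c - s - y)"
    by (simp add: power2_eq_square algebra_simps)
  ultimately show ?thesis
    by (auto simp: char_integrand_def green_def smooth_kernel_def indicator_def)
qed

text \<open>On the bounded region that the cones up to time \<open>T\<close> fill, the kernel is Lipschitz in \<open>t\<close>. Near the
  moving edge the argument of the series is \<open>O(t' - t)\<close>, so the series is close to its value 1 at 0.\<close>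

lemma smooth_kernel_estimates:
  obtains C where "0 \<le> C"
    "\<And>t t' s y. 0 \<le> s \<Longrightarrow> s - y \<le> c \<Longrightarrow> s + y \<le> 2 * t - c \<Longrightarrow> t \<le> t' \<Longrightarrow> t' \<le> T \<Longrightarrow>
       \<bar>smooth_kernel a m c t' (s, y) - smooth_kernel a m c t (s, y)\<bar> \<le> C * (t' - t)"
    "\<And>t t' s y. 0 \<le> s \<Longrightarrow> s - y \<le> c \<Longrightarrow> 2 * t - c \<le> s + y \<Longrightarrow> s + y \<le> 2 * t' - c \<Longrightarrow> t' \<le> T \<Longrightarrow>
       \<bar>(smooth_kernel a m c t' (s, y))\<^sup>2 - exp (- a * (t' - s)) / 4\<bar> \<le> C * (t' - t)"
proof -
  let ?F = "riemann_series (a\<^sup>2 / 4 - m\<^sup>2)"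
  obtain L where L: "0 \<le> L" "\<And>y z. \<bar>y\<bar> \<le> 4 * T\<^sup>2 \<Longrightarrow> \<bar>z\<bar> \<le> 4 * T\<^sup>2 \<Longrightarrow> \<bar>?F y - ?F z\<bar> \<le> L * \<bar>y - z\<bar>"
    by (rule riemann_series_lipschitz[of "4 * T\<^sup>2" "a\<^sup>2 / 4 - m\<^sup>2"], rule that)
  define B where "B = 1 + L * (4 * T\<^sup>2)"
  have B: "1 \<le> B" using L by (simp add: B_def)
  have FB: "\<bar>?F z\<bar> \<le> B" if "\<bar>z\<bar> \<le> 4 * T\<^sup>2" for z
  proof -
    have "\<bar>?F z - ?F 0\<bar> \<le> L * \<bar>z\<bar>" using L(2)[of z 0] that by simp
    also have "\<dots> \<le> L * (4 * T\<^sup>2)" using that L by (intro mult_left_mono) auto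
    finally show ?thesis by (simp add: riemann_series_0 B_def)
  qed
  define R where "R = \<bar>a\<bar> * \<bar>T\<bar>"
  define E where "E = exp R"
  have R: "0 \<le> R" by (simp add: R_def)
  then have E: "1 \<le> E" by (simp add: E_def)
  have rng: "0 \<le> c + y - s" "c + y - s \<le> 2 * T" "0 \<le> 2 * t - c - s - y" "2 * t - c - s - y \<le> 2 * T"
      "0 \<le> T" "0 \<le> t - s" "t - s \<le> T"
    if "0 \<le> s" "s - y \<le> c" "s + y \<le> 2 * t - c" "t \<le> T" for s y t
    using that by auto
  have arg: "\<bar>(c + y - s) * (2 * t - c - s - y)\<bar> \<le> 4 * T\<^sup>2"
    if "0 \<le> s" "s - y \<le> c" "s + y \<le> 2 * t - c" "t \<le> T" for s y t
  proof -
    have "(c + y - s) * (2 * t - c - s - y) \<le> (2 * T) * (2 * T)"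
      using rng[OF that] by (intro mult_mono) auto
    then show ?thesis using rng[OF that] by (simp add: power2_eq_square)
  qed
  have ex: "\<bar>- a * u / 2\<bar> \<le> R" "\<bar>- a * u\<bar> \<le> R" if "0 \<le> u" "u \<le> T" for u
  proof -
    have "\<bar>a\<bar> * \<bar>u\<bar> \<le> R" unfolding R_def using that by (intro mult_left_mono) auto
    moreover have "\<bar>a\<bar> * \<bar>u\<bar> \<le> R * 2" using calculation R by linarith
    ultimately show "\<bar>- a * u / 2\<bar> \<le> R" "\<bar>- a * u\<bar> \<le> R" by (auto simp: abs_mult)
  qed
  define C where "C = E * \<bar>a\<bar> * B + E * L * (4 * \<bar>T\<bar>) * (B + 1)"
  have p: "0 \<le> E * \<bar>a\<bar> * B" "0 \<le> E * L * (4 * \<bar>T\<bar>)" "0 \<le> E * L * (4 * \<bar>T\<bar>) * B" using E B L by auto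
  show thesis
  proof
    show "0 \<le> C" unfolding C_def using p E B L by (auto intro!: add_nonneg_nonneg mult_nonneg_nonneg)
  next
    fix t t' s y assume s: "0 \<le> s" "s - y \<le> c" "s + y \<le> 2 * t - c" and t: "t \<le> t'" "t' \<le> T"
    have s': "s + y \<le> 2 * t' - c" "t \<le> T" using s t by auto
    define z z' where "z = (c + y - s) * (2 * t - c - s - y)" and "z' = (c + y - s) * (2 * t' - c - s - y)"
    define e e' where "e = exp (- a * (t - s) / 2)" and "e' = exp (- a * (t' - s) / 2)"
    note r = rng[OF s s'(2)] and r' = rng[OF s(1,2) s'(1) t(2)]
    have zb: "\<bar>z\<bar> \<le> 4 * T\<^sup>2" "\<bar>z'\<bar> \<le> 4 * T\<^sup>2"
      unfolding z_def z'_def using arg[OF s s'(2)] arg[OF s(1,2) s'(1) t(2)] by auto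
    have ee: "\<bar>e' - e\<bar> \<le> E * (\<bar>a\<bar> * (t' - t) / 2)"
    proof -
      have "\<bar>e' - e\<bar> \<le> exp R * \<bar>- a * (t' - s) / 2 - (- a * (t - s) / 2)\<bar>"
        unfolding e_def e'_def by (intro exp_diff_le ex r r')
      also have "- a * (t' - s) / 2 - (- a * (t - s) / 2) = - a * (t' - t) / 2" by (simp add: field_simps)
      finally show ?thesis using t by (simp add: E_def abs_mult)
    qed
    have eb: "0 \<le> e" "e \<le> E" unfolding e_def E_def using ex(1)[OF r(6,7)] by auto
    have ff: "\<bar>?F z' - ?F z\<bar> \<le> L * (4 * \<bar>T\<bar> * (t' - t))"
    proof -
      have zd: "z' - z = (c + y - s) * (2 * (t' - t))" by (simp add: z_def z'_def algebra_simps)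
      also have "\<dots> \<le> (2 * T) * (2 * (t' - t))" using r t by (intro mult_right_mono) auto
      also have "\<dots> = 4 * \<bar>T\<bar> * (t' - t)" using r by simp
      finally have "z' - z \<le> 4 * \<bar>T\<bar> * (t' - t)" .
      moreover have "0 \<le> z' - z" unfolding zd using r t by simp
      ultimately have "L * \<bar>z' - z\<bar> \<le> L * (4 * \<bar>T\<bar> * (t' - t))" using L(1) by (intro mult_left_mono) auto
      then show ?thesis using L(2)[OF zb(2,1)] by simp
    qed
    have split: "smooth_kernel a m c t' (s, y) - smooth_kernel a m c t (s, y) = ((e' - e) * ?F z' + e * (?F z' - ?F z)) / 2"
    proof -
      have "smooth_kernel a m c t' (s, y) = e' / 2 * ?F z'" "smooth_kernel a m c t (s, y) = e / 2 * ?F z"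
        by (simp_all add: smooth_kernel_def e_def e'_def z_def z'_def)
      moreover have "e' / 2 * u' - e / 2 * u = ((e' - e) * u' + e * (u' - u)) / 2" for u u' :: real
        by (simp add: field_simps)
      ultimately show ?thesis by simp
    qed
    have "\<bar>smooth_kernel a m c t' (s, y) - smooth_kernel a m c t (s, y)\<bar> \<le> (\<bar>e' - e\<bar> * \<bar>?F z'\<bar> + \<bar>e\<bar> * \<bar>?F z' - ?F z\<bar>) / 2"
      unfolding split using abs_triangle_ineq[of "(e' - e) * ?F z'" "e * (?F z' - ?F z)"] by (simp add: abs_mult)
    also have "\<dots> \<le> (E * (\<bar>a\<bar> * (t' - t) / 2) * B + E * (L * (4 * \<bar>T\<bar> * (t' - t)))) / 2"
      using ee eb ff FB[OF zb(2)] t E L(1) by (intro divide_right_mono add_mono mult_mono) auto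
    also have "\<dots> = (E * \<bar>a\<bar> * B / 4 + E * L * (4 * \<bar>T\<bar>) / 2) * (t' - t)" by (simp add: field_simps)
    also have "\<dots> \<le> C * (t' - t)"
      unfolding C_def using p t by (intro mult_right_mono) (auto simp: algebra_simps)
    finally show "\<bar>smooth_kernel a m c t' (s, y) - smooth_kernel a m c t (s, y)\<bar> \<le> C * (t' - t)" .
  next
    fix t t' s y assume s: "0 \<le> s" "s - y \<le> c" "2 * t - c \<le> s + y" "s + y \<le> 2 * t' - c" and t: "t' \<le> T"
    define z' where "z' = (c + y - s) * (2 * t' - c - s - y)"
    note r' = rng[OF s(1,2,4) t]
    have zb: "\<bar>z'\<bar> \<le> 4 * T\<^sup>2" unfolding z'_def using arg[OF s(1,2,4) t] .
    have zz: "\<bar>z'\<bar> \<le> 4 * \<bar>T\<bar> * (t' - t)"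
    proof -
      have "z' \<le> (2 * T) * (2 * (t' - t))" unfolding z'_def using r' s by (intro mult_mono) auto
      also have "\<dots> = 4 * \<bar>T\<bar> * (t' - t)" using r' by simp
      finally show ?thesis using r' by (simp add: z'_def)
    qed
    have f1: "\<bar>?F z' - 1\<bar> \<le> L * (4 * \<bar>T\<bar> * (t' - t))"
      using L(2)[of z' 0] zb zz mult_left_mono[OF zz L(1)] by (simp add: riemann_series_0)
    have f2: "\<bar>?F z' + 1\<bar> \<le> B + 1" using FB[OF zb] by simp
    have split: "(smooth_kernel a m c t' (s, y))\<^sup>2 - exp (- a * (t' - s)) / 4 = exp (- a * (t' - s)) / 4 * ((?F z' - 1) * (?F z' + 1))"
    proof -
      have "(exp (- a * (t' - s) / 2))\<^sup>2 = exp (- a * (t' - s))" by (simp flip: exp_double add: field_simps)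
      moreover have "smooth_kernel a m c t' (s, y) = exp (- a * (t' - s) / 2) / 2 * ?F z'"
        by (simp add: smooth_kernel_def z'_def)
      moreover have "(v / 2 * u)\<^sup>2 - v\<^sup>2 / 4 = v\<^sup>2 / 4 * ((u - 1) * (u + 1))" for u v :: real
        by (simp add: power2_eq_square field_simps)
      ultimately show ?thesis by metis
    qed
    have "\<bar>(smooth_kernel a m c t' (s, y))\<^sup>2 - exp (- a * (t' - s)) / 4\<bar>
        = exp (- a * (t' - s)) / 4 * (\<bar>?F z' - 1\<bar> * \<bar>?F z' + 1\<bar>)"
      unfolding split by (simp add: abs_mult)
    also have "\<dots> \<le> E * ((L * (4 * \<bar>T\<bar> * (t' - t))) * (B + 1))"
    proof (intro mult_mono f1 f2)
      have "exp (- a * (t' - s)) \<le> E" unfolding E_def using ex(2)[OF r'(6,7)] by auto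
      then show "exp (- a * (t' - s)) / 4 \<le> E" using E by simp
    qed (use L E B s f1 in auto)
    also have "\<dots> = E * L * (4 * \<bar>T\<bar>) * (B + 1) * (t' - t)" by (simp add: algebra_simps)
    also have "\<dots> \<le> C * (t' - t)"
      unfolding C_def using p s by (intro mult_right_mono) auto
    finally show "\<bar>(smooth_kernel a m c t' (s, y))\<^sup>2 - exp (- a * (t' - s)) / 4\<bar> \<le> C * (t' - t)" .
  qed
qed

text \<open>What the backward cone of \<open>(t + h, t + h - c)\<close> gains over that of \<open>(t, t - c)\<close> lies here.\<close>

definition char_strip :: "real \<Rightarrow> real \<Rightarrow> real \<Rightarrow> (real \<times> real) set" where
  "char_strip c t h = {(s, y). 2 * t - c < s + y \<and> s + y \<le> 2 * (t + h) - c}"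

lemma char_strip_borel[measurable]: "char_strip c t h \<in> sets borel"
proof -
  have "Measurable.pred (borel \<Otimes>\<^sub>M borel) (\<lambda>(s, y). 2 * t - c < s + y \<and> s + y \<le> 2 * (t + h) - c)"
    by measurable
  then have "{p \<in> space (borel \<Otimes>\<^sub>M borel). (\<lambda>(s, y). 2 * t - c < s + y \<and> s + y \<le> 2 * (t + h) - c) p} \<in> sets (borel \<Otimes>\<^sub>M borel)"
    by (rule predE)
  then show ?thesis unfolding char_strip_def borel_prod[symmetric] by (simp add: space_pair_measure)
qed

definition char_increment :: "real \<Rightarrow> real \<Rightarrow> real \<Rightarrow> real \<Rightarrow> real \<Rightarrow> real \<times> real \<Rightarrow> real" where
  "char_increment a m c t h p = char_integrand a m c (t + h) p - char_integrand a m c t p"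

text \<open>The second and third clauses agree to leading order in \<open>h\<close>, since \<open>age_integral a h\<close> tends to 0; so almost the whole
  variance of an increment comes from the strip.\<close>

definition char_increment_bounds :: "real \<Rightarrow> real \<Rightarrow> real \<Rightarrow> real \<Rightarrow> real \<Rightarrow> real \<Rightarrow> bool" where
  "char_increment_bounds a m c C t h \<longleftrightarrow>
     integrable lborel (\<lambda>p. (char_increment a m c t h p)\<^sup>2) \<and>
     (\<integral>p. (char_increment a m c t h p)\<^sup>2 \<partial>lborel) \<le> h / 2 * age_integral a (t + h) + C * h\<^sup>2 \<and>
     h / 2 * (age_integral a (t + h) - age_integral a h) - C * h\<^sup>2
       \<le> (\<integral>p. (char_increment a m c t h p * indicator (char_strip c t h) p)\<^sup>2 \<partial>lborel) \<and>
     (\<integral>p. (char_increment a m c t h p * indicator (- char_strip c t h) p)\<^sup>2 \<partial>lborel) \<le> C * h\<^sup>2"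

text \<open>The increment is split along the strip. Off the strip it is Lipschitz in \<open>h\<close> on a bounded
  set. On the strip its square is \<open>exp (- a (t + h - s)) / 4\<close> up to \<open>O(h)\<close>; the cone meets the strip in
  a set that contains the part with \<open>0 \<le> s \<le> t\<close> and is contained in the part with \<open>0 \<le> s \<le> t + h\<close>,
  and \<open>integral_sheared_strip\<close> with width \<open>2 h\<close> evaluates both.\<close>

lemma char_increment_estimates:
  assumes T: "0 < T"
  obtains C where "0 < C" "\<And>t h. 0 \<le> t \<Longrightarrow> 0 < h \<Longrightarrow> t + h \<le> T \<Longrightarrow> char_increment_bounds a m c C t h"
proof -
  obtain K where K: "0 \<le> K"
    "\<And>t t' s y. 0 \<le> s \<Longrightarrow> s - y \<le> c \<Longrightarrow> s + y \<le> 2 * t - c \<Longrightarrow> t \<le> t' \<Longrightarrow> t' \<le> T \<Longrightarrow>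
       \<bar>smooth_kernel a m c t' (s, y) - smooth_kernel a m c t (s, y)\<bar> \<le> K * (t' - t)"
    "\<And>t t' s y. 0 \<le> s \<Longrightarrow> s - y \<le> c \<Longrightarrow> 2 * t - c \<le> s + y \<Longrightarrow> s + y \<le> 2 * t' - c \<Longrightarrow> t' \<le> T \<Longrightarrow>
       \<bar>(smooth_kernel a m c t' (s, y))\<^sup>2 - exp (- a * (t' - s)) / 4\<bar> \<le> K * (t' - t)"
    by (rule smooth_kernel_estimates[of c T a m], rule that)
  define C where "C = K\<^sup>2 * (T * (2 * T)) + 2 * K * T + 1"
  let ?Q = "cbox (0, - c) (T, 2 * T - c)"
  have Q: "integrable lborel (\<lambda>p. r * indicator ?Q p)" "(\<integral>p. r * indicator ?Q p \<partial>lborel) = r * (T * (2 * T))" for r :: real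
  proof -
    have "measure lborel ?Q = T * (2 * T)"
      using T by (subst content_cbox) (auto simp: Basis_prod_def prod.union_disjoint)
    moreover show "integrable lborel (\<lambda>p. r * indicator ?Q p)"
      using emeasure_lborel_cbox_finite[of "(0, - c)" "(T, 2 * T - c)"]
      by (intro integrable_mult_right integrable_real_indicator) (auto simp: less_top)
    ultimately show "(\<integral>p. r * indicator ?Q p \<partial>lborel) = r * (T * (2 * T))" by simp
  qed
  show thesis
  proof
    show "0 < C" using K T by (auto simp: C_def intro!: add_nonneg_pos add_nonneg_nonneg)
    fix t h assume t: "0 \<le> t" and h: "0 < h" and tT: "t + h \<le> T"
    let ?t' = "t + h"
    define \<Delta> where "\<Delta> p = char_integrand a m c (t + h) p - char_integrand a m c t p" for p
    have [measurable]: "\<Delta> \<in> borel_measurable borel" by (simp add: \<Delta>_def[abs_def])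
    define on where "on p = \<Delta> p * indicator (char_strip c t h) p" for p
    define off where "off p = \<Delta> p * indicator (- char_strip c t h) p" for p
    have [measurable]: "on \<in> borel_measurable borel" "off \<in> borel_measurable borel"
      by (simp_all add: on_def[abs_def] off_def[abs_def])
    have onoff: "(\<Delta> p)\<^sup>2 = (on p)\<^sup>2 + (off p)\<^sup>2" for p
      by (auto simp: on_def off_def indicator_def)
    have on_eq: "on (s, y) = (if 0 \<le> s \<and> s - y \<le> c \<and> (s, y) \<in> char_strip c t h then smooth_kernel a m c ?t' (s, y) else 0)" for s y
      unfolding on_def \<Delta>_def char_integrand_eq_smooth_kernel by (auto simp: char_strip_def indicator_def)
    have off_le: "(off p)\<^sup>2 \<le> K\<^sup>2 * h\<^sup>2 * indicator ?Q p" for p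
    proof (cases p)
      case (Pair s y)
      have off_eq: "off (s, y) = (if 0 \<le> s \<and> s - y \<le> c \<and> s + y \<le> 2 * t - c
          then smooth_kernel a m c ?t' (s, y) - smooth_kernel a m c t (s, y) else 0)"
        unfolding off_def \<Delta>_def char_integrand_eq_smooth_kernel using h by (auto simp: char_strip_def indicator_def)
      show ?thesis
      proof (cases "0 \<le> s \<and> s - y \<le> c \<and> s + y \<le> 2 * t - c")
        case True
        then have "\<bar>off (s, y)\<bar> \<le> K * h"
          unfolding off_eq using K(2)[of s y t ?t'] h tT by simp
        then have "(off (s, y))\<^sup>2 \<le> (K * h)\<^sup>2" by (rule abs_le_square_iff[THEN iffD1, OF order_trans]) simp
        moreover have "(s, y) \<in> ?Q" using True h tT by (simp only: cbox_Pair_eq) auto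
        ultimately show ?thesis by (simp add: Pair power_mult_distrib)
      next
        case False
        then show ?thesis unfolding Pair off_eq by (auto simp: indicator_def)
      qed
    qed
    have off_int: "integrable lborel (\<lambda>p. (off p)\<^sup>2)"
      by (rule Bochner_Integration.integrable_bound[OF Q(1)[of "K\<^sup>2 * h\<^sup>2"]]) (use off_le in auto)
    have off_bd: "(\<integral>p. (off p)\<^sup>2 \<partial>lborel) \<le> K\<^sup>2 * (T * (2 * T)) * h\<^sup>2"
    proof -
      have "(\<integral>p. (off p)\<^sup>2 \<partial>lborel) \<le> (\<integral>p. K\<^sup>2 * h\<^sup>2 * indicator ?Q p \<partial>lborel)"
        by (rule integral_mono[OF off_int Q(1) off_le])
      also have "\<dots> = K\<^sup>2 * (T * (2 * T)) * h\<^sup>2" unfolding Q(2) by simp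
      finally show ?thesis .
    qed
    \<comment> \<open>On the strip the square of the increment is \<open>g\<close> up to an error \<open>k\<close>; the cut-off \<open>b\<close> will be
      \<open>t + h\<close> for the upper and \<open>t\<close> for the lower bound.\<close>
    define g where "g b s = indicator {0..b} s * (exp (- a * (?t' - s)) / 4)" for b s :: real
    define k where "k b s = indicator {0..b} s * (K * h)" for b s :: real
    define ind where "ind s y = (indicator {(2 * t - c) - s<..(2 * t - c) + 2 * h - s} y :: real)" for s y
    have ind: "ind s y = indicator (char_strip c t h) (s, y)" for s y
      by (auto simp: ind_def char_strip_def indicator_def)
    have gi: "integrable lborel (g b)" "(\<integral>s. g b s \<partial>lborel) = (age_integral a ?t' - age_integral a (?t' - b)) / 4" if "0 \<le> b" for b
      using integral_exp_age[OF that, of a ?t'] unfolding g_def[abs_def]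
      by (simp_all flip: times_divide_eq_right) (simp_all add: times_divide_eq_right)
    have ki: "integrable lborel (k b)" "(\<integral>s. k b s \<partial>lborel) = b * (K * h)" if "0 \<le> b" for b
      unfolding k_def[abs_def] using that by (auto simp: integrable_real_indicator)
    have g0: "0 \<le> g b s" "0 \<le> k b s" for b s using K(1) h by (auto simp: g_def k_def)
    note Sg = integral_sheared_strip[where l="2 * t - c" and h="2 * h", folded ind_def]
    have up: "(on p)\<^sup>2 \<le> (case p of (s, y) \<Rightarrow> (g ?t' s + k ?t' s) * ind s y)" for p
    proof (cases p)
      case (Pair s y)
      show ?thesis
      proof (cases "0 \<le> s \<and> s - y \<le> c \<and> (s, y) \<in> char_strip c t h")
        case True
        then have st: "s + y \<le> 2 * ?t' - c" "2 * t - c \<le> s + y" by (auto simp: char_strip_def)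
        have "(smooth_kernel a m c ?t' (s, y))\<^sup>2 \<le> exp (- a * (?t' - s)) / 4 + K * h"
          using K(3)[of s y t ?t'] True st tT by simp
        moreover have "s \<le> ?t'" using True st by simp
        ultimately show ?thesis using True by (simp add: Pair on_eq g_def k_def ind)
      next
        case False
        then show ?thesis using g0 by (auto simp: Pair on_eq ind)
      qed
    qed
    have low: "(case p of (s, y) \<Rightarrow> g t s * ind s y) - (case p of (s, y) \<Rightarrow> k t s * ind s y) \<le> (on p)\<^sup>2" for p
    proof (cases p)
      case (Pair s y)
      show ?thesis
      proof (cases "0 \<le> s \<and> s \<le> t \<and> (s, y) \<in> char_strip c t h")
        case True
        then have st: "s + y \<le> 2 * ?t' - c" "2 * t - c \<le> s + y" "s - y \<le> c" by (auto simp: char_strip_def)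
        have "exp (- a * (?t' - s)) / 4 - K * h \<le> (smooth_kernel a m c ?t' (s, y))\<^sup>2"
          using K(3)[of s y t ?t'] True st tT by simp
        then show ?thesis using True st by (simp add: Pair on_eq g_def k_def ind)
      next
        case False
        then have "g t s * ind s y = 0" by (auto simp: g_def ind indicator_def)
        moreover have "0 \<le> k t s * ind s y" using g0 by (simp add: ind)
        ultimately have "g t s * ind s y - k t s * ind s y \<le> (on (s, y))\<^sup>2"
          using zero_le_power2[of "on (s, y)"] by linarith
        then show ?thesis by (simp add: Pair)
      qed
    qed
    have gk: "integrable lborel (\<lambda>s. g ?t' s + k ?t' s)" using gi(1)[of ?t'] ki(1)[of ?t'] t h by auto
    have gk0: "0 \<le> g ?t' s + k ?t' s" for s using g0[of ?t' s] by simp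
    have up_int: "integrable lborel (\<lambda>p. case p of (s, y) \<Rightarrow> (g ?t' s + k ?t' s) * ind s y)"
      by (rule Sg(1)[OF gk gk0]) (use h in auto)
    have on_int: "integrable lborel (\<lambda>p. (on p)\<^sup>2)"
      by (rule Bochner_Integration.integrable_bound[OF up_int])
         (use order_trans[OF up abs_ge_self] in \<open>simp_all add: split_beta\<close>)
    have on_up: "(\<integral>p. (on p)\<^sup>2 \<partial>lborel) \<le> h / 2 * age_integral a ?t' + 2 * K * T * h\<^sup>2"
    proof -
      have "(\<integral>p. (on p)\<^sup>2 \<partial>lborel) \<le> (\<integral>p. (case p of (s, y) \<Rightarrow> (g ?t' s + k ?t' s) * ind s y) \<partial>lborel)"
        by (rule integral_mono[OF on_int up_int up])
      also have "\<dots> = 2 * h * (\<integral>s. g ?t' s + k ?t' s \<partial>lborel)"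
        by (rule Sg(2)[OF gk gk0]) (use h in auto)
      also have "(\<integral>s. g ?t' s + k ?t' s \<partial>lborel) = age_integral a ?t' / 4 + ?t' * (K * h)"
        using gi[of ?t'] ki[of ?t'] t h by simp
      also have "\<dots> \<le> age_integral a ?t' / 4 + T * (K * h)"
        using K(1) h tT by (intro add_left_mono mult_right_mono) auto
      finally show ?thesis using h by (simp add: power2_eq_square algebra_simps)
    qed
    have on_low: "h / 2 * (age_integral a ?t' - age_integral a h) - 2 * K * T * h\<^sup>2 \<le> (\<integral>p. (on p)\<^sup>2 \<partial>lborel)"
    proof -
      have i1: "integrable lborel (\<lambda>p. case p of (s, y) \<Rightarrow> g t s * ind s y)"
        and i2: "integrable lborel (\<lambda>p. case p of (s, y) \<Rightarrow> k t s * ind s y)"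
        using gi(1)[OF t] ki(1)[OF t] g0 h by (auto intro!: Sg(1))
      have "h / 2 * (age_integral a ?t' - age_integral a h) - 2 * K * T * h\<^sup>2
          \<le> h / 2 * (age_integral a ?t' - age_integral a h) - 2 * K * t * h\<^sup>2"
        using K(1) h tT by (auto intro!: mult_right_mono mult_left_mono)
      also have "\<dots> = 2 * h * (\<integral>s. g t s \<partial>lborel) - 2 * h * (\<integral>s. k t s \<partial>lborel)"
        unfolding gi(2)[OF t] ki(2)[OF t] by (simp add: power2_eq_square field_simps)
      also have "\<dots> = (\<integral>p. (case p of (s, y) \<Rightarrow> g t s * ind s y) \<partial>lborel) - (\<integral>p. (case p of (s, y) \<Rightarrow> k t s * ind s y) \<partial>lborel)"
        using gi(1)[OF t] ki(1)[OF t] g0 h by (simp add: Sg(2))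
      also have "\<dots> = (\<integral>p. (case p of (s, y) \<Rightarrow> g t s * ind s y) - (case p of (s, y) \<Rightarrow> k t s * ind s y) \<partial>lborel)"
        by (rule Bochner_Integration.integral_diff[symmetric, OF i1 i2])
      also have "\<dots> \<le> (\<integral>p. (on p)\<^sup>2 \<partial>lborel)"
        by (rule integral_mono[OF Bochner_Integration.integrable_diff[OF i1 i2] on_int low])
      finally show ?thesis .
    qed
    have dint: "integrable lborel (\<lambda>p. (\<Delta> p)\<^sup>2)" unfolding onoff using on_int off_int by auto
    have dsum: "(\<integral>p. (\<Delta> p)\<^sup>2 \<partial>lborel) = (\<integral>p. (on p)\<^sup>2 \<partial>lborel) + (\<integral>p. (off p)\<^sup>2 \<partial>lborel)"
      unfolding onoff using on_int off_int by simp
    have Ch: "C * h\<^sup>2 = K\<^sup>2 * (T * (2 * T)) * h\<^sup>2 + 2 * K * T * h\<^sup>2 + h\<^sup>2" by (simp add: C_def algebra_simps)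
    have nn: "0 \<le> K\<^sup>2 * (T * (2 * T)) * h\<^sup>2" "0 \<le> 2 * K * T * h\<^sup>2" "0 \<le> h\<^sup>2" using K(1) T by auto
    have "integrable lborel (\<lambda>p. (\<Delta> p)\<^sup>2) \<and>
      (\<integral>p. (\<Delta> p)\<^sup>2 \<partial>lborel) \<le> h / 2 * age_integral a ?t' + C * h\<^sup>2 \<and>
      h / 2 * (age_integral a ?t' - age_integral a h) - C * h\<^sup>2 \<le> (\<integral>p. (on p)\<^sup>2 \<partial>lborel) \<and>
      (\<integral>p. (off p)\<^sup>2 \<partial>lborel) \<le> C * h\<^sup>2"
      using dint dsum on_up on_low off_bd nn unfolding Ch by linarith
    then show "char_increment_bounds a m c C t h"
      unfolding char_increment_bounds_def char_increment_def \<Delta>_def on_def off_def .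
  qed
qed

section \<open>The upper bound for the modulus of continuity\<close>

definition dyadic_index :: "real \<Rightarrow> nat \<Rightarrow> nat" where
  "dyadic_index x n = nat \<lfloor>x * 2 ^ n\<rfloor>"

lemma dyadic_index_bounds:
  assumes "0 \<le> x"
  shows "real (dyadic_index x n) \<le> x * 2 ^ n" "x * 2 ^ n < real (dyadic_index x n) + 1"
    "real (dyadic_index x n) / 2 ^ n \<le> x" "x < real (dyadic_index x n) / 2 ^ n + 1 / 2 ^ n"
proof -
  have *: "real (dyadic_index x n) = of_int \<lfloor>x * 2 ^ n\<rfloor>" using assms by (simp add: dyadic_index_def)
  show "real (dyadic_index x n) \<le> x * 2 ^ n" "x * 2 ^ n < real (dyadic_index x n) + 1"
    unfolding * by linarith+
  then show "real (dyadic_index x n) / 2 ^ n \<le> x" "x < real (dyadic_index x n) / 2 ^ n + 1 / 2 ^ n"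
    by (simp_all add: field_simps)
qed

lemma dyadic_index_Suc:
  assumes "0 \<le> x"
  shows "dyadic_index x (Suc n) = 2 * dyadic_index x n \<or> dyadic_index x (Suc n) = 2 * dyadic_index x n + 1"
proof -
  have "real (dyadic_index x (Suc n)) < real (2 * dyadic_index x n + 2)"
    "real (2 * dyadic_index x n) < real (dyadic_index x (Suc n) + 1)"
    using dyadic_index_bounds(1,2)[OF assms, of n] dyadic_index_bounds(1,2)[OF assms, of "Suc n"] by simp_all
  then have "dyadic_index x (Suc n) < 2 * dyadic_index x n + 2" "2 * dyadic_index x n < dyadic_index x (Suc n) + 1"
    by (simp_all only: of_nat_less_iff)
  then show ?thesis by linarith
qed

definition dyadic_scale :: "nat \<Rightarrow> real" where
  "dyadic_scale n = sqrt (real n / 2 ^ n)"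

text \<open>Geometric decay of the scales, in a form that makes \<open>10 dyadic_scale\<close> a telescoping majorant of the
  sum of all finer scales.\<close>

lemma dyadic_scale_Suc_le:
  assumes "2 \<le> n" shows "11 * dyadic_scale (Suc n) \<le> 10 * dyadic_scale n"
proof -
  have "121 * (real (Suc n) / 2 ^ Suc n) \<le> 100 * (real n / 2 ^ n)"
    using assms by (simp add: field_simps)
  then have "sqrt (121 * (real (Suc n) / 2 ^ Suc n)) \<le> sqrt (100 * (real n / 2 ^ n))" by (rule real_sqrt_le_mono)
  moreover have "sqrt 121 = 11" "sqrt 100 = (10::real)" by (auto intro: real_sqrt_unique)
  ultimately show ?thesis unfolding dyadic_scale_def real_sqrt_mult by (simp only:)
qed

text \<open>The points \<open>s\<close> and \<open>s + h\<close> are replaced by the grid points of level \<open>n\<close> below them. These are at most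
  \<open>2 N + 1\<close> steps and at most \<open>h + 2\<^sup>-\<^sup>n\<close> apart, and the replacement costs the sum of all finer scales. As
  \<open>h\<close> is of order \<open>N 2\<^sup>-\<^sup>n\<close>, this cost is small compared with the main term when \<open>N\<close> is large.\<close>

lemma dyadic_chaining:
  fixes y :: "real \<Rightarrow> real"
  assumes cont: "continuous_on {\<alpha>..b} y" and n0: "2 \<le> n0" and N: "1 \<le> N" and c: "0 \<le> c"
    and grid: "\<And>n i j. n0 \<le> n \<Longrightarrow> 1 \<le> j \<Longrightarrow> j \<le> 2 * N + 1 \<Longrightarrow> \<alpha> + real (i + j) / 2 ^ n \<le> b \<Longrightarrow>
       \<bar>y (\<alpha> + real (i + j) / 2 ^ n) - y (\<alpha> + real i / 2 ^ n)\<bar> \<le> c * sqrt (real n * (real j / 2 ^ n))"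
    and n: "n0 \<le> n" and s: "\<alpha> \<le> s" "s + h \<le> b" and h: "real N / 2 ^ n \<le> h" "h < 2 * real N / 2 ^ n"
  shows "\<bar>y (s + h) - y s\<bar> \<le> c * sqrt (real n * (h + 1 / 2 ^ n)) + 20 * c * dyadic_scale n"
proof -
  have h0: "0 \<le> h" using h(1) by (rule order_trans[rotated]) simp
  have near: "\<bar>y r - y (\<alpha> + real (dyadic_index (r - \<alpha>) n) / 2 ^ n)\<bar> \<le> 10 * c * dyadic_scale n"
    if r: "\<alpha> \<le> r" "r \<le> b" for r
  proof -
    have x: "0 \<le> r - \<alpha>" using r by simp
    define D where "D m = \<alpha> + real (dyadic_index (r - \<alpha>) m) / 2 ^ m" for m
    have D: "\<alpha> \<le> D m" "D m \<le> r" "r < D m + 1 / 2 ^ m" for m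
      using dyadic_index_bounds(3,4)[OF x, of m] by (auto simp: D_def)
    have step: "\<bar>y (D (Suc m)) - y (D m)\<bar> \<le> c * dyadic_scale (Suc m)" if "n0 \<le> m" for m
      using dyadic_index_Suc[OF x, of m]
    proof
      assume "dyadic_index (r - \<alpha>) (Suc m) = 2 * dyadic_index (r - \<alpha>) m"
      then have "D (Suc m) = D m" by (simp add: D_def)
      then show ?thesis using c by (simp add: dyadic_scale_def)
    next
      assume e: "dyadic_index (r - \<alpha>) (Suc m) = 2 * dyadic_index (r - \<alpha>) m + 1"
      let ?i = "2 * dyadic_index (r - \<alpha>) m"
      have e1: "\<alpha> + real (?i + 1) / 2 ^ Suc m = D (Suc m)" unfolding D_def e ..
      have e2: "\<alpha> + real ?i / 2 ^ Suc m = D m" by (simp add: D_def)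
      have "\<bar>y (\<alpha> + real (?i + 1) / 2 ^ Suc m) - y (\<alpha> + real ?i / 2 ^ Suc m)\<bar> \<le> c * sqrt (real (Suc m) * (real 1 / 2 ^ Suc m))"
        by (rule grid) (use that D(2)[of "Suc m"] r e1 in auto)
      then show ?thesis unfolding e1 e2 by (simp add: dyadic_scale_def)
    qed
    have tel: "\<bar>y (D (n + m)) - y (D n)\<bar> \<le> 10 * c * (dyadic_scale n - dyadic_scale (n + m))" for m
    proof (induction m)
      case (Suc m)
      have "11 * dyadic_scale (Suc (n + m)) \<le> 10 * dyadic_scale (n + m)"
        by (rule dyadic_scale_Suc_le) (use n n0 in simp)
      from mult_left_mono[OF this c]
      have "c * dyadic_scale (Suc (n + m)) \<le> 10 * c * (dyadic_scale (n + m) - dyadic_scale (Suc (n + m)))"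
        by (simp add: algebra_simps)
      with step[of "n + m"] Suc n show ?case by (simp add: algebra_simps)
    qed simp
    have "(\<lambda>m. \<bar>y (D (n + m)) - y (D n)\<bar>) \<longlonglongrightarrow> \<bar>y r - y (D n)\<bar>"
    proof (intro tendsto_intros)
      have "(\<lambda>m. 1 / 2 ^ m :: real) \<longlonglongrightarrow> 0"
        using LIMSEQ_power_zero[of "1 / 2 :: real"] by (simp add: power_one_over)
      moreover have "norm (D m - r) \<le> 1 / 2 ^ m" for m using D[of m] by simp
      then have "\<forall>\<^sub>F m in sequentially. norm (D m - r) \<le> 1 / 2 ^ m" by simp
      ultimately have "(\<lambda>m. D m - r) \<longlonglongrightarrow> 0" by (rule Lim_null_comparison[rotated])
      then have "D \<longlonglongrightarrow> r" by (rule LIM_zero_cancel)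
      then have "(\<lambda>m. D (n + m)) \<longlonglongrightarrow> r" by (subst add.commute) (rule LIMSEQ_ignore_initial_segment)
      then show "(\<lambda>m. y (D (n + m))) \<longlonglongrightarrow> y r"
        by (rule continuous_on_tendsto_compose[OF cont]) (use r D order_trans[OF D(2) r(2)] in auto)
    qed
    then have "\<bar>y r - y (D n)\<bar> \<le> 10 * c * dyadic_scale n"
    proof (rule tendsto_upperbound)
      have "10 * c * (dyadic_scale n - dyadic_scale (n + m)) \<le> 10 * c * dyadic_scale n" for m
        using c by (intro mult_left_mono) (auto simp: dyadic_scale_def)
      then show "\<forall>\<^sub>F m in sequentially. \<bar>y (D (n + m)) - y (D n)\<bar> \<le> 10 * c * dyadic_scale n"
        using order_trans[OF tel] by auto
    qed simp
    then show ?thesis by (simp only: D_def)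
  qed
  define i i' where "i = dyadic_index (s - \<alpha>) n" and "i' = dyadic_index (s + h - \<alpha>) n"
  have x: "0 \<le> s - \<alpha>" "0 \<le> s + h - \<alpha>" using s h0 by auto
  note di = dyadic_index_bounds(1,2)[OF x(1), of n, folded i_def] dyadic_index_bounds(1,2)[OF x(2), of n, folded i'_def]
  have hn: "real N \<le> h * 2 ^ n" "h * 2 ^ n < 2 * real N" using h by (simp_all add: field_simps)
  have sh: "(s + h - \<alpha>) * 2 ^ n = (s - \<alpha>) * 2 ^ n + h * 2 ^ n" by (simp add: algebra_simps)
  have "real i < real i' + 1" "real i' < real i + 2 * real N + 1" using di hn N unfolding sh by linarith+
  then have le: "i \<le> i'" "i' - i \<le> 2 * N + 1" by linarith+
  have mid: "\<bar>y (\<alpha> + real i' / 2 ^ n) - y (\<alpha> + real i / 2 ^ n)\<bar> \<le> c * sqrt (real n * (h + 1 / 2 ^ n))"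
  proof (cases "i = i'")
    case True
    then show ?thesis using c h0 by simp
  next
    case False
    define j where "j = i' - i"
    have j: "1 \<le> j" "j \<le> 2 * N + 1" "i' = i + j" using False le by (auto simp: j_def)
    have b: "\<alpha> + real (i + j) / 2 ^ n \<le> b"
      using dyadic_index_bounds(3)[OF x(2), of n] s unfolding j(3)[symmetric] i'_def by simp
    have "real j / 2 ^ n \<le> h + 1 / 2 ^ n"
    proof -
      have "real j \<le> h * 2 ^ n + 1" using di j(3) unfolding sh by simp
      then show ?thesis by (simp add: field_simps)
    qed
    then have "c * sqrt (real n * (real j / 2 ^ n)) \<le> c * sqrt (real n * (h + 1 / 2 ^ n))"
      using c by (intro mult_left_mono real_sqrt_le_mono) auto
    with grid[OF n j(1,2) b] show ?thesis unfolding j(3) by simp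
  qed
  have "\<bar>y s - y (\<alpha> + real i / 2 ^ n)\<bar> \<le> 10 * c * dyadic_scale n"
       "\<bar>y (s + h) - y (\<alpha> + real i' / 2 ^ n)\<bar> \<le> 10 * c * dyadic_scale n"
    unfolding i_def i'_def using s h0 by (auto intro!: near)
  with mid show ?thesis by linarith
qed

text \<open>Union bound and Borel-Cantelli. There are \<open>O(2\<^sup>n)\<close> increments of level \<open>n\<close>, and each
  violates the bound with probability at most \<open>2 exp (- n (V' / V) ln 2)\<close>, which is summable
  against \<open>2\<^sup>n\<close> because \<open>V' > V\<close>.\<close>

lemma gaussian_increments_grid_bound:
  fixes Y :: "real \<Rightarrow> 'w \<Rightarrow> real"
  assumes "prob_space M"
    and meas: "\<And>t. \<alpha> \<le> t \<Longrightarrow> t \<le> b \<Longrightarrow> Y t \<in> borel_measurable M"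
    and V: "0 < V" "V < V'" and h0: "0 < h0"
    and tail: "\<And>t h x. \<alpha> \<le> t \<Longrightarrow> 0 < h \<Longrightarrow> h < h0 \<Longrightarrow> t + h \<le> b \<Longrightarrow> 0 \<le> x \<Longrightarrow>
       measure M {\<omega>\<in>space M. \<bar>Y (t + h) \<omega> - Y t \<omega>\<bar> > x} \<le> 2 * exp (- x\<^sup>2 / (2 * (V * h)))"
  shows "AE \<omega> in M. \<forall>\<^sub>F n in sequentially. \<forall>i j. 1 \<le> j \<longrightarrow> j \<le> N \<longrightarrow> \<alpha> + real (i + j) / 2 ^ n \<le> b \<longrightarrow>
       \<bar>Y (\<alpha> + real (i + j) / 2 ^ n) \<omega> - Y (\<alpha> + real i / 2 ^ n) \<omega>\<bar> \<le> sqrt (2 * V' * ln 2) * sqrt (real n * (real j / 2 ^ n))"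
proof -
  interpret prob_space M by fact
  define \<theta> where "\<theta> = V' / V"
  have \<theta>: "1 < \<theta>" using V by (simp add: \<theta>_def)
  define A where "A n i j = {\<omega>\<in>space M. \<bar>Y (\<alpha> + real (i + j) / 2 ^ n) \<omega> - Y (\<alpha> + real i / 2 ^ n) \<omega>\<bar>
     > sqrt (2 * V' * ln 2) * sqrt (real n * (real j / 2 ^ n))}" for n i j :: nat
  define I where "I n = {(i, j). 1 \<le> j \<and> j \<le> N \<and> \<alpha> + real (i + j) / 2 ^ n \<le> b}" for n :: nat
  define k where "k n = nat \<lceil>\<bar>b - \<alpha>\<bar> * 2 ^ n\<rceil>" for n :: nat
  have Isub: "I n \<subseteq> {..k n} \<times> {..N}" for n
  proof
    fix p assume "p \<in> I n"
    then obtain i j where p: "p = (i, j)" "j \<le> N" "\<alpha> + real (i + j) / 2 ^ n \<le> b" by (auto simp: I_def)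
    have "real i / 2 ^ n \<le> \<bar>b - \<alpha>\<bar>" using p(3) by (simp add: add_divide_distrib)
       (smt (verit) divide_nonneg_nonneg of_nat_0_le_iff zero_le_power)
    then have "real i \<le> \<bar>b - \<alpha>\<bar> * 2 ^ n" by (simp add: field_simps)
    also have "\<dots> \<le> real (k n)" unfolding k_def by linarith
    finally show "p \<in> {..k n} \<times> {..N}" using p by simp
  qed
  then have Ifin: "finite (I n)" for n by (rule finite_subset) auto
  have Icard: "real (card (I n)) \<le> (\<bar>b - \<alpha>\<bar> + 2) * 2 ^ n * (real N + 1)" for n
  proof -
    have "card (I n) \<le> card ({..k n} \<times> {..N})" by (rule card_mono[OF _ Isub]) auto
    then have "real (card (I n)) \<le> (real (k n) + 1) * (real N + 1)"
      by (simp add: card_cartesian_product algebra_simps flip: of_nat_le_iff[where 'a=real])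
    also have "real (k n) + 1 \<le> \<bar>b - \<alpha>\<bar> * 2 ^ n + 2"
    proof -
      have "0 \<le> \<bar>b - \<alpha>\<bar> * 2 ^ n" by simp
      then show ?thesis unfolding k_def by linarith
    qed
    also have "\<bar>b - \<alpha>\<bar> * 2 ^ n + 2 \<le> (\<bar>b - \<alpha>\<bar> + 2) * 2 ^ n" by (simp add: algebra_simps)
    finally show ?thesis by (simp add: mult_right_mono)
  qed
  have Am: "A n i j \<in> sets M" if "(i, j) \<in> I n" for n i j
  proof -
    have "\<alpha> \<le> \<alpha> + real i / 2 ^ n" "\<alpha> + real i / 2 ^ n \<le> \<alpha> + real (i + j) / 2 ^ n"
      by (auto simp: divide_right_mono)
    then have [measurable]: "Y (\<alpha> + real (i + j) / 2 ^ n) \<in> borel_measurable M" "Y (\<alpha> + real i / 2 ^ n) \<in> borel_measurable M"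
      using that by (auto intro!: meas simp: I_def)
    show ?thesis unfolding A_def by measurable
  qed
  define B where "B n = (\<Union>p\<in>I n. case p of (i, j) \<Rightarrow> A n i j)" for n
  have Bm: "B n \<in> sets M" for n
    unfolding B_def by (rule sets.finite_UN[OF Ifin]) (use Am in auto)
  obtain n1 where n1: "real N / 2 ^ n1 < h0"
  proof -
    have "(\<lambda>m. real N * (1 / 2) ^ m) \<longlonglongrightarrow> real N * 0" by (intro tendsto_intros LIMSEQ_power_zero) auto
    then have "\<forall>\<^sub>F m in sequentially. real N * (1 / 2) ^ m < h0" using h0 by (intro order_tendstoD) auto
    then show thesis using that by (auto simp: eventually_sequentially power_one_over)
  qed
  have Ple: "measure M (A n i j) \<le> 2 * exp (- \<theta> * ln 2) ^ n" if p: "(i, j) \<in> I n" and n: "n1 \<le> n" for n i j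
  proof -
    have j: "1 \<le> j" "j \<le> N" "\<alpha> + real (i + j) / 2 ^ n \<le> b" using p by (auto simp: I_def)
    have h: "0 < real j / 2 ^ n" using j by simp
    have "real j / 2 ^ n \<le> real N / 2 ^ n1"
      using j n by (intro frac_le power_increasing) auto
    then have h': "real j / 2 ^ n < h0" using n1 by simp
    have e: "\<alpha> + real i / 2 ^ n + real j / 2 ^ n = \<alpha> + real (i + j) / 2 ^ n" by (simp add: add_divide_distrib)
    let ?x = "sqrt (2 * V' * ln 2) * sqrt (real n * (real j / 2 ^ n))"
    have "measure M (A n i j) \<le> 2 * exp (- ?x\<^sup>2 / (2 * (V * (real j / 2 ^ n))))"
      unfolding A_def e[symmetric] using V by (intro tail h h') (use j e in auto)
    also have "- ?x\<^sup>2 / (2 * (V * (real j / 2 ^ n))) = real n * (- \<theta> * ln 2)"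
      using V h j by (simp add: power_mult_distrib \<theta>_def field_simps)
    finally show ?thesis by (simp only: exp_of_nat_mult)
  qed
  have Bb: "measure M (B n) \<le> (\<bar>b - \<alpha>\<bar> + 2) * (real N + 1) * 2 * exp ((1 - \<theta>) * ln 2) ^ n" if n: "n1 \<le> n" for n
  proof -
    have "measure M (B n) \<le> (\<Sum>p\<in>I n. measure M (case p of (i, j) \<Rightarrow> A n i j))"
      unfolding B_def by (rule finite_measure_subadditive_finite[OF Ifin]) (use Am in auto)
    also have "\<dots> \<le> (\<Sum>p\<in>I n. 2 * exp (- \<theta> * ln 2) ^ n)"
      by (intro sum_mono) (use Ple n in auto)
    also have "\<dots> = real (card (I n)) * (2 * exp (- \<theta> * ln 2) ^ n)" by simp
    also have "\<dots> \<le> ((\<bar>b - \<alpha>\<bar> + 2) * 2 ^ n * (real N + 1)) * (2 * exp (- \<theta> * ln 2) ^ n)"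
      by (rule mult_right_mono[OF Icard]) simp
    also have "\<dots> = (\<bar>b - \<alpha>\<bar> + 2) * (real N + 1) * 2 * (2 * exp (- \<theta> * ln 2)) ^ n"
      by (simp add: power_mult_distrib)
    also have "2 * exp (- \<theta> * ln 2) = exp ((1 - \<theta>) * ln 2)"
      by (simp add: left_diff_distrib exp_diff exp_minus field_simps)
    finally show ?thesis .
  qed
  have "AE \<omega> in M. \<forall>\<^sub>F n in sequentially. \<omega> \<in> space M - B n"
  proof (rule borel_cantelli_AE1)
    have q: "exp ((1 - \<theta>) * ln 2) < 1" using \<theta> by (simp add: mult_neg_pos)
    have "summable (\<lambda>n. (\<bar>b - \<alpha>\<bar> + 2) * (real N + 1) * 2 * exp ((1 - \<theta>) * ln 2) ^ n)"
      by (intro summable_mult summable_geometric) (use q in simp)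
    then show "summable (\<lambda>n. measure M (B n))"
      by (rule summable_comparison_test'[where N=n1]) (use Bb in simp)
  qed (use Bm in \<open>auto simp: emeasure_eq_measure\<close>)
  then show ?thesis
  proof eventually_elim
    case (elim \<omega>)
    then show ?case
    proof eventually_elim
      case (elim n)
      show ?case
      proof (intro allI impI)
        fix i j assume "1 \<le> j" "j \<le> N" "\<alpha> + real (i + j) / 2 ^ n \<le> b"
        then have "(i, j) \<in> I n" by (simp add: I_def)
        then have "\<omega> \<notin> A n i j" using elim by (auto simp: B_def)
        then show "\<bar>Y (\<alpha> + real (i + j) / 2 ^ n) \<omega> - Y (\<alpha> + real i / 2 ^ n) \<omega>\<bar> \<le> sqrt (2 * V' * ln 2) * sqrt (real n * (real j / 2 ^ n))"
          using elim by (simp add: A_def not_less)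
      qed
    qed
  qed
qed

lemma dyadic_level_exists:
  assumes h: "0 < h" and N: "1 \<le> N" and small: "h < real N / 2 ^ n0"
  obtains n where "n0 \<le> n" "real N / 2 ^ n \<le> h" "h < 2 * real N / 2 ^ n"
proof -
  let ?P = "\<lambda>n. real N / 2 ^ n \<le> h"
  have "(\<lambda>m. real N * (1 / 2) ^ m) \<longlonglongrightarrow> real N * 0" by (intro tendsto_intros LIMSEQ_power_zero) auto
  then have "\<forall>\<^sub>F m in sequentially. real N * (1 / 2) ^ m < h" using h by (intro order_tendstoD) auto
  then obtain m where m: "?P m" by (auto simp: eventually_sequentially power_one_over intro: less_imp_le)
  define n where "n = (LEAST n. ?P n)"
  have n: "?P n" unfolding n_def by (rule LeastI[of ?P, OF m])
  have lt: "n0 < n"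
  proof (rule ccontr)
    assume "\<not> n0 < n"
    then have "real N / 2 ^ n0 \<le> real N / 2 ^ n" by (intro divide_left_mono power_increasing) auto
    then show False using n small by simp
  qed
  then obtain n' where n': "n = Suc n'" by (cases n) auto
  have "\<not> ?P n'" unfolding n_def by (rule not_less_Least) (simp add: n'[unfolded n_def])
  then have "h < 2 * real N / 2 ^ n" by (simp add: n')
  with lt n show thesis by (intro that[of n]) auto
qed

text \<open>With \<open>u = 1/N\<close> the grid bound and chaining give the constant \<open>\<Phi> u\<close>, which tends to \<open>\<surd>(2 V)\<close> as \<open>N\<close> grows:
  \<open>V + 2 u\<close> exceeds the variance rate, one factor \<open>1 + u\<close> comes from comparing \<open>n ln 2\<close> with \<open>ln (1/h)\<close>, the
  other from the rounding to the grid, and \<open>20 \<surd>u\<close> from chaining.\<close>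

lemma gaussian_modulus_upper:
  fixes Y :: "real \<Rightarrow> 'w \<Rightarrow> real"
  assumes "prob_space M"
    and meas: "\<And>t. \<alpha> \<le> t \<Longrightarrow> t \<le> b \<Longrightarrow> Y t \<in> borel_measurable M"
    and V: "0 \<le> V" and \<beta>: "\<beta> < b" and \<epsilon>: "0 < \<epsilon>"
    and tail: "\<And>V'. V < V' \<Longrightarrow> \<exists>h0>0. \<forall>t h x. \<alpha> \<le> t \<longrightarrow> 0 < h \<longrightarrow> h < h0 \<longrightarrow> t + h \<le> b \<longrightarrow> 0 \<le> x \<longrightarrow>
       measure M {\<omega>\<in>space M. \<bar>Y (t + h) \<omega> - Y t \<omega>\<bar> > x} \<le> 2 * exp (- x\<^sup>2 / (2 * (V' * h)))"
    and cont: "AE \<omega> in M. continuous_on {\<alpha>..b} (\<lambda>t. Y t \<omega>)"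
  shows "AE \<omega> in M. \<forall>\<^sub>F h in at_right 0. \<forall>t\<in>{\<alpha>..\<beta>}. \<bar>Y (t + h) \<omega> - Y t \<omega>\<bar> \<le> (sqrt (2 * V) + \<epsilon>) * sqrt (h * ln (1 / h))"
proof -
  define \<Phi> where "\<Phi> u = sqrt (2 * (V + 2 * u) * (1 + u)) * (sqrt (1 + u) + 20 * sqrt u)" for u :: real
  have "(\<lambda>N. \<Phi> (1 / real N)) \<longlonglongrightarrow> \<Phi> 0"
    unfolding \<Phi>_def by (intro tendsto_intros lim_1_over_n)
  then have "\<forall>\<^sub>F N in sequentially. \<Phi> (1 / real N) < sqrt (2 * V) + \<epsilon>"
    by (rule order_tendstoD) (simp add: \<Phi>_def \<epsilon>)
  then have "\<forall>\<^sub>F N in sequentially. 1 \<le> N \<and> \<Phi> (1 / real N) < sqrt (2 * V) + \<epsilon>"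
    using eventually_ge_at_top[of 1] by eventually_elim simp
  then obtain N where N: "1 \<le> N" and N\<Phi>: "\<Phi> (1 / real N) < sqrt (2 * V) + \<epsilon>"
    by (auto dest!: eventually_happens'[OF sequentially_bot])
  define u where "u = 1 / real N"
  have u: "0 < u" using N by (simp add: u_def)
  define V1 V2 where "V1 = V + u" and "V2 = V + 2 * u"
  have V12: "0 < V1" "V1 < V2" using V u by (auto simp: V1_def V2_def)
  obtain h0 where h0: "h0 > 0" and tail': "\<And>t h x. \<alpha> \<le> t \<Longrightarrow> 0 < h \<Longrightarrow> h < h0 \<Longrightarrow> t + h \<le> b \<Longrightarrow> 0 \<le> x \<Longrightarrow>
       measure M {\<omega>\<in>space M. \<bar>Y (t + h) \<omega> - Y t \<omega>\<bar> > x} \<le> 2 * exp (- x\<^sup>2 / (2 * (V1 * h)))"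
    using tail[of V1] u by (auto simp: V1_def)
  have ae: "AE \<omega> in M. \<forall>\<^sub>F n in sequentially. \<forall>i j. 1 \<le> j \<longrightarrow> j \<le> 2 * N + 1 \<longrightarrow> \<alpha> + real (i + j) / 2 ^ n \<le> b \<longrightarrow>
       \<bar>Y (\<alpha> + real (i + j) / 2 ^ n) \<omega> - Y (\<alpha> + real i / 2 ^ n) \<omega>\<bar> \<le> sqrt (2 * V2 * ln 2) * sqrt (real n * (real j / 2 ^ n))"
    by (rule gaussian_increments_grid_bound[OF \<open>prob_space M\<close> _ V12 h0]) (fact meas, fact tail')
  define c where "c = sqrt (2 * V2 * ln 2)"
  have c: "0 \<le> c" using V12 by (simp add: c_def)
  show ?thesis
    using ae cont
  proof eventually_elim
    case (elim \<omega>)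
    then obtain n1 where n1: "\<And>n i j. n1 \<le> n \<Longrightarrow> 1 \<le> j \<Longrightarrow> j \<le> 2 * N + 1 \<Longrightarrow> \<alpha> + real (i + j) / 2 ^ n \<le> b \<Longrightarrow>
       \<bar>Y (\<alpha> + real (i + j) / 2 ^ n) \<omega> - Y (\<alpha> + real i / 2 ^ n) \<omega>\<bar> \<le> c * sqrt (real n * (real j / 2 ^ n))"
      unfolding eventually_sequentially c_def by blast
    define n0 where "n0 = max 2 n1"
    define h1 where "h1 = min (min (b - \<beta>) (real N / 2 ^ n0)) (min 1 (exp (- ln (2 * real N) / u)))"
    have h1: "0 < h1" using \<beta> N by (simp add: h1_def)
    have main: "\<bar>Y (t + h) \<omega> - Y t \<omega>\<bar> \<le> (sqrt (2 * V) + \<epsilon>) * sqrt (h * ln (1 / h))"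
      if h: "0 < h" "h < h1" and t: "t \<in> {\<alpha>..\<beta>}" for h t
    proof -
      have hb: "h < b - \<beta>" "h < real N / 2 ^ n0" "h < 1" "h < exp (- ln (2 * real N) / u)"
        using h by (auto simp: h1_def)
      obtain n where n: "n0 \<le> n" "real N / 2 ^ n \<le> h" "h < 2 * real N / 2 ^ n"
        by (rule dyadic_level_exists[OF h(1) N hb(2)])
      have "\<bar>Y (t + h) \<omega> - Y t \<omega>\<bar> \<le> c * sqrt (real n * (h + 1 / 2 ^ n)) + 20 * c * dyadic_scale n"
        by (rule dyadic_chaining[where \<alpha>=\<alpha> and b=b and ?n0.0=n0 and N=N and n=n, OF elim(2) _ N c _ n(1) _ _ n(2,3)])
           (use t hb n1 in \<open>auto simp: n0_def\<close>)
      also have "\<dots> \<le> c * (sqrt (real n * h) * sqrt (1 + u)) + 20 * c * (sqrt (real n * h) * sqrt u)"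
      proof -
        have d: "1 / 2 ^ n \<le> h * u" using n(2) N by (simp add: u_def field_simps)
        have "real n * (h + 1 / 2 ^ n) \<le> (real n * h) * (1 + u)"
          using mult_left_mono[OF d, of "real n"] by (simp add: algebra_simps)
        then have "sqrt (real n * (h + 1 / 2 ^ n)) \<le> sqrt (real n * h) * sqrt (1 + u)"
          unfolding real_sqrt_mult[symmetric] by (rule real_sqrt_le_mono)
        moreover have "real n / 2 ^ n \<le> (real n * h) * u"
          using mult_left_mono[OF d, of "real n"] by (simp add: algebra_simps)
        then have "dyadic_scale n \<le> sqrt (real n * h) * sqrt u"
          unfolding real_sqrt_mult[symmetric] dyadic_scale_def by (rule real_sqrt_le_mono)
        ultimately show ?thesis using c by (intro add_mono mult_left_mono) auto
      qed
      also have "\<dots> = c * sqrt (real n * h) * (sqrt (1 + u) + 20 * sqrt u)" by (simp add: algebra_simps)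
      also have "c * sqrt (real n * h) \<le> sqrt (2 * V2 * (1 + u)) * sqrt (h * ln (1 / h))"
      proof -
        have L: "ln (2 * real N) \<le> u * ln (1 / h)"
        proof -
          have "ln h \<le> - ln (2 * real N) / u" using hb(4) h(1) by (metis less_imp_le ln_exp ln_le_cancel_iff exp_gt_zero)
          then have "u * ln h \<le> - ln (2 * real N)" using u by (simp add: field_simps)
          then show ?thesis using h by (simp add: ln_div)
        qed
        have "real n * ln 2 = ln (2 ^ n)" by (simp add: ln_realpow)
        also have "\<dots> \<le> ln (2 * real N / h)"
          using n(3) h(1) N by (subst ln_le_cancel_iff) (auto simp: field_simps)
        also have "\<dots> = ln (2 * real N) + ln (1 / h)" using h(1) N by (simp add: ln_div)
        also have "\<dots> \<le> (1 + u) * ln (1 / h)" using L by (simp add: algebra_simps)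
        finally have le: "2 * V2 * h * (real n * ln 2) \<le> 2 * V2 * h * ((1 + u) * ln (1 / h))"
          using V12 h by (intro mult_left_mono) auto
        then have "sqrt ((2 * V2 * ln 2) * (real n * h)) \<le> sqrt ((2 * V2 * (1 + u)) * (h * ln (1 / h)))"
        proof (intro real_sqrt_le_mono)
          have "(2 * V2 * ln 2) * (real n * h) = 2 * V2 * h * (real n * ln 2)"
            "(2 * V2 * (1 + u)) * (h * ln (1 / h)) = 2 * V2 * h * ((1 + u) * ln (1 / h))"
            by simp_all
          with le show "(2 * V2 * ln 2) * (real n * h) \<le> (2 * V2 * (1 + u)) * (h * ln (1 / h))" by (simp only:)
        qed
        then show ?thesis by (simp only: c_def real_sqrt_mult)
      qed
      also have "sqrt (2 * V2 * (1 + u)) * sqrt (h * ln (1 / h)) * (sqrt (1 + u) + 20 * sqrt u) = \<Phi> u * sqrt (h * ln (1 / h))"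
        by (simp add: \<Phi>_def V2_def mult_ac)
      also have "\<dots> \<le> (sqrt (2 * V) + \<epsilon>) * sqrt (h * ln (1 / h))"
        using N\<Phi> h(1) hb(3) by (intro mult_right_mono) (auto simp: u_def)
      finally show ?thesis using u by (simp add: mult_right_mono)
    qed
    show ?case unfolding eventually_at_right_field using h1 main by auto
  qed
qed

section \<open>The lower bound for the modulus of continuity\<close>

text \<open>Chebyshev's inequality for the number of events that occur: its variance is at most its mean \<open>m\<close>.\<close>

lemma pairwise_independent_none_le:
  fixes n :: nat
  assumes "prob_space M" and A[measurable]: "\<And>i. i < n \<Longrightarrow> A i \<in> sets M"
    and ind: "\<And>i j. i < n \<Longrightarrow> j < n \<Longrightarrow> i \<noteq> j \<Longrightarrow> measure M (A i \<inter> A j) = measure M (A i) * measure M (A j)"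
    and m: "m = (\<Sum>i<n. measure M (A i))" "0 < m"
  shows "measure M (space M - (\<Union>i<n. A i)) \<le> 1 / m"
proof -
  interpret prob_space M by fact
  let ?N = "space M - (\<Union>i<n. A i)"
  have Nm: "?N \<in> sets M" using A by (intro sets.Diff sets.top sets.finite_UN) auto
  define X where "X \<omega> = (\<Sum>i<n. indicat_real (A i) \<omega>)" for \<omega>
  have sq: "(X \<omega> - m)\<^sup>2 = (\<Sum>i<n. \<Sum>j<n. indicat_real (A i \<inter> A j) \<omega>) - 2 * m * (\<Sum>i<n. indicat_real (A i) \<omega>) + m\<^sup>2" for \<omega>
  proof -
    have "X \<omega> * X \<omega> = (\<Sum>i<n. \<Sum>j<n. indicat_real (A i \<inter> A j) \<omega>)"
      by (simp add: X_def sum_product indicator_inter_arith)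
    moreover have "(X \<omega> - m)\<^sup>2 = X \<omega> * X \<omega> - 2 * m * X \<omega> + m\<^sup>2"
      by (simp add: power2_eq_square algebra_simps)
    ultimately show ?thesis by (simp only: X_def)
  qed
  have i1: "integrable M (\<lambda>\<omega>. \<Sum>i<n. indicat_real (A i) \<omega>)"
    using A by (intro Bochner_Integration.integrable_sum integrable_real_indicator) (auto simp: emeasure_eq_measure)
  have i2: "integrable M (\<lambda>\<omega>. \<Sum>i<n. \<Sum>j<n. indicat_real (A i \<inter> A j) \<omega>)"
    using A by (intro Bochner_Integration.integrable_sum integrable_real_indicator) (auto simp: emeasure_eq_measure)
  have int: "integrable M (\<lambda>\<omega>. (X \<omega> - m)\<^sup>2)"
    unfolding sq using i1 i2 by (intro Bochner_Integration.integrable_add Bochner_Integration.integrable_diff integrable_mult_right) auto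
  have e1: "(\<integral>\<omega>. (\<Sum>i<n. indicat_real (A i) \<omega>) \<partial>M) = m"
    unfolding m using A by (subst Bochner_Integration.integral_sum) (auto simp: emeasure_eq_measure intro!: integrable_real_indicator)
  have e2: "(\<integral>\<omega>. (\<Sum>i<n. \<Sum>j<n. indicat_real (A i \<inter> A j) \<omega>) \<partial>M) = (\<Sum>i<n. \<Sum>j<n. measure M (A i \<inter> A j))"
  proof -
    have "(\<integral>\<omega>. (\<Sum>i<n. \<Sum>j<n. indicat_real (A i \<inter> A j) \<omega>) \<partial>M) = (\<Sum>i<n. \<integral>\<omega>. (\<Sum>j<n. indicat_real (A i \<inter> A j) \<omega>) \<partial>M)"
      using A by (intro Bochner_Integration.integral_sum Bochner_Integration.integrable_sum integrable_real_indicator)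
        (auto simp: emeasure_eq_measure)
    also have "\<dots> = (\<Sum>i<n. \<Sum>j<n. \<integral>\<omega>. indicat_real (A i \<inter> A j) \<omega> \<partial>M)"
      using A by (intro sum.cong refl Bochner_Integration.integral_sum integrable_real_indicator) (auto simp: emeasure_eq_measure)
    also have "\<dots> = (\<Sum>i<n. \<Sum>j<n. measure M (A i \<inter> A j))"
      using A by (intro sum.cong refl) (auto intro!: arg_cong[where f="measure M"] dest: sets.sets_into_space)
    finally show ?thesis .
  qed
  have "(\<integral>\<omega>. (X \<omega> - m)\<^sup>2 \<partial>M) = (\<Sum>i<n. \<Sum>j<n. measure M (A i \<inter> A j)) - 2 * m * m + m\<^sup>2"
  proof -
    have "(\<integral>\<omega>. (X \<omega> - m)\<^sup>2 \<partial>M) = (\<integral>\<omega>. (\<Sum>i<n. \<Sum>j<n. indicat_real (A i \<inter> A j) \<omega>) - 2 * m * (\<Sum>i<n. indicat_real (A i) \<omega>) \<partial>M) + m\<^sup>2"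
      unfolding sq using i1 i2
      by (subst Bochner_Integration.integral_add) (auto simp: prob_space intro!: Bochner_Integration.integrable_diff integrable_mult_right)
    also have "(\<integral>\<omega>. (\<Sum>i<n. \<Sum>j<n. indicat_real (A i \<inter> A j) \<omega>) - 2 * m * (\<Sum>i<n. indicat_real (A i) \<omega>) \<partial>M)
      = (\<Sum>i<n. \<Sum>j<n. measure M (A i \<inter> A j)) - 2 * m * m"
      by (subst Bochner_Integration.integral_diff[OF i2 integrable_mult_right[OF i1]]) (simp add: e1 e2)
    finally show ?thesis .
  qed
  also have "(\<Sum>i<n. \<Sum>j<n. measure M (A i \<inter> A j)) \<le> (\<Sum>i<n. measure M (A i) + (\<Sum>j<n. measure M (A i) * measure M (A j)))"
  proof (rule sum_mono)
    fix i assume i: "i \<in> {..<n}"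
    have "(\<Sum>j<n. measure M (A i \<inter> A j)) \<le> (\<Sum>j<n. (if j = i then measure M (A i) else 0) + measure M (A i) * measure M (A j))"
      using ind i by (intro sum_mono) auto
    also have "\<dots> = measure M (A i) + (\<Sum>j<n. measure M (A i) * measure M (A j))"
      using i by (simp add: sum.distrib)
    finally show "(\<Sum>j<n. measure M (A i \<inter> A j)) \<le> measure M (A i) + (\<Sum>j<n. measure M (A i) * measure M (A j))" .
  qed
  also have "\<dots> = m + m\<^sup>2" by (simp add: sum.distrib m power2_eq_square sum_product)
  finally have var: "(\<integral>\<omega>. (X \<omega> - m)\<^sup>2 \<partial>M) \<le> m" by (simp add: power2_eq_square)
  have "m\<^sup>2 * measure M ?N = (\<integral>\<omega>. m\<^sup>2 * indicat_real ?N \<omega> \<partial>M)" using Nm by simp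
  also have "\<dots> \<le> (\<integral>\<omega>. (X \<omega> - m)\<^sup>2 \<partial>M)"
  proof (rule integral_mono[OF _ int])
    show "integrable M (\<lambda>\<omega>. m\<^sup>2 * indicat_real ?N \<omega>)"
      using Nm by (intro integrable_mult_right integrable_real_indicator) (auto simp: emeasure_eq_measure)
    show "m\<^sup>2 * indicat_real ?N \<omega> \<le> (X \<omega> - m)\<^sup>2" for \<omega>
    proof (cases "\<omega> \<in> ?N")
      case True
      then have "X \<omega> = 0" unfolding X_def by (intro sum.neutral) auto
      then show ?thesis using True by simp
    qed simp
  qed
  finally have "m * (m * measure M ?N) \<le> m * 1" using var by (simp add: power2_eq_square mult.assoc)
  then have "m * measure M ?N \<le> 1" using m(2) by (simp only: mult_le_cancel_left_pos)
  then show ?thesis using m(2) by (simp add: field_simps)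
qed

lemma AE_frequently_of_prob_tendsto_0:
  assumes "prob_space M" and F: "\<And>n. F n \<in> sets M" and lim: "(\<lambda>n::nat. measure M (F n)) \<longlonglongrightarrow> 0"
  shows "AE \<omega> in M. \<exists>\<^sub>F n in sequentially. \<omega> \<notin> F n"
proof -
  interpret prob_space M by fact
  have "AE \<omega> in M. \<exists>n\<ge>k. \<omega> \<notin> F n" for k
  proof (rule AE_I)
    let ?G = "\<Inter>n\<in>{k..}. F n"
    show Gm: "?G \<in> sets M" using F by (intro sets.countable_INT) auto
    show "{\<omega> \<in> space M. \<not> (\<exists>n\<ge>k. \<omega> \<notin> F n)} \<subseteq> ?G" by auto
    have "measure M ?G \<le> 0"
    proof (rule tendsto_lowerbound[OF lim])
      show "\<forall>\<^sub>F n in sequentially. measure M ?G \<le> measure M (F n)"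
        using eventually_ge_at_top[of k] by eventually_elim (auto intro!: finite_measure_mono F)
    qed simp
    then show "emeasure M ?G = 0" by (simp add: emeasure_eq_measure measure_le_0_iff)
  qed
  then have "AE \<omega> in M. \<forall>k. \<exists>n\<ge>k. \<omega> \<notin> F n" by (simp add: AE_all_countable)
  then show ?thesis by (simp add: frequently_sequentially)
qed

text \<open>Over a grid of \<open>n\<close> steps of length \<open>h\<close>, the increments are pairwise independent variables \<open>S\<^sub>i\<close> up to errors \<open>Z\<^sub>i\<close> with
  standard deviation \<open>O(h)\<close>, much below the \<open>\<surd>h\<close> of \<open>S\<^sub>i\<close>.\<close>

definition nearly_independent_increments ::
  "'w measure \<Rightarrow> (real \<Rightarrow> 'w \<Rightarrow> real) \<Rightarrow> real \<Rightarrow> real \<Rightarrow> real \<Rightarrow> real \<Rightarrow> nat \<Rightarrow> bool" where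
  "nearly_independent_increments M Y V C \<alpha> h n \<longleftrightarrow> (\<exists>S Z v z.
     (\<forall>i<n. (\<forall>\<omega>. Y (\<alpha> + real i * h + h) \<omega> - Y (\<alpha> + real i * h) \<omega> = S i \<omega> + Z i \<omega>) \<and>
        centered_gaussian M (S i) (v i) \<and> V * h \<le> v i \<and>
        centered_gaussian M (Z i) (z i) \<and> z i \<le> C * h\<^sup>2) \<and>
     (\<forall>i<n. \<forall>j<n. i \<noteq> j \<longrightarrow> (\<forall>x. measure M {\<omega>\<in>space M. S i \<omega> > x \<and> S j \<omega> > x}
        = measure M {\<omega>\<in>space M. S i \<omega> > x} * measure M {\<omega>\<in>space M. S j \<omega> > x})))"

text \<open>Among \<open>n\<close> increments over steps of length \<open>h = l / n\<close> the expected number of those with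
  \<open>S\<^sub>i > \<rho> \<surd>(2 V h ln (1/h))\<close>, \<open>\<rho> < 1\<close>, is \<open>n powr (1 - \<rho>\<^sup>2)\<close> up to factors of smaller order and tends to infinity, so with
  probability tending to one at least one of them occurs. The errors \<open>Z\<^sub>i\<close> have standard deviation
  \<open>O(h)\<close> and are uniformly negligible. Almost surely, infinitely many
  of a sequence of events whose probabilities tend to one occur.\<close>

lemma gaussian_modulus_lower:
  fixes Y :: "real \<Rightarrow> 'w \<Rightarrow> real"
  assumes "prob_space M" and V: "0 < V" and l: "0 < l" and C: "0 < C" and \<epsilon>: "0 < \<epsilon>" "\<epsilon> < sqrt (2 * V)"
    and meas: "\<And>t. \<alpha> \<le> t \<Longrightarrow> Y t \<in> borel_measurable M"
    and dec: "\<forall>\<^sub>F n in sequentially. nearly_independent_increments M Y V C \<alpha> (l / n) n"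
  shows "AE \<omega> in M. \<exists>\<^sub>F h in at_right 0. \<exists>t\<in>{\<alpha>..<\<alpha> + l}.
    (sqrt (2 * V) - \<epsilon>) * sqrt (h * ln (1 / h)) \<le> \<bar>Y (t + h) \<omega> - Y t \<omega>\<bar>"
proof -
  interpret prob_space M by fact
  define \<rho> where "\<rho> = 1 - \<epsilon> / (2 * sqrt (2 * V))"
  have \<rho>: "0 < \<rho>" "\<rho> < 1" using \<epsilon> V by (auto simp: \<rho>_def field_simps)
  have \<rho>V: "\<rho> * sqrt (2 * V) - \<epsilon> / 2 = sqrt (2 * V) - \<epsilon>" using V by (simp add: \<rho>_def field_simps)
  define L where "L n = ln (real n / l)" for n :: nat
  define h where "h n = l / real n" for n :: nat
  define r where "r n = sqrt (h n * ln (1 / h n))" for n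
  define F where "F n = {\<omega>\<in>space M. \<forall>i<n. \<bar>Y (\<alpha> + real i * h n + h n) \<omega> - Y (\<alpha> + real i * h n) \<omega>\<bar> < (sqrt (2 * V) - \<epsilon>) * r n}" for n
  have h0: "0 \<le> h n" for n using l by (simp add: h_def)
  have Fm: "F n \<in> sets M" for n
  proof -
    have [measurable]: "Y (\<alpha> + real i * h n + h n) \<in> borel_measurable M" "Y (\<alpha> + real i * h n) \<in> borel_measurable M" for i
      using h0[of n] by (auto intro!: meas)
    show ?thesis unfolding F_def by measurable
  qed
  have Lt: "filterlim L at_top sequentially"
    unfolding L_def using l
    by (intro filterlim_compose[OF ln_at_top] filterlim_at_top_mult_tendsto_pos[OF tendsto_const[of "1 / l"] _ filterlim_real_sequentially, simplified]) simp
  have wt: "filterlim (\<lambda>n. sqrt (L n)) at_top sequentially"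
    by (rule filterlim_compose[OF sqrt_at_top Lt])
  \<comment> \<open>The two terms bound the probability that no \<open>S\<^sub>i\<close> is large and that some \<open>Z\<^sub>i\<close> is large.\<close>
  have Fle: "\<forall>\<^sub>F n in sequentially. measure M (F n) \<le> sqrt (2 * pi) / l * inverse (sqrt (L n) + 1 / 2) + 16 * C * l / \<epsilon>\<^sup>2 * inverse (L n)"
    using dec eventually_gt_at_top[of 0] filterlim_at_top_dense[THEN iffD1, OF Lt, rule_format, of 0]
      filterlim_at_top[THEN iffD1, OF wt, rule_format, of "(1 + sqrt 2 * \<rho>) / (1 - \<rho>\<^sup>2)"]
  proof eventually_elim
    case (elim n)
    have n: "0 < n" "0 < L n" "(1 + sqrt 2 * \<rho>) / (1 - \<rho>\<^sup>2) \<le> sqrt (L n)" using elim by auto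
    have hp: "0 < h n" using n l by (simp add: h_def)
    have hL: "ln (1 / h n) = L n" by (simp add: h_def L_def)
    obtain S Z v z where
      SZ: "\<And>i \<omega>. i < n \<Longrightarrow> Y (\<alpha> + real i * h n + h n) \<omega> - Y (\<alpha> + real i * h n) \<omega> = S i \<omega> + Z i \<omega>"
      and S: "\<And>i. i < n \<Longrightarrow> centered_gaussian M (S i) (v i)" "\<And>i. i < n \<Longrightarrow> V * h n \<le> v i"
      and Z: "\<And>i. i < n \<Longrightarrow> centered_gaussian M (Z i) (z i)" "\<And>i. i < n \<Longrightarrow> z i \<le> C * (h n)\<^sup>2"
      and ind: "\<And>i j x. i < n \<Longrightarrow> j < n \<Longrightarrow> i \<noteq> j \<Longrightarrow> measure M {\<omega>\<in>space M. S i \<omega> > x \<and> S j \<omega> > x}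
         = measure M {\<omega>\<in>space M. S i \<omega> > x} * measure M {\<omega>\<in>space M. S j \<omega> > x}"
    proof -
      from elim(1) obtain S Z v z where
        1: "\<forall>i<n. (\<forall>\<omega>. Y (\<alpha> + real i * h n + h n) \<omega> - Y (\<alpha> + real i * h n) \<omega> = S i \<omega> + Z i \<omega>) \<and>
           centered_gaussian M (S i) (v i) \<and> V * h n \<le> v i \<and> centered_gaussian M (Z i) (z i) \<and> z i \<le> C * (h n)\<^sup>2"
        and 2: "\<forall>i<n. \<forall>j<n. i \<noteq> j \<longrightarrow> (\<forall>x. measure M {\<omega>\<in>space M. S i \<omega> > x \<and> S j \<omega> > x}
         = measure M {\<omega>\<in>space M. S i \<omega> > x} * measure M {\<omega>\<in>space M. S j \<omega> > x})"
        unfolding nearly_independent_increments_def h_def by (elim exE conjE)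
      show thesis by (rule that[of S Z v z]) (use 1 2 in simp_all)
    qed
    have Sm[measurable]: "S i \<in> borel_measurable M" and Zm[measurable]: "Z i \<in> borel_measurable M" if "i < n" for i
      using S(1)[OF that] Z(1)[OF that] by (auto simp: centered_gaussian_def)
    have r0: "0 < r n" using hp n by (simp add: r_def hL)
    have r2: "(r n)\<^sup>2 = h n * L n" using hp n by (simp add: r_def hL)
    define x where "x = \<rho> * sqrt (2 * V) * r n"
    define y where "y = \<epsilon> / 2 * r n"
    have x0: "0 \<le> x" and y0: "0 \<le> y" using \<rho> V r0 \<epsilon> by (auto simp: x_def y_def)
    have xy: "x - y = (sqrt (2 * V) - \<epsilon>) * r n" unfolding x_def y_def \<rho>V[symmetric] by (simp add: algebra_simps)
    define A where "A i = {\<omega>\<in>space M. S i \<omega> > x}" for i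
    define B where "B i = {\<omega>\<in>space M. \<bar>Z i \<omega>\<bar> > y}" for i
    have Am: "A i \<in> sets M" and Bm: "B i \<in> sets M" if "i < n" for i
      using Sm[OF that] Zm[OF that] unfolding A_def B_def by measurable
    have sub: "F n \<subseteq> (space M - (\<Union>i<n. A i)) \<union> (\<Union>i<n. B i)"
    proof
      fix \<omega> assume "\<omega> \<in> F n"
      then have w: "\<omega> \<in> space M" "\<And>i. i < n \<Longrightarrow> \<bar>S i \<omega> + Z i \<omega>\<bar> < x - y"
        using SZ by (auto simp: F_def xy)
      show "\<omega> \<in> (space M - (\<Union>i<n. A i)) \<union> (\<Union>i<n. B i)"
      proof (rule ccontr)
        assume "\<not> ?thesis"
        then obtain i where i: "i < n" "S i \<omega> > x" "\<bar>Z i \<omega>\<bar> \<le> y" using w(1) by (auto simp: A_def B_def not_less)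
        then show False using w(2)[OF i(1)] by linarith
      qed
    qed
    have eL: "real n = l * exp (L n)" using n l by (simp add: L_def)
    have mass: "l * (sqrt (L n) + 1 / 2) / sqrt (2 * pi) \<le> (\<Sum>i<n. measure M (A i))"
    proof -
      have xs: "x / sqrt (V * h n) = \<rho> * (sqrt 2 * sqrt (L n))"
        using V hp by (simp add: x_def r_def hL real_sqrt_mult)
      let ?w = "sqrt (L n)"
      have w2: "?w * ?w = L n" using n by simp
      have w1: "1 + sqrt 2 * \<rho> \<le> ?w * (1 - \<rho>\<^sup>2)"
        using n(3) \<rho> by (simp add: pos_divide_le_eq power_less_one_iff)
      have w0: "0 < ?w" using n by simp
      have "?w - 1 / 2 \<le> L n - (\<rho> * (sqrt 2 * ?w) + 1)\<^sup>2 / 2"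
      proof -
        have "L n - (\<rho> * (sqrt 2 * ?w) + 1)\<^sup>2 / 2 = ?w * (?w * (1 - \<rho>\<^sup>2) - sqrt 2 * \<rho>) - 1 / 2"
        proof -
          have "v * v - (\<rho> * (sqrt 2 * v) + 1)\<^sup>2 / 2 = v * (v * (1 - \<rho>\<^sup>2) - sqrt 2 * \<rho>) - 1 / 2" for v
          proof -
            have "(\<rho> * (sqrt 2 * v) + 1)\<^sup>2 = \<rho>\<^sup>2 * 2 * (v * v) + 2 * (\<rho> * (sqrt 2 * v)) + 1"
              by (simp add: power2_sum power_mult_distrib power2_eq_square[of v])
            then show ?thesis by (simp add: algebra_simps)
          qed
          from this[of ?w] show ?thesis by (simp only: w2)
        qed
        moreover have "?w * 1 \<le> ?w * (?w * (1 - \<rho>\<^sup>2) - sqrt 2 * \<rho>)"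
          using w1 w0 by (intro mult_left_mono) auto
        ultimately show ?thesis by simp
      qed
      then have "?w + 1 / 2 \<le> 1 + (L n - (\<rho> * (sqrt 2 * ?w) + 1)\<^sup>2 / 2)" by simp
      also have "\<dots> \<le> exp (L n - (\<rho> * (sqrt 2 * ?w) + 1)\<^sup>2 / 2)" by (rule exp_ge_add_one_self)
      also have "\<dots> = exp (L n) * exp (- (x / sqrt (V * h n) + 1)\<^sup>2 / 2)"
        unfolding xs by (simp flip: exp_add)
      finally have le: "l * (?w + 1 / 2) \<le> l * (exp (L n) * exp (- (x / sqrt (V * h n) + 1)\<^sup>2 / 2))"
        using l by (intro mult_left_mono) auto
      then have "l * (?w + 1 / 2) / sqrt (2 * pi) \<le> real n * (exp (- (x / sqrt (V * h n) + 1)\<^sup>2 / 2) / sqrt (2 * pi))"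
      proof -
        let ?e = "exp (- (x / sqrt (V * h n) + 1)\<^sup>2 / 2)"
        have "l * (exp (L n) * ?e) = (l * exp (L n)) * ?e" by (rule mult.assoc[symmetric])
        also have "\<dots> = real n * ?e" by (simp only: eL[symmetric])
        finally have "l * (exp (L n) * ?e) / sqrt (2 * pi) = real n * (?e / sqrt (2 * pi))" by (simp only: times_divide_eq_right)
        moreover have "l * (?w + 1 / 2) / sqrt (2 * pi) \<le> l * (exp (L n) * ?e) / sqrt (2 * pi)"
          using le by (intro divide_right_mono) auto
        ultimately show ?thesis by (simp only:)
      qed
      also have "\<dots> = (\<Sum>i<n. exp (- (x / sqrt (V * h n) + 1)\<^sup>2 / 2) / sqrt (2 * pi))" by simp
      also have "\<dots> \<le> (\<Sum>i<n. measure M (A i))"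
        unfolding A_def using V hp x0
        by (intro sum_mono centered_gaussian_tail_ge[OF prob_space_axioms S(1,2)]) auto
      finally show ?thesis .
    qed
    have mp: "0 < l * (sqrt (L n) + 1 / 2) / sqrt (2 * pi)" using l n by (auto intro!: divide_pos_pos mult_pos_pos add_pos_pos)
    have none: "measure M (space M - (\<Union>i<n. A i)) \<le> 1 / (\<Sum>i<n. measure M (A i))"
    proof (rule pairwise_independent_none_le[OF prob_space_axioms Am _ refl])
      show "measure M (A i \<inter> A j) = measure M (A i) * measure M (A j)" if "i < n" "j < n" "i \<noteq> j" for i j
      proof -
        have "A i \<inter> A j = {\<omega>\<in>space M. S i \<omega> > x \<and> S j \<omega> > x}" by (auto simp: A_def)
        then show ?thesis using ind[OF that, of x] by (simp add: A_def)
      qed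
      show "0 < (\<Sum>i<n. measure M (A i))" using mp mass by linarith
    qed
    also have "\<dots> \<le> 1 / (l * (sqrt (L n) + 1 / 2) / sqrt (2 * pi))"
      using mp mass by (intro divide_left_mono mult_pos_pos) auto
    also have "\<dots> = sqrt (2 * pi) / l * inverse (sqrt (L n) + 1 / 2)"
    proof -
      have "1 / (l * u / p) = p / l * inverse u" for u p :: real by (simp add: inverse_eq_divide)
      then show ?thesis .
    qed
    finally have P1: "measure M (space M - (\<Union>i<n. A i)) \<le> sqrt (2 * pi) / l * inverse (sqrt (L n) + 1 / 2)" .
    have PB: "measure M (B i) \<le> 16 * C * h n / (\<epsilon>\<^sup>2 * L n)" if i: "i < n" for i
    proof -
      define q where "q = \<epsilon>\<^sup>2 * L n / (8 * C * h n)"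
      have q: "0 < q" using \<epsilon> n C hp by (simp add: q_def)
      have "measure M (B i) \<le> 2 * exp (- y\<^sup>2 / (2 * (C * (h n)\<^sup>2)))"
        unfolding B_def using C hp y0 by (intro centered_gaussian_tail_le[OF prob_space_axioms Z(1,2)[OF i]]) auto
      also have "- y\<^sup>2 / (2 * (C * (h n)\<^sup>2)) = - q"
        unfolding y_def power_mult_distrib r2 q_def using hp C by (simp add: field_simps power2_eq_square)
      also have "exp (- q) \<le> 1 / q"
      proof -
        have "q \<le> exp q" using exp_ge_add_one_self[of q] by linarith
        then show ?thesis using q unfolding exp_minus inverse_eq_divide by (intro divide_left_mono) auto
      qed
      also have "2 * (1 / q) = 16 * C * h n / (\<epsilon>\<^sup>2 * L n)" by (simp add: q_def)
      finally show ?thesis by simp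
    qed
    have "measure M (\<Union>i<n. B i) \<le> (\<Sum>i<n. measure M (B i))"
      by (rule finite_measure_subadditive_finite) (use Bm in auto)
    also have "\<dots> \<le> (\<Sum>i<n. 16 * C * h n / (\<epsilon>\<^sup>2 * L n))" by (intro sum_mono PB) auto
    also have "\<dots> = 16 * C * l / \<epsilon>\<^sup>2 * inverse (L n)" using n by (simp add: h_def inverse_eq_divide)
    finally have P2: "measure M (\<Union>i<n. B i) \<le> 16 * C * l / \<epsilon>\<^sup>2 * inverse (L n)" .
    have "measure M (F n) \<le> measure M ((space M - (\<Union>i<n. A i)) \<union> (\<Union>i<n. B i))"
      using Am Bm by (intro finite_measure_mono sub sets.Un sets.Diff sets.finite_UN sets.top) auto
    also have "\<dots> \<le> measure M (space M - (\<Union>i<n. A i)) + measure M (\<Union>i<n. B i)"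
      using Am Bm by (intro measure_Un_le sets.Diff sets.finite_UN sets.top) auto
    finally show ?case using P1 P2 by linarith
  qed
  have "(\<lambda>n. measure M (F n)) \<longlonglongrightarrow> 0"
  proof (rule tendsto_sandwich[OF _ Fle tendsto_const])
    have w2: "filterlim (\<lambda>n. sqrt (L n) + 1 / 2) at_top sequentially"
      by (subst add.commute) (rule filterlim_tendsto_add_at_top[OF tendsto_const wt])
    have "(\<lambda>n. sqrt (2 * pi) / l * inverse (sqrt (L n) + 1 / 2) + 16 * C * l / \<epsilon>\<^sup>2 * inverse (L n)) \<longlonglongrightarrow>
       sqrt (2 * pi) / l * 0 + 16 * C * l / \<epsilon>\<^sup>2 * 0"
      by (intro tendsto_intros filterlim_compose[OF tendsto_inverse_0_at_top w2] filterlim_compose[OF tendsto_inverse_0_at_top Lt]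
            tendsto_inverse_0_at_top w2 Lt)
    then show "(\<lambda>n. sqrt (2 * pi) / l * inverse (sqrt (L n) + 1 / 2) + 16 * C * l / \<epsilon>\<^sup>2 * inverse (L n)) \<longlonglongrightarrow> 0" by simp
  qed simp
  from AE_frequently_of_prob_tendsto_0[OF prob_space_axioms Fm this] AE_space
  show ?thesis
  proof eventually_elim
    case (elim \<omega>)
    let ?P = "\<lambda>h. \<exists>t\<in>{\<alpha>..<\<alpha> + l}. (sqrt (2 * V) - \<epsilon>) * sqrt (h * ln (1 / h)) \<le> \<bar>Y (t + h) \<omega> - Y t \<omega>\<bar>"
    have ht: "filterlim h (at_right 0) sequentially"
      unfolding filterlim_at
    proof
      have "(\<lambda>n. l * (1 / real n)) \<longlonglongrightarrow> l * 0" by (intro tendsto_intros lim_1_over_n)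
      then show "h \<longlonglongrightarrow> 0" by (simp add: h_def[abs_def])
      show "\<forall>\<^sub>F n in sequentially. h n \<in> {0<..} \<and> h n \<noteq> 0"
        using eventually_gt_at_top[of 0] by eventually_elim (use l in \<open>simp add: h_def\<close>)
    qed
    have imp: "?P (h n)" if notF: "\<omega> \<notin> F n" for n
    proof -
      obtain i where i: "i < n" "(sqrt (2 * V) - \<epsilon>) * r n \<le> \<bar>Y (\<alpha> + real i * h n + h n) \<omega> - Y (\<alpha> + real i * h n) \<omega>\<bar>"
        using notF elim(2) by (auto simp: F_def not_less)
      have "real i * h n < l" using i(1) l by (simp add: h_def field_simps)
      then have "\<alpha> + real i * h n \<in> {\<alpha>..<\<alpha> + l}" using h0[of n] by simp
      then show ?thesis using i(2) unfolding r_def by blast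
    qed
    show "\<exists>\<^sub>F h in at_right 0. ?P h"
      unfolding frequently_def
    proof
      assume "\<forall>\<^sub>F h in at_right 0. \<not> ?P h"
      then have "\<forall>\<^sub>F n in sequentially. \<not> ?P (h n)" using ht by (rule eventually_compose_filterlim)
      then have "\<forall>\<^sub>F n in sequentially. \<not> \<omega> \<notin> F n" by eventually_elim (use imp in blast)
      then show False using elim(1) by (simp add: frequently_def)
    qed
  qed
qed

section \<open>The solution along a characteristic\<close>

lemma has_noise_integral_cong_AE:
  assumes f: "has_noise_integral M W f X" and [measurable]: "g \<in> borel_measurable borel"
    and eq: "AE p in lborel. f p = g p"
  shows "has_noise_integral M W g X"
proof -
  have "(\<integral>\<^sup>+p. ennreal ((f p - s p)\<^sup>2) \<partial>lborel) = (\<integral>\<^sup>+p. ennreal ((g p - s p)\<^sup>2) \<partial>lborel)" for s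
    by (rule nn_integral_cong_AE) (use eq in auto)
  then show ?thesis using f unfolding has_noise_integral_def by simp
qed

lemma mild_solution_char_integral:
  assumes u: "mild_solution a m M W u" and t: "0 \<le> t"
  shows "has_noise_integral M W (char_integrand a m c t) (u (t, t - c))"
proof -
  obtain G where G: "fundamental_solution a m G"
    and N: "\<And>t x. 0 \<le> t \<Longrightarrow> has_noise_integral M W (\<lambda>(s, y). indicator {0..t} s * G (t - s) (x - y)) (u (t, x))"
    using u by (auto simp: mild_solution_def)
  show ?thesis
  proof (rule has_noise_integral_cong_AE[OF N[OF t, of "t - c"] char_integrand_measurable])
    show "AE p in lborel. (case p of (s, y) \<Rightarrow> indicator {0..t} s * G (t - s) (t - c - y)) = char_integrand a m c t p"
      using mild_integrand_eq_green[OF G, of t "t - c"] by (simp add: char_integrand_def)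
  qed
qed

context white_noise_space begin

lemma has_noise_integral_diff:
  assumes "has_noise_integral M W f X" "has_noise_integral M W g Y"
  shows "has_noise_integral M W (\<lambda>p. f p - g p) (\<lambda>\<omega>. X \<omega> - Y \<omega>)"
  using has_noise_integral_lincomb[OF assms, of 1 "- 1"] by simp

lemma has_noise_integral_char_increment:
  assumes "\<And>t. 0 \<le> t \<Longrightarrow> has_noise_integral M W (char_integrand a m c t) (X t)" "0 \<le> t" "0 \<le> h"
  shows "has_noise_integral M W (char_increment a m c t h) (\<lambda>\<omega>. X (t + h) \<omega> - X t \<omega>)"
  unfolding char_increment_def[abs_def] using assms by (intro has_noise_integral_diff) auto

lemma char_increment_tail:
  assumes X: "\<And>t. 0 \<le> t \<Longrightarrow> has_noise_integral M W (char_integrand a m c t) (X t)"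
    and \<alpha>: "0 \<le> \<alpha>" and b: "0 < b" and V: "age_integral a b / 2 < V"
  shows "\<exists>h0>0. \<forall>t h x. \<alpha> \<le> t \<longrightarrow> 0 < h \<longrightarrow> h < h0 \<longrightarrow> t + h \<le> b \<longrightarrow> 0 \<le> x \<longrightarrow>
    prob {\<omega>\<in>space M. \<bar>X (t + h) \<omega> - X t \<omega>\<bar> > x} \<le> 2 * exp (- x\<^sup>2 / (2 * (V * h)))"
proof -
  obtain C where C: "0 < C" and bounds: "\<And>t h. 0 \<le> t \<Longrightarrow> 0 < h \<Longrightarrow> t + h \<le> b \<Longrightarrow> char_increment_bounds a m c C t h"
    by (rule char_increment_estimates[OF b, of a m c], rule that)
  note est = bounds[unfolded char_increment_bounds_def, THEN conjunct2, THEN conjunct1]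
  have V0: "0 < V" using V age_integral_pos[OF b, of a] by linarith
  show ?thesis
  proof (intro exI[of _ "(V - age_integral a b / 2) / C"] conjI allI impI)
    show "0 < (V - age_integral a b / 2) / C" using V C by simp
    fix t h x :: real assume t: "\<alpha> \<le> t" and h: "0 < h" "h < (V - age_integral a b / 2) / C" and th: "t + h \<le> b" and x: "0 \<le> x"
    have G: "centered_gaussian M (\<lambda>\<omega>. X (t + h) \<omega> - X t \<omega>)
        (\<integral>p. (char_increment a m c t h p)\<^sup>2 \<partial>lborel)"
      using t \<alpha> h by (intro has_noise_integral_gaussian has_noise_integral_char_increment X) auto
    have "(\<integral>p. (char_increment a m c t h p)\<^sup>2 \<partial>lborel) \<le> h / 2 * age_integral a (t + h) + C * h\<^sup>2"
      using t \<alpha> h th by (intro est) auto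
    also have "\<dots> \<le> h / 2 * age_integral a b + C * h\<^sup>2"
      using h age_integral_mono[OF th, of a] by (intro add_right_mono mult_left_mono) auto
    also have "\<dots> = h * (age_integral a b / 2 + C * h)" by (simp add: power2_eq_square algebra_simps)
    also have "\<dots> \<le> h * V"
    proof (rule mult_left_mono)
      have "h * C < V - age_integral a b / 2" using h(2) C by (simp only: pos_less_divide_eq)
      then show "age_integral a b / 2 + C * h \<le> V" by (simp add: mult.commute)
    qed (use h in simp)
    finally have v: "(\<integral>p. (char_increment a m c t h p)\<^sup>2 \<partial>lborel) \<le> V * h"
      by (simp add: mult.commute)
    show "prob {\<omega>\<in>space M. \<bar>X (t + h) \<omega> - X t \<omega>\<bar> > x} \<le> 2 * exp (- x\<^sup>2 / (2 * (V * h)))"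
      by (rule centered_gaussian_tail_le[OF prob_space_axioms G v]) (use V0 h x in auto)
  qed
qed

text \<open>\<open>S\<close> is the integral of a step function supported in the strip and within \<open>h\<^sup>3\<close> of the increment there,
  in squared norm; with \<open>\<theta> = h\<close> in \<open>integral_square_diff_le\<close> this costs only \<open>O(h\<^sup>2)\<close> of variance.
  The remainder \<open>Z\<close> collects this error and the part off the strip.\<close>

lemma char_increment_split:
  assumes X: "\<And>t. 0 \<le> t \<Longrightarrow> has_noise_integral M W (char_integrand a m c t) (X t)"
    and t: "0 \<le> t" and h: "0 < h" "h \<le> 1" "t + h \<le> T" and C: "0 < C"
    and est: "char_increment_bounds a m c C t h"
  shows "\<exists>g S Z v z. has_noise_integral M W g S \<and> (\<forall>p. p \<notin> char_strip c t h \<longrightarrow> g p = 0) \<and>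
     (\<forall>\<omega>. X (t + h) \<omega> - X t \<omega> = S \<omega> + Z \<omega>) \<and>
     centered_gaussian M S v \<and> h / 2 * (age_integral a (t + h) - age_integral a h) - (age_integral a T + 2 * C + 2) * h\<^sup>2 \<le> v \<and>
     centered_gaussian M Z z \<and> z \<le> (C + 1) * h\<^sup>2"
proof -
  define \<Delta> where "\<Delta> = char_increment a m c t h"
  let ?D = "char_strip c t h"
  have N: "has_noise_integral M W \<Delta> (\<lambda>\<omega>. X (t + h) \<omega> - X t \<omega>)"
    unfolding \<Delta>_def using t h by (intro has_noise_integral_char_increment X) auto
  have [measurable]: "\<Delta> \<in> borel_measurable borel" using has_noise_integral_measurable(1)[OF N] .
  note est' = est[unfolded char_increment_bounds_def, folded \<Delta>_def]
  obtain g S where g: "has_noise_integral M W g S" "\<And>p. p \<notin> ?D \<Longrightarrow> g p = 0"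
    "integrable lborel (\<lambda>p. (\<Delta> p * indicator ?D p - g p)\<^sup>2)" "(\<integral>p. (\<Delta> p * indicator ?D p - g p)\<^sup>2 \<partial>lborel) < h ^ 3"
    by (rule noise_integral_restrict_approx[OF N char_strip_borel, of "h ^ 3" c t h]) (use h in auto)
  have [measurable]: "g \<in> borel_measurable borel" using has_noise_integral_measurable(1)[OF g(1)] .
  let ?Z = "\<lambda>\<omega>. (X (t + h) \<omega> - X t \<omega>) - S \<omega>"
  note ZN = has_noise_integral_diff[OF N g(1)]
  have int_on: "integrable lborel (\<lambda>p. (\<Delta> p * indicator A p)\<^sup>2)" if [measurable]: "A \<in> sets borel" for A
    by (rule Bochner_Integration.integrable_bound[OF est'[THEN conjunct1]]) (auto simp: indicator_def)
  have "h / 2 * (age_integral a (t + h) - age_integral a h) - (age_integral a T + 2 * C + 2) * h\<^sup>2 \<le> (\<integral>p. (g p)\<^sup>2 \<partial>lborel)"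
  proof -
    let ?F = "\<integral>p. (\<Delta> p * indicator ?D p)\<^sup>2 \<partial>lborel"
    have close: "\<bar>(\<integral>p. (g p)\<^sup>2 \<partial>lborel) - ?F\<bar> \<le> h * ?F + (1 + 1 / h) * (\<integral>p. (\<Delta> p * indicator ?D p - g p)\<^sup>2 \<partial>lborel)"
      by (rule integral_square_diff_le) (use int_on has_noise_integral_gaussian(1)[OF g(1)] g(3) h in auto)
    have "?F \<le> (\<integral>p. (\<Delta> p)\<^sup>2 \<partial>lborel)"
      by (rule integral_mono[OF int_on]) (use est' in \<open>auto simp: indicator_def\<close>)
    also have "\<dots> \<le> h / 2 * age_integral a (t + h) + C * h\<^sup>2" using est' by simp
    also have "\<dots> \<le> h * age_integral a T + C * h"
    proof (intro add_mono)
      have "age_integral a (t + h) \<le> age_integral a T" "0 \<le> age_integral a T"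
        using age_integral_mono[OF h(3)] age_integral_pos[of T a] t h by auto
      then have "h / 2 * age_integral a (t + h) \<le> h / 2 * age_integral a T" "0 \<le> h / 2 * age_integral a T"
        using h by (auto intro!: mult_left_mono)
      then show "h / 2 * age_integral a (t + h) \<le> h * age_integral a T" by simp
      show "C * h\<^sup>2 \<le> C * h" using C h by (auto simp: power2_eq_square mult_le_cancel_left1)
    qed
    finally have "h * ?F \<le> h * (h * age_integral a T + C * h)" using h by (intro mult_left_mono) auto
    also have "\<dots> = (age_integral a T + C) * h\<^sup>2" by (simp add: power2_eq_square algebra_simps)
    finally have F1: "h * ?F \<le> (age_integral a T + C) * h\<^sup>2" .
    have "(1 + 1 / h) * (\<integral>p. (\<Delta> p * indicator ?D p - g p)\<^sup>2 \<partial>lborel) \<le> (1 + 1 / h) * h ^ 3"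
      using g(4) h by (intro mult_left_mono) auto
    also have "\<dots> = h\<^sup>2 * (1 + h)" using h by (simp add: field_simps power2_eq_square power3_eq_cube)
    also have "\<dots> \<le> h\<^sup>2 * 2" using h by (intro mult_left_mono) auto
    finally have F2: "(1 + 1 / h) * (\<integral>p. (\<Delta> p * indicator ?D p - g p)\<^sup>2 \<partial>lborel) \<le> 2 * h\<^sup>2" by simp
    have "h / 2 * (age_integral a (t + h) - age_integral a h) - C * h\<^sup>2 \<le> ?F" using est' by simp
    moreover have "(age_integral a T + 2 * C + 2) * h\<^sup>2 = (age_integral a T + C) * h\<^sup>2 + 2 * h\<^sup>2 + C * h\<^sup>2"
      by (simp add: algebra_simps)
    ultimately show ?thesis using close F1 F2 by linarith
  qed
  moreover have "(\<integral>p. (\<Delta> p - g p)\<^sup>2 \<partial>lborel) \<le> (C + 1) * h\<^sup>2"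
  proof -
    have "(\<Delta> p - g p)\<^sup>2 = (\<Delta> p * indicator (- ?D) p)\<^sup>2 + (\<Delta> p * indicator ?D p - g p)\<^sup>2" for p
      using g(2)[of p] by (cases "p \<in> ?D") auto
    then have "(\<integral>p. (\<Delta> p - g p)\<^sup>2 \<partial>lborel) = (\<integral>p. (\<Delta> p * indicator (- ?D) p)\<^sup>2 \<partial>lborel) + (\<integral>p. (\<Delta> p * indicator ?D p - g p)\<^sup>2 \<partial>lborel)"
      using int_on[of "- ?D"] g(3) by simp
    also have "\<dots> \<le> C * h\<^sup>2 + h ^ 3" using est' g(4) by simp
    also have "h ^ 3 \<le> h\<^sup>2" using h by (intro power_decreasing) auto
    finally show ?thesis by (simp add: algebra_simps)
  qed
  ultimately show ?thesis
    using g(1,2) has_noise_integral_gaussian(2)[OF g(1)] has_noise_integral_gaussian(2)[OF ZN]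
    by (intro exI[of _ g] exI[of _ S] exI[of _ ?Z] exI[of _ "\<integral>p. (g p)\<^sup>2 \<partial>lborel"] exI[of _ "\<integral>p. (\<Delta> p - g p)\<^sup>2 \<partial>lborel"])
       auto
qed

text \<open>The strips that belong to disjoint time intervals are disjoint, which makes the \<open>S\<^sub>i\<close> pairwise
  independent.\<close>

lemma char_increments_decomposition:
  assumes X: "\<And>t. 0 \<le> t \<Longrightarrow> has_noise_integral M W (char_integrand a m c t) (X t)"
    and \<alpha>: "0 < \<alpha>" and l: "0 < l" and V: "V < age_integral a \<alpha> / 2"
  shows "\<exists>C>0. \<forall>\<^sub>F n in sequentially. nearly_independent_increments M X V C \<alpha> (l / n) n"
proof -
  define T where "T = \<alpha> + l"
  have T: "0 < T" using \<alpha> l by (simp add: T_def)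
  obtain C where C: "0 < C" and est: "\<And>t h. 0 \<le> t \<Longrightarrow> 0 < h \<Longrightarrow> t + h \<le> T \<Longrightarrow> char_increment_bounds a m c C t h"
    by (rule char_increment_estimates[OF T, of a m c], rule that)
  define B where "B = age_integral a T + 2 * C + 2"
  have hlim: "(\<lambda>n. l / real n) \<longlonglongrightarrow> 0"
    using tendsto_mult[OF tendsto_const[of l] lim_1_over_n] by simp
  have "(\<lambda>n. age_integral a (l / real n) / 2 + B * (l / real n)) \<longlonglongrightarrow> age_integral a 0 / 2 + B * 0"
    by (intro tendsto_intros hlim isCont_tendsto_compose[OF age_integral_continuous]) simp
  then have "\<forall>\<^sub>F n in sequentially. age_integral a (l / real n) / 2 + B * (l / real n) < age_integral a \<alpha> / 2 - V"
    using V by (intro order_tendstoD(2)) auto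
  moreover have "\<forall>\<^sub>F n in sequentially. l / real n < 1"
    using hlim by (intro order_tendstoD(2)) auto
  ultimately have "\<forall>\<^sub>F n in sequentially. nearly_independent_increments M X V (C + 1) \<alpha> (l / n) n"
    using eventually_gt_at_top[of 0]
  proof eventually_elim
    case (elim n)
    define h where "h = l / real n"
    have h: "0 < h" "h < 1" "age_integral a h / 2 + B * h < age_integral a \<alpha> / 2 - V"
      using elim l by (auto simp: h_def)
    define t where "t i = \<alpha> + real i * h" for i :: nat
    have t0: "0 \<le> t i" for i using \<alpha> h by (simp add: t_def)
    have tT: "t i + h \<le> T" if "i < n" for i
    proof -
      have "real (i + 1) * h \<le> real n * h" using that h by (intro mult_right_mono) auto
      moreover have "real (i + 1) * h = real i * h + h" by (simp add: algebra_simps)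
      moreover have "real n * h = l" using elim by (simp add: h_def)
      ultimately show ?thesis by (simp add: t_def T_def)
    qed
    define splits where "splits i g S Z v z \<longleftrightarrow> has_noise_integral M W g S \<and> (\<forall>p. p \<notin> char_strip c (t i) h \<longrightarrow> g p = 0) \<and>
       (\<forall>\<omega>. X (t i + h) \<omega> - X (t i) \<omega> = S \<omega> + Z \<omega>) \<and>
       centered_gaussian M S v \<and> h / 2 * (age_integral a (t i + h) - age_integral a h) - B * h\<^sup>2 \<le> v \<and>
       centered_gaussian M Z z \<and> z \<le> (C + 1) * h\<^sup>2" for i g S Z v z
    have "\<forall>i. \<exists>q. i < n \<longrightarrow> (case q of (g, S, Z, v, z) \<Rightarrow> splits i g S Z v z)"
    proof
      fix i
      show "\<exists>q. i < n \<longrightarrow> (case q of (g, S, Z, v, z) \<Rightarrow> splits i g S Z v z)"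
      proof (cases "i < n")
        case True
        from char_increment_split[OF X t0 h(1) less_imp_le[OF h(2)] tT[OF True] C est[OF t0 h(1) tT[OF True]]]
        show ?thesis unfolding B_def[symmetric] splits_def[symmetric] by fastforce
      qed simp
    qed
    from choice[OF this] obtain q where q: "\<And>i. i < n \<Longrightarrow> (case q i of (g, S, Z, v, z) \<Rightarrow> splits i g S Z v z)" by blast
    define g S Z v z where "g i = fst (q i)" and "S i = fst (snd (q i))" and "Z i = fst (snd (snd (q i)))"
      and "v i = fst (snd (snd (snd (q i))))" and "z i = snd (snd (snd (snd (q i))))" for i
    have all: "has_noise_integral M W (g i) (S i)" "\<And>p. p \<notin> char_strip c (t i) h \<Longrightarrow> g i p = 0"
       "\<And>\<omega>. X (t i + h) \<omega> - X (t i) \<omega> = S i \<omega> + Z i \<omega>"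
       "centered_gaussian M (S i) (v i)" "h / 2 * (age_integral a (t i + h) - age_integral a h) - B * h\<^sup>2 \<le> v i"
       "centered_gaussian M (Z i) (z i)" "z i \<le> (C + 1) * h\<^sup>2" if "i < n" for i
      using q[OF that] by (auto simp: g_def S_def Z_def v_def z_def splits_def split_beta)
    have Vv: "V * h \<le> v i" if i: "i < n" for i
    proof -
      have "age_integral a \<alpha> \<le> age_integral a (t i + h)" using h(1) by (intro age_integral_mono) (simp add: t_def)
      then have "V \<le> age_integral a (t i + h) / 2 - age_integral a h / 2 - B * h" using h(3) by linarith
      then have "V * h \<le> (age_integral a (t i + h) / 2 - age_integral a h / 2 - B * h) * h"
        using h(1) by (intro mult_right_mono) auto
      also have "\<dots> = h / 2 * (age_integral a (t i + h) - age_integral a h) - B * h\<^sup>2"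
        by (simp add: power2_eq_square field_simps)
      finally show ?thesis using all(5)[OF i] by linarith
    qed
    have disj: "g i p = 0 \<or> g j p = 0" if ij: "i < n" "j < n" "i < j" for i j p
    proof (rule ccontr)
      assume "\<not> ?thesis"
      then have "p \<in> char_strip c (t i) h" "p \<in> char_strip c (t j) h" using all(2) ij by blast+
      then have "t j < t i + h" by (auto simp: char_strip_def)
      moreover have "real (i + 1) * h \<le> real j * h" using ij h by (intro mult_right_mono) auto
      ultimately show False by (simp add: t_def algebra_simps)
    qed
    have ind: "prob {\<omega>\<in>space M. S i \<omega> > x \<and> S j \<omega> > x} = prob {\<omega>\<in>space M. S i \<omega> > x} * prob {\<omega>\<in>space M. S j \<omega> > x}"
      if ij: "i < n" "j < n" "i \<noteq> j" for i j x
    proof -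
      have "g i p = 0 \<or> g j p = 0" for p using disj[of i j p] disj[of j i p] ij by linarith
      from noise_integral_disjoint_independent[OF all(1)[OF ij(1)] all(1)[OF ij(2)] this, of "{x<..}" "{x<..}"]
      show ?thesis by simp
    qed
    have one: "\<forall>i<n. (\<forall>\<omega>. X (\<alpha> + real i * h + h) \<omega> - X (\<alpha> + real i * h) \<omega> = S i \<omega> + Z i \<omega>) \<and>
         centered_gaussian M (S i) (v i) \<and> V * h \<le> v i \<and> centered_gaussian M (Z i) (z i) \<and> z i \<le> (C + 1) * h\<^sup>2"
      using all(3,4,6,7)[unfolded t_def] Vv by simp
    have two: "\<forall>i<n. \<forall>j<n. i \<noteq> j \<longrightarrow> (\<forall>x. prob {\<omega>\<in>space M. S i \<omega> > x \<and> S j \<omega> > x}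
         = prob {\<omega>\<in>space M. S i \<omega> > x} * prob {\<omega>\<in>space M. S j \<omega> > x})"
      using ind by simp
    show ?case
      unfolding nearly_independent_increments_def h_def[symmetric]
      by (rule exI[of _ S], rule exI[of _ Z], rule exI[of _ v], rule exI[of _ z], rule conjI[OF one two])
  qed
  moreover have "0 < C + 1" using C by simp
  ultimately show ?thesis by (intro exI[of _ "C + 1"] conjI)
qed

end

lemma Limsup_ereal_eqI:
  assumes "F \<noteq> bot"
    and up: "\<And>e. 0 < e \<Longrightarrow> \<forall>\<^sub>F h in F. f h \<le> ereal (K + e)"
    and low: "\<And>e. 0 < e \<Longrightarrow> \<exists>\<^sub>F h in F. ereal (K - e) \<le> f h"
  shows "Limsup F f = ereal K"
proof (rule antisym)
  show "Limsup F f \<le> ereal K"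
  proof (rule ereal_le_epsilon2)
    fix e :: real assume "0 < e"
    from Limsup_bounded[OF up[OF this]] show "Limsup F f \<le> ereal K + ereal e" by simp
  qed
  show "ereal K \<le> Limsup F f"
  proof (rule ereal_le_epsilon2)
    fix e :: real assume e: "0 < e"
    have "ereal (K - e) \<le> Limsup F f"
    proof (rule Limsup_greatest)
      fix P assume P: "eventually P F"
      have "\<exists>\<^sub>F h in F. ereal (K - e) \<le> f h \<and> P h"
        by (rule frequently_eventually_frequently[OF low[OF e] P])
      then obtain h where h: "ereal (K - e) \<le> f h" "P h" using frequently_ex by blast
      show "ereal (K - e) \<le> (SUP x\<in>Collect P. f x)"
        by (rule SUP_upper2[of h]) (use h in simp_all)
    qed
    then have "ereal (K - e) + ereal e \<le> Limsup F f + ereal e" by (rule add_right_mono)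
    then show "ereal K \<le> Limsup F f + ereal e" by simp
  qed
qed

lemma connected_real_contains_interior:
  fixes S :: "real set"
  assumes S: "connected S" and bd: "bdd_below S" "bdd_above S" and ne: "x \<in> S" "y \<in> S" "x < y"
  shows "Inf S < Sup S" "S \<subseteq> {Inf S..Sup S}" "{Inf S<..<Sup S} \<subseteq> S"
proof -
  show "S \<subseteq> {Inf S..Sup S}" using bd by (auto intro: cInf_lower cSup_upper)
  show "Inf S < Sup S" using cInf_lower[OF ne(1) bd(1)] cSup_upper[OF ne(2) bd(2)] ne(3) by simp
  show "{Inf S<..<Sup S} \<subseteq> S"
  proof
    fix z assume z: "z \<in> {Inf S<..<Sup S}"
    obtain p where p: "p \<in> S" "p < z" using z cInf_less_iff[of S z] bd ne(1) by auto
    obtain q where q: "q \<in> S" "z < q" using z less_cSup_iff[of S z] bd ne(1) by auto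
    show "z \<in> S" using connectedD_interval[OF S p(1) q(1)] p q by simp
  qed
qed

context white_noise_space begin

text \<open>The upper bound is applied on intervals that extend slightly beyond \<open>\<beta>\<close>, since increments
  starting at \<open>\<beta>\<close> count. The lower bound is applied on intervals just before \<open>\<beta>\<close>, where the
  variance rate is nearly maximal; these lie in \<open>I\<close> whether or not \<open>I\<close> contains its end points. Both constants
  converge to \<open>\<surd>(age_integral a \<beta>)\<close>.\<close>

lemma char_modulus:
  assumes X: "\<And>t. 0 \<le> t \<Longrightarrow> has_noise_integral M W (char_integrand a m c t) (X t)"
    and cont: "AE \<omega> in M. continuous_on {0..} (\<lambda>t. X t \<omega>)"
    and \<alpha>: "0 < \<alpha>" "\<alpha> < \<beta>" and I: "{\<alpha><..<\<beta>} \<subseteq> I" "I \<subseteq> {\<alpha>..\<beta>}"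
  shows "AE \<omega> in M. Limsup (at_right 0) (\<lambda>h. SUP t\<in>I. ereal (\<bar>X (t + h) \<omega> - X t \<omega>\<bar> / sqrt (h * ln (1 / h))))
    = ereal (sqrt (age_integral a \<beta>))"
proof -
  let ?K = "sqrt (age_integral a \<beta>)"
  have meas: "X t \<in> borel_measurable M" if "0 \<le> t" for t using has_noise_integral_measurable(2)[OF X[OF that]] .
  have \<delta>lim: "(\<lambda>k. 1 / real (k + 2)) \<longlonglongrightarrow> 0"
    using LIMSEQ_ignore_initial_segment[OF lim_1_over_n, of 2] by simp
  define \<delta> where "\<delta> k = 1 / real (k + 2)" for k
  have \<delta>: "0 < \<delta> k" "\<delta> k < 1" for k by (auto simp: \<delta>_def)
  have \<delta>0: "\<delta> \<longlonglongrightarrow> 0" using \<delta>lim by (simp add: \<delta>_def[abs_def])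
  define U where "U k = sqrt (age_integral a (\<beta> + \<delta> k)) + \<delta> k" for k
  have U: "U \<longlonglongrightarrow> ?K"
  proof -
    have "U \<longlonglongrightarrow> sqrt (age_integral a (\<beta> + 0)) + 0"
      unfolding U_def[abs_def] by (intro tendsto_intros \<delta>0 isCont_tendsto_compose[OF age_integral_continuous])
    then show ?thesis by simp
  qed
  have up: "AE \<omega> in M. \<forall>\<^sub>F h in at_right 0. \<forall>t\<in>{\<alpha>..\<beta>}. \<bar>X (t + h) \<omega> - X t \<omega>\<bar> \<le> U k * sqrt (h * ln (1 / h))" for k
  proof -
    let ?b = "\<beta> + \<delta> k"
    have b: "0 < ?b" using \<alpha> \<delta>[of k] by simp
    have "AE \<omega> in M. \<forall>\<^sub>F h in at_right 0. \<forall>t\<in>{\<alpha>..\<beta>}.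
       \<bar>X (t + h) \<omega> - X t \<omega>\<bar> \<le> (sqrt (2 * (age_integral a ?b / 2)) + \<delta> k) * sqrt (h * ln (1 / h))"
    proof (rule gaussian_modulus_upper[OF prob_space_axioms, where b="?b"])
      show "0 \<le> age_integral a ?b / 2" using age_integral_pos[OF b] by (simp add: less_imp_le)
      show "\<exists>h0>0. \<forall>t h x. \<alpha> \<le> t \<longrightarrow> 0 < h \<longrightarrow> h < h0 \<longrightarrow> t + h \<le> ?b \<longrightarrow> 0 \<le> x \<longrightarrow>
         prob {\<omega>\<in>space M. \<bar>X (t + h) \<omega> - X t \<omega>\<bar> > x} \<le> 2 * exp (- x\<^sup>2 / (2 * (V' * h)))"
        if "age_integral a ?b / 2 < V'" for V'
        by (rule char_increment_tail[OF X less_imp_le[OF \<alpha>(1)] b that])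
      show "AE \<omega> in M. continuous_on {\<alpha>..?b} (\<lambda>t. X t \<omega>)"
        using cont by eventually_elim (rule continuous_on_subset, use \<alpha> in auto)
    qed (use \<delta>[of k] \<alpha> meas in auto)
    then show ?thesis by (simp add: U_def)
  qed
  define t where "t k = \<beta> - (\<beta> - \<alpha>) * \<delta> k" for k
  define V where "V k = age_integral a (t k) / 2 * (1 - \<delta> k)" for k
  have t: "\<alpha> < t k" "t k < \<beta>" for k
  proof -
    have "(\<beta> - \<alpha>) * \<delta> k < (\<beta> - \<alpha>) * 1" using \<alpha> \<delta>[of k] by (intro mult_strict_left_mono) auto
    then show "\<alpha> < t k" by (simp add: t_def)
    show "t k < \<beta>" using \<alpha> \<delta>[of k] by (simp add: t_def)
  qed
  have V: "0 < V k" "V k < age_integral a (t k) / 2" for k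
    using age_integral_pos[of "t k" a] t[of k] \<alpha> \<delta>[of k] by (auto simp: V_def mult_less_cancel_left2)
  define B where "B k = sqrt (2 * V k) - \<delta> k * sqrt (2 * V k)" for k
  have B: "B \<longlonglongrightarrow> ?K"
  proof -
    have "V \<longlonglongrightarrow> age_integral a (\<beta> - (\<beta> - \<alpha>) * 0) / 2 * (1 - 0)"
      unfolding V_def[abs_def] t_def by (intro tendsto_intros \<delta>0 isCont_tendsto_compose[OF age_integral_continuous]) simp
    then have "B \<longlonglongrightarrow> sqrt (2 * (age_integral a (\<beta> - (\<beta> - \<alpha>) * 0) / 2 * (1 - 0)))
        - 0 * sqrt (2 * (age_integral a (\<beta> - (\<beta> - \<alpha>) * 0) / 2 * (1 - 0)))"
      unfolding B_def[abs_def] by (intro tendsto_intros \<delta>0)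
    then show ?thesis by simp
  qed
  have low: "AE \<omega> in M. \<exists>\<^sub>F h in at_right 0. \<exists>s\<in>I. B k * sqrt (h * ln (1 / h)) \<le> \<bar>X (s + h) \<omega> - X s \<omega>\<bar>" for k
  proof -
    have l: "0 < \<beta> - t k" using t[of k] by simp
    have tp: "0 < t k" using t[of k] \<alpha> by simp
    obtain C where C: "0 < C" and dec: "\<forall>\<^sub>F n in sequentially. nearly_independent_increments M X (V k) C (t k) ((\<beta> - t k) / n) n"
      by (rule exE[OF char_increments_decomposition[OF X tp l V(2)]]) (assumption, elim conjE, rule that)
    have "AE \<omega> in M. \<exists>\<^sub>F h in at_right 0. \<exists>s\<in>{t k..<t k + (\<beta> - t k)}.
       (sqrt (2 * V k) - \<delta> k * sqrt (2 * V k)) * sqrt (h * ln (1 / h)) \<le> \<bar>X (s + h) \<omega> - X s \<omega>\<bar>"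
      by (rule gaussian_modulus_lower[OF prob_space_axioms V(1) l C _ _ _ dec])
         (use V(1)[of k] \<delta>[of k] tp meas in \<open>auto simp: mult_less_cancel_right2\<close>)
    then show ?thesis
    proof eventually_elim
      case (elim \<omega>)
      then show ?case
        by (rule frequently_mono[rotated]) (use t[of k] I in \<open>fastforce simp: B_def\<close>)
    qed
  qed
  have "AE \<omega> in M. \<forall>k. \<forall>\<^sub>F h in at_right 0. \<forall>t\<in>{\<alpha>..\<beta>}. \<bar>X (t + h) \<omega> - X t \<omega>\<bar> \<le> U k * sqrt (h * ln (1 / h))"
    using up by (simp add: AE_all_countable)
  moreover have "AE \<omega> in M. \<forall>k. \<exists>\<^sub>F h in at_right 0. \<exists>s\<in>I. B k * sqrt (h * ln (1 / h)) \<le> \<bar>X (s + h) \<omega> - X s \<omega>\<bar>"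
    using low by (simp add: AE_all_countable)
  ultimately show ?thesis
  proof eventually_elim
    case (elim \<omega>)
    let ?f = "\<lambda>h. SUP t\<in>I. ereal (\<bar>X (t + h) \<omega> - X t \<omega>\<bar> / sqrt (h * ln (1 / h)))"
    have small: "\<forall>\<^sub>F h in at_right 0. 0 < sqrt (h * ln (1 / h))"
      unfolding eventually_at_right_field by (intro exI[of _ 1]) (auto simp: ln_gt_zero)
    show ?case
    proof (rule Limsup_ereal_eqI)
      fix e :: real assume e: "0 < e"
      obtain k where k: "U k < ?K + e"
        using order_tendstoD(2)[OF U, of "?K + e"] e by (auto dest!: eventually_happens'[OF sequentially_bot])
      from elim(1)[rule_format, of k] small
      show "\<forall>\<^sub>F h in at_right 0. ?f h \<le> ereal (?K + e)"
      proof eventually_elim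
        case (elim h)
        show ?case
        proof (rule SUP_least)
          fix s assume "s \<in> I"
          then have "\<bar>X (s + h) \<omega> - X s \<omega>\<bar> \<le> U k * sqrt (h * ln (1 / h))" using elim(1) I by auto
          then have "\<bar>X (s + h) \<omega> - X s \<omega>\<bar> / sqrt (h * ln (1 / h)) \<le> U k" using elim(2) by (simp only: pos_divide_le_eq)
          then show "ereal (\<bar>X (s + h) \<omega> - X s \<omega>\<bar> / sqrt (h * ln (1 / h))) \<le> ereal (?K + e)" using k by simp
        qed
      qed
      obtain k where k: "?K - e < B k"
        using order_tendstoD(1)[OF B, of "?K - e"] e by (auto dest!: eventually_happens'[OF sequentially_bot])
      from frequently_eventually_frequently[OF elim(2)[rule_format, of k] small]
      show "\<exists>\<^sub>F h in at_right 0. ereal (?K - e) \<le> ?f h"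
      proof (rule frequently_elim1)
        fix h assume h: "(\<exists>s\<in>I. B k * sqrt (h * ln (1 / h)) \<le> \<bar>X (s + h) \<omega> - X s \<omega>\<bar>) \<and> 0 < sqrt (h * ln (1 / h))"
        then obtain s where s: "s \<in> I" "B k * sqrt (h * ln (1 / h)) \<le> \<bar>X (s + h) \<omega> - X s \<omega>\<bar>" by blast
        then have "B k \<le> \<bar>X (s + h) \<omega> - X s \<omega>\<bar> / sqrt (h * ln (1 / h))" using h by (simp only: pos_le_divide_eq)
        then show "ereal (?K - e) \<le> ?f h" using s(1) k by (intro SUP_upper2) auto
      qed
    qed simp
  qed
qed

end

text \<open>A subinterval of the segment is the graph of \<open>t \<mapsto> t - c\<close> over an interval of times, to which
  \<open>char_modulus\<close> applies.\<close>

theorem theorem1p2: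
  fixes a m w\<^sub>0 a\<^sub>1 a\<^sub>2 :: real
  assumes "w\<^sub>0 \<ge> 0" and "0 < a\<^sub>1" and "a\<^sub>1 < a\<^sub>2"
  shows "\<exists>C\<^sub>1 C\<^sub>2 :: real. 0 < C\<^sub>1 \<and> C\<^sub>1 < C\<^sub>2 \<and>
    (\<forall>(M :: 'w measure) W u.
       prob_space M \<longrightarrow> complete_measure M \<longrightarrow> white_noise M W \<longrightarrow> mild_solution a m M W u \<longrightarrow>
       (\<forall>J. subinterval_of J (char_segment w\<^sub>0 a\<^sub>1 a\<^sub>2) \<longrightarrow>
         (\<exists>K\<in>{C\<^sub>1..C\<^sub>2}. AE \<omega> in M.
            Limsup (at_right 0) (\<lambda>h. SUP (t, x)\<in>J.
              ereal (\<bar>u (t + h, x + h) \<omega> - u (t, x) \<omega>\<bar> / sqrt (h * ln (1 / h)))) = ereal K)))"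
proof -
  define c where "c = sqrt 2 * w\<^sub>0"
  define T\<^sub>1 T\<^sub>2 where "T\<^sub>1 = (a\<^sub>1 + w\<^sub>0) / sqrt 2" and "T\<^sub>2 = (a\<^sub>2 + w\<^sub>0) / sqrt 2"
  have T: "0 < T\<^sub>1" "T\<^sub>1 < T\<^sub>2" using assms by (auto simp: T\<^sub>1_def T\<^sub>2_def divide_strict_right_mono)
  show ?thesis
  proof (rule exI[of _ "sqrt (age_integral a T\<^sub>1)"], rule exI[of _ "sqrt (age_integral a T\<^sub>2)"], intro conjI allI impI)
    show "0 < sqrt (age_integral a T\<^sub>1)" "sqrt (age_integral a T\<^sub>1) < sqrt (age_integral a T\<^sub>2)"
      using age_integral_pos[OF T(1)] age_integral_less[OF T(2)] by auto
    fix M :: "'w measure" and W u J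
    assume M: "prob_space M" and W: "white_noise M W" and u: "mild_solution a m M W u"
      and J: "subinterval_of J (char_segment w\<^sub>0 a\<^sub>1 a\<^sub>2)"
    interpret white_noise_space M W
      using M W by (simp add: white_noise_space_def white_noise_space_axioms_def)
    have seg: "x = t - c \<and> T\<^sub>1 \<le> t \<and> t \<le> T\<^sub>2" if "(t, x) \<in> J" for t x
    proof -
      have *: "(t - x) / sqrt 2 = w\<^sub>0" "a\<^sub>1 \<le> (t + x) / sqrt 2" "(t + x) / sqrt 2 \<le> a\<^sub>2"
        using that J by (auto simp: subinterval_of_def char_segment_def)
      have "t - x = c" using *(1) by (simp add: c_def field_simps)
      moreover have s2: "(t + x) / sqrt 2 + w\<^sub>0 = t * sqrt 2"
      proof -
        have "(t + x) / sqrt 2 + w\<^sub>0 = 2 * t / sqrt 2" unfolding *(1)[symmetric] by (simp flip: add_divide_distrib)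
        also have "\<dots> = t * sqrt 2" by (simp add: real_divide_square_eq field_simps)
        finally show ?thesis .
      qed
      have "a\<^sub>1 + w\<^sub>0 \<le> t * sqrt 2" "t * sqrt 2 \<le> a\<^sub>2 + w\<^sub>0" unfolding s2[symmetric] using *(2,3) by auto
      then have "T\<^sub>1 \<le> t" "t \<le> T\<^sub>2" by (simp_all add: T\<^sub>1_def T\<^sub>2_def pos_divide_le_eq pos_le_divide_eq)
      ultimately show ?thesis by simp
    qed
    define I where "I = fst ` J"
    define \<alpha> \<beta> where "\<alpha> = Inf I" and "\<beta> = Sup I"
    have conn: "connected I" unfolding I_def using J by (intro connected_continuous_image continuous_intros) (auto simp: subinterval_of_def)
    have Isub: "I \<subseteq> {T\<^sub>1..T\<^sub>2}" using seg by (auto simp: I_def)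
    then have bd: "bdd_below I" "bdd_above I" by (meson bdd_below_Icc bdd_below_mono bdd_above_Icc bdd_above_mono)+
    obtain p q where pq: "p \<in> I" "q \<in> I" "p < q"
    proof -
      obtain p q where "p \<in> J" "q \<in> J" "p \<noteq> q" using J by (auto simp: subinterval_of_def)
      then have "fst p \<in> I" "fst q \<in> I" "fst p \<noteq> fst q"
        using seg[of "fst p" "snd p"] seg[of "fst q" "snd q"] by (auto simp: I_def prod_eq_iff)
      then show thesis using that by (metis linorder_neqE)
    qed
    note ab = connected_real_contains_interior[OF conn bd pq, folded \<alpha>_def \<beta>_def]
    have \<alpha>T: "T\<^sub>1 \<le> \<alpha>" unfolding \<alpha>_def using Isub pq by (intro cInf_greatest) auto
    have \<beta>T: "\<beta> \<le> T\<^sub>2" unfolding \<beta>_def using Isub pq by (intro cSup_least) auto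
    have "AE \<omega> in M. Limsup (at_right 0) (\<lambda>h. SUP t\<in>I. ereal (\<bar>u (t + h, (t + h) - c) \<omega> - u (t, t - c) \<omega>\<bar> / sqrt (h * ln (1 / h))))
      = ereal (sqrt (age_integral a \<beta>))"
    proof (rule char_modulus[where X="\<lambda>t. u (t, t - c)" and \<alpha>=\<alpha>, OF mild_solution_char_integral[OF u]])
      have "AE \<omega> in M. continuous_on ({0..} \<times> UNIV) (\<lambda>p. u p \<omega>)" using u by (simp add: mild_solution_def)
      then show "AE \<omega> in M. continuous_on {0..} (\<lambda>t. u (t, t - c) \<omega>)"
        by eventually_elim (erule continuous_on_compose2, auto intro!: continuous_intros)
    qed (use ab \<alpha>T T in auto)
    moreover have "(SUP (t, x)\<in>J. ereal (\<bar>u (t + h, x + h) \<omega> - u (t, x) \<omega>\<bar> / r))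
        = (SUP t\<in>I. ereal (\<bar>u (t + h, (t + h) - c) \<omega> - u (t, t - c) \<omega>\<bar> / r))" for h r \<omega>
      unfolding I_def image_image
    proof (rule SUP_cong[OF refl])
      fix p assume p: "p \<in> J"
      obtain t x where tx: "p = (t, x)" by (cases p)
      have x: "x = t - c" using seg[of t x] p tx by simp
      have xh: "t - c + h = (t + h) - c" by simp
      show "(case p of (t, x) \<Rightarrow> ereal (\<bar>u (t + h, x + h) \<omega> - u (t, x) \<omega>\<bar> / r))
        = ereal (\<bar>u (fst p + h, (fst p + h) - c) \<omega> - u (fst p, fst p - c) \<omega>\<bar> / r)"
        by (simp only: tx x xh prod.case fst_conv)
    qed
    ultimately have "AE \<omega> in M. Limsup (at_right 0) (\<lambda>h. SUP (t, x)\<in>J.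
              ereal (\<bar>u (t + h, x + h) \<omega> - u (t, x) \<omega>\<bar> / sqrt (h * ln (1 / h)))) = ereal (sqrt (age_integral a \<beta>))"
      by simp
    moreover have "sqrt (age_integral a \<beta>) \<in> {sqrt (age_integral a T\<^sub>1)..sqrt (age_integral a T\<^sub>2)}"
      using age_integral_mono[OF \<beta>T, of a] age_integral_mono[of T\<^sub>1 \<beta> a] \<alpha>T ab(1) by simp
    ultimately show "\<exists>K\<in>{sqrt (age_integral a T\<^sub>1)..sqrt (age_integral a T\<^sub>2)}. AE \<omega> in M.
            Limsup (at_right 0) (\<lambda>h. SUP (t, x)\<in>J.
              ereal (\<bar>u (t + h, x + h) \<omega> - u (t, x) \<omega>\<bar> / sqrt (h * ln (1 / h)))) = ereal K"
      by blast
  qed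
qed

end
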